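(* The generating function of ascending polyominoes counted by semi-perimeter, $A(t)=\sum_{P}t^{|P|}$ (sum over all ascending polyominoes $P$, $|P|$ the semi-perimeter), is \[A(t)=\frac{t^2(2-12t+19t^2-4t^3)}{2(1-4t)^2}-\frac{t^4(5-8t)}{2(1-2t)(1-4t)^{3/2}}.\]
   Context: A polyomino is a finite edge-connected set of unit cells; it is convex if every row and column is a contiguous segment; its semi-perimeter is the width plus the height of its minimal bounding rectangle. A NW-path inside $P$ is a sequence of cells of $P$, consecutive cells sharing an edge, each step North or West; write $a\nwarrow b$ if such a path exists, let $D_{NW}(a,b)$ be the minimum number of direction changes over such paths, and $D_{NW}(P)=\max\{D_{NW}(a,b):a\nwarrow b\}$. A convex polyomino is ascending if $D_{NW}(P)\le1$. *)

theory Defs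
  imports
    "HOL-Computational_Algebra.Formal_Power_Series"
    "HOL-Library.Product_Plus"
begin

text \<open>
  The pair \<open>(x, y)\<close> stands for the unit cell with lower left corner \<open>(x, y)\<close>:
  North increases \<open>y\<close> and West decreases \<open>x\<close>.
\<close>

type_synonym cell = "int \<times> int"

definition edge_adjacent :: "cell \<Rightarrow> cell \<Rightarrow> bool" where
  "edge_adjacent a b \<longleftrightarrow> \<bar>fst a - fst b\<bar> + \<bar>snd a - snd b\<bar> = 1"

definition edge_connected :: "cell set \<Rightarrow> bool" where
  "edge_connected P \<longleftrightarrow>
     (\<forall>a\<in>P. \<forall>b\<in>P. (a, b) \<in> {(u, v). u \<in> P \<and> v \<in> P \<and> edge_adjacent u v}\<^sup>*)"

definition polyomino :: "cell set \<Rightarrow> bool" where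
  "polyomino P \<longleftrightarrow> finite P \<and> P \<noteq> {} \<and> edge_connected P"

definition convex_polyomino :: "cell set \<Rightarrow> bool" where
  "convex_polyomino P \<longleftrightarrow> polyomino P \<and>
     (\<forall>y x1 x x2. (x1, y) \<in> P \<longrightarrow> (x2, y) \<in> P \<longrightarrow> x1 \<le> x \<longrightarrow> x \<le> x2 \<longrightarrow> (x, y) \<in> P) \<and>
     (\<forall>x y1 y y2. (x, y1) \<in> P \<longrightarrow> (x, y2) \<in> P \<longrightarrow> y1 \<le> y \<longrightarrow> y \<le> y2 \<longrightarrow> (x, y) \<in> P)"

definition width :: "cell set \<Rightarrow> nat" where
  "width P = nat (Max (fst ` P) - Min (fst ` P) + 1)"

definition height :: "cell set \<Rightarrow> nat" where
  "height P = nat (Max (snd ` P) - Min (snd ` P) + 1)"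

definition semi_perimeter :: "cell set \<Rightarrow> nat" where
  "semi_perimeter P = width P + height P"

definition nw_step :: "cell \<Rightarrow> cell \<Rightarrow> bool" where
  "nw_step a b \<longleftrightarrow> b - a = (0, 1) \<or> b - a = (-1, 0)"

text \<open>A path may consist of a single cell, so every cell of \<open>P\<close> is reachable from itself.\<close>

definition nw_path :: "cell set \<Rightarrow> cell \<Rightarrow> cell list \<Rightarrow> cell \<Rightarrow> bool" where
  "nw_path P a p b \<longleftrightarrow>
     p \<noteq> [] \<and> hd p = a \<and> last p = b \<and> set p \<subseteq> P \<and> successively nw_step p"

definition nw_reach :: "cell set \<Rightarrow> cell \<Rightarrow> cell \<Rightarrow> bool" where
  "nw_reach P a b \<longleftrightarrow> (\<exists>p. nw_path P a p b)"

definition direction_changes :: "cell list \<Rightarrow> nat" where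
  "direction_changes p =
     card {i. i + 2 < length p \<and> p ! (i + 1) - p ! i \<noteq> p ! (i + 2) - p ! (i + 1)}"

definition D_NW_cells :: "cell set \<Rightarrow> cell \<Rightarrow> cell \<Rightarrow> nat" where
  "D_NW_cells P a b = Inf {direction_changes p | p. nw_path P a p b}"

definition D_NW :: "cell set \<Rightarrow> nat" where
  "D_NW P = Max {D_NW_cells P a b | a b. nw_reach P a b}"

definition ascending :: "cell set \<Rightarrow> bool" where
  "ascending P \<longleftrightarrow> convex_polyomino P \<and> D_NW P \<le> 1"

text \<open>Polyominoes are counted up to translation.\<close>

definition translation :: "(cell set \<times> cell set) set" where
  "translation = {(P, Q). \<exists>v. Q = (+) v ` P}"

text \<open>
  The sum of \<open>t ^ semi_perimeter P\<close> over all ascending \<open>P\<close>, collected by powers of \<open>t\<close>; for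
  each \<open>n\<close> there are only finitely many translation classes, so \<^const>\<open>card\<close> counts them.
\<close>

definition ascending_gf :: "real fps" where
  "ascending_gf =
     Abs_fps (\<lambda>n. of_nat (card ({P. ascending P \<and> semi_perimeter P = n} // translation)))"

text \<open>
  \<^term>\<open>fps_binomial c\<close> is the series of \<open>(1 + t) powr c\<close>, so this is the
  branch of \<open>(1 - 4 * t) powr (3 / 2)\<close> with constant coefficient \<open>1\<close>.
\<close>

definition one_minus_4t_three_halves :: "real fps" where
  "one_minus_4t_three_halves = fps_binomial (3 / 2) oo (- 4 * fps_X)"

end

theory Submission imports Defs begin

text \<open>
  A convex polyomino is ascending iff no column has both ends strictly higher than those of a column
  further east. Cutting such a polyomino at the first column touching the bottom line and at the last
  one touching the top line leaves a parallelogram polyomino \<open>M\<close> flanked by two nested chains \<open>G\<close> (to the west) and \<open>H\<close> (to the east).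
  Conversely a triple \<open>(G, M, H)\<close> gives an ascending polyomino iff no column of \<open>H\<close> lies below one of
  \<open>G\<close>, so that the required number is that of all triples minus that of the crossing ones.

  All triples are counted by a transfer recursion on the height of the last column of \<open>M\<close>. In a
  crossing triple the tails of \<open>G\<close> and \<open>H\<close> from the first crossing on can be exchanged; this
  involution swaps the bottom end \<open>e\<close> of the outermost column of \<open>G\<close> with the top end \<open>f\<close> of the
  outermost column of \<open>H\<close>, and reduces the count to the triples with \<open>e \<ge> f\<close>. There the four boundary
  paths are independent, and the sum of the resulting products of four binomial coefficients obeys a
  recursion of Pascal type.
\<close>

text \<open>Nonempty columns and overlapping neighbours in \<open>M\<close> are what couples the
  boundary paths of a crossing triple. When \<open>e \<ge> f\<close>, every lower edge of
  \<open>M\<close> and \<open>H\<close> is at most \<open>f - 1\<close> and every upper edge of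
  \<open>G\<close> and \<open>M\<close> at least \<open>e + 1\<close>, so these conditions hold by
  themselves. This is why the exchange of tails is built to negate \<open>e - f\<close>; its unit
  shifts keep the crossing strict, so that the same crossing is found again and the exchange can be
  undone.

  The square root enters twice. The pairs \<open>(G, M)\<close> have the series t^2 / sqrt(1 - 4t),
  found by the kernel method, and the crossing count contains the coefficients (2N + 1) C(2N, N) of
  (1 - 4t)^(-3/2). The factor 1 - 2t of the second denominator reflects the two neighbour terms in
  the recursion for the products of four binomials: they become a doubling once all sizes with
  \<open>A + B = n\<close> are added up.\<close>

section \<open>A cyclic sum of products of four binomials\<close>

definition gch :: "int \<Rightarrow> nat \<Rightarrow> real" where
  "gch x k = of_int x gchoose k"

lemma gch_0 [simp]: "gch x 0 = 1"
  by (simp add: gch_def)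

lemma gch_pascal: "gch x (Suc k) = gch (x - 1) (Suc k) + gch (x - 1) k"
  using gbinomial_Suc_Suc[of "of_int (x - 1) :: real" k] by (simp add: gch_def)

lemma gch_nat: "gch (int n) k = of_nat (n choose k)"
  by (simp add: gch_def binomial_gbinomial)

lemma gch_minus_one: "gch (int k - 1) k = (if k = 0 then 1 else 0)"
proof (cases k)
  case (Suc m)
  then have "gch (int k - 1) k = gch (int m) (Suc m)" by simp
  then show ?thesis using Suc by (simp only: gch_nat) simp
qed simp

text \<open>
  The four factors count the boundary paths of a crossing triple, arranged cyclically like the sails
  of a windmill. The upper arguments may be negative, because the recursion is proved by lowering
  the offsets to \<open>-1\<close>.
\<close>

definition mill :: "nat \<Rightarrow> nat \<Rightarrow> int \<Rightarrow> int \<Rightarrow> int \<Rightarrow> int \<Rightarrow> real" where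
  "mill A B s1 s2 r1 r2 = (\<Sum>a\<le>A. \<Sum>g\<le>B.
     gch (int g + int a + s1) g * gch (int a + int (B - g) + r1) a *
     gch (int (B - g) + int (A - a) + s2) (B - g) * gch (int (A - a) + int g + r2) (A - a))"

lemma sum_atMost_rev: "(\<Sum>k\<le>(n::nat). f k) = (\<Sum>k\<le>n. f (n - k))"
  by (rule sum.reindex_bij_witness[where i = "\<lambda>k. n - k" and j = "\<lambda>k. n - k"]) auto

lemma sum2_atMost_rev:
  "(\<Sum>k\<le>(m::nat). \<Sum>l\<le>(n::nat). f k l) = (\<Sum>k\<le>m. \<Sum>l\<le>n. f (m - k) (n - l))"
  by (subst sum_atMost_rev, rule sum.cong[OF refl], rule sum_atMost_rev)

lemma mill_rotate: "mill A B s1 s2 r1 r2 = mill A B s2 s1 r2 r1"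
proof -
  have "mill A B s1 s2 r1 r2 = (\<Sum>a\<le>A. \<Sum>g\<le>B.
     gch (int (B - g) + int (A - a) + s1) (B - g) * gch (int (A - a) + int (B - (B - g)) + r1) (A - a) *
     gch (int (B - (B - g)) + int (A - (A - a)) + s2) (B - (B - g)) * gch (int (A - (A - a)) + int (B - g) + r2) (A - (A - a)))"
    unfolding mill_def by (rule sum2_atMost_rev)
  also have "\<dots> = mill A B s2 s1 r2 r1"
    unfolding mill_def by (intro sum.cong refl) (simp add: mult_ac)
  finally show ?thesis .
qed

text \<open>A quarter turn of the cycle; \<open>mill_rotate\<close> is the half turn. Together they
  bring any of the four offsets into the place of \<open>s1\<close>, the only one for which Pascal's
  rule is worked out.\<close>

lemma mill_swap: "mill A B s1 s2 r1 r2 = mill B A r2 r1 s1 s2"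
proof -
  have "mill A B s1 s2 r1 r2 = (\<Sum>g\<le>B. \<Sum>a\<le>A.
     gch (int g + int a + s1) g * gch (int a + int (B - g) + r1) a *
     gch (int (B - g) + int (A - a) + s2) (B - g) * gch (int (A - a) + int g + r2) (A - a))"
    unfolding mill_def by (rule sum.swap)
  also have "\<dots> = (\<Sum>g\<le>B. \<Sum>a\<le>A.
     gch (int g + int (A - a) + s1) g * gch (int (A - a) + int (B - g) + r1) (A - a) *
     gch (int (B - g) + int (A - (A - a)) + s2) (B - g) * gch (int (A - (A - a)) + int g + r2) (A - (A - a)))"
    by (rule sum.cong[OF refl], rule sum_atMost_rev)
  also have "\<dots> = mill B A r2 r1 s1 s2"
    unfolding mill_def by (intro sum.cong refl) (simp add: add_ac mult_ac)
  finally show ?thesis .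
qed

text \<open>Pascal's rule for the factor with offset \<open>s1\<close>. Its second term has
  \<open>g\<close> shifted by one: this lowers \<open>B\<close>, leaves \<open>B - g\<close> alone
  and raises the argument \<open>A - a + g\<close> of the last factor, hence
  \<open>r2 + 1\<close>.\<close>

lemma mill_pascal:
  "mill A (Suc B) s1 s2 r1 r2 = mill A (Suc B) (s1 - 1) s2 r1 r2 + mill A B s1 s2 r1 (r2 + 1)"
proof -
  have *: "(\<Sum>g\<le>Suc B. gch (int g + int a + s1) g * h g) =
        (\<Sum>g\<le>Suc B. gch (int g + int a + (s1 - 1)) g * h g) + (\<Sum>g\<le>B. gch (int g + int a + s1) g * h (Suc g))"
    for a and h :: "nat \<Rightarrow> real"
  proof -
    have "gch (int (Suc g) + int a + s1) (Suc g) =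
        gch (int (Suc g) + int a + (s1 - 1)) (Suc g) + gch (int g + int a + s1) g" for g
      using gch_pascal[of "int (Suc g) + int a + s1" g] by (simp add: algebra_simps)
    then show ?thesis
      by (simp add: sum.atMost_Suc_shift ring_distribs sum.distrib del: sum.atMost_Suc)
  qed
  have "mill A (Suc B) s1 s2 r1 r2 = (\<Sum>a\<le>A. \<Sum>g\<le>Suc B.
     gch (int g + int a + s1) g * (gch (int a + int (Suc B - g) + r1) a *
     gch (int (Suc B - g) + int (A - a) + s2) (Suc B - g) * gch (int (A - a) + int g + r2) (A - a)))"
    unfolding mill_def by (simp add: mult.assoc del: sum.atMost_Suc)
  also have "\<dots> = mill A (Suc B) (s1 - 1) s2 r1 r2 + mill A B s1 s2 r1 (r2 + 1)"
    unfolding * mill_def sum.distrib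
    by (intro arg_cong2[where f = "(+)"] sum.cong refl) (simp_all add: mult.assoc algebra_simps)
  finally show ?thesis .
qed

lemma mill_pascal_0: "mill A 0 s1 s2 r1 r2 = mill A 0 s1' s2' r1 r2"
  by (simp add: mill_def)

definition mill_left :: "nat \<Rightarrow> nat \<Rightarrow> int \<Rightarrow> int \<Rightarrow> int \<Rightarrow> int \<Rightarrow> real" where
  "mill_left A B s1 s2 r1 r2 = (if A = 0 then 0 else mill (A - 1) B s1 s2 r1 r2)"

definition mill_down :: "nat \<Rightarrow> nat \<Rightarrow> int \<Rightarrow> int \<Rightarrow> int \<Rightarrow> int \<Rightarrow> real" where
  "mill_down A B s1 s2 r1 r2 = (if B = 0 then 0 else mill A (B - 1) s1 s2 r1 r2)"

text \<open>A predicate, so that the induction can carry the recursion through the two symmetries.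
  Neighbours of negative size count as 0.\<close>

definition mill_rec :: "nat \<Rightarrow> nat \<Rightarrow> int \<Rightarrow> int \<Rightarrow> int \<Rightarrow> int \<Rightarrow> bool" where
  "mill_rec A B s1 s2 r1 r2 \<longleftrightarrow> mill A B s1 s2 r1 r2 =
     mill_left A B s1 s2 r1 r2 + mill_down A B s1 s2 r1 r2 +
     gch (int (A + B) + s1 + s2) B * gch (int (A + B) + r1 + r2) A"

lemma mill_rec_rotate: "mill_rec A B s1 s2 r1 r2 = mill_rec A B s2 s1 r2 r1"
  by (simp add: mill_rec_def mill_left_def mill_down_def mill_rotate[of _ _ s1] add_ac)

lemma mill_rec_swap: "mill_rec A B s1 s2 r1 r2 = mill_rec B A r2 r1 s1 s2"
  by (simp add: mill_rec_def mill_left_def mill_down_def mill_swap[of _ _ s1] add_ac mult_ac)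

text \<open>All terms of the recursion split by the same Pascal rule. In the product only the first
  binomial splits; the second is the same for both parts because \<open>r2 + 1\<close> makes up for
  \<open>B - 1\<close>.\<close>

lemma mill_rec_step:
  assumes "mill_rec A B (s1 - 1) s2 r1 r2" and "B > 0 \<Longrightarrow> mill_rec A (B - 1) s1 s2 r1 (r2 + 1)"
  shows "mill_rec A B s1 s2 r1 r2"
proof (cases B)
  case 0
  then show ?thesis using assms(1)
    by (simp add: mill_rec_def mill_left_def mill_down_def mill_pascal_0[of _ "s1 - 1" s2 _ _ s1 s2])
next
  case (Suc C)
  have L: "mill_left A B s1 s2 r1 r2 = mill_left A B (s1 - 1) s2 r1 r2 + mill_left A C s1 s2 r1 (r2 + 1)"
    by (simp add: mill_left_def Suc mill_pascal[of _ _ s1])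
  have D: "mill_down A B s1 s2 r1 r2 = mill_down A B (s1 - 1) s2 r1 r2 + mill_down A C s1 s2 r1 (r2 + 1)"
    by (cases C) (simp_all add: mill_down_def Suc mill_pascal[of _ _ s1] mill_pascal_0[of _ "s1 - 1" s2 _ _ s1 s2])
  have "gch (int (A + B) + s1 + s2) B = gch (int (A + B) + (s1 - 1) + s2) B + gch (int (A + C) + s1 + s2) C"
    using gch_pascal[of "int (A + B) + s1 + s2" C] Suc by (simp add: algebra_simps)
  moreover have "int (A + C) + r1 + (r2 + 1) = int (A + B) + r1 + r2" using Suc by simp
  ultimately show ?thesis
    using assms L D mill_pascal[of A C s1 s2 r1 r2] Suc
    unfolding mill_rec_def by (simp add: algebra_simps)
qed

text \<open>At offset \<open>-1\<close> either all four summation variables vanish or none does, because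
  \<open>gch (k - 1) k = 0\<close> for \<open>k > 0\<close>.\<close>

lemma mill_corner_0:
  assumes "0 < A + B" and "A < 2 \<or> B < 2"
  shows "mill A B (-1) (-1) (-1) (-1) = 0"
proof -
  have z: "gch (int k - 1) k = (if k = 0 then 1 else 0)" for k by (rule gch_minus_one)
  show ?thesis
    unfolding mill_def
  proof (intro sum.neutral ballI)
    fix a g assume "a \<in> {..A}" "g \<in> {..B}"
    then consider "a = 0" | "g = 0" | "a = A" | "g = B" using assms by force
    then show "gch (int g + int a + - 1) g * gch (int a + int (B - g) + - 1) a *
      gch (int (B - g) + int (A - a) + - 1) (B - g) * gch (int (A - a) + int g + - 1) (A - a) = 0"
      by cases (use assms z[of A] z[of B] z[of a] z[of g] z[of "A - a"] z[of "B - g"] in \<open>auto split: if_splits\<close>)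
  qed
qed

lemma gch_sym: "gch (int (k + l)) k = gch (int (k + l)) l"
  using binomial_symmetric[of k "k + l"] by (simp only: gch_nat) simp

text \<open>Only terms with all four variables positive survive. Lowering each variable by one turns
  a factor C(k + l - 1, k) into C(k' + l' + 1, k' + 1) = C(k' + l' + 1, l'), so every factor now
  selects its other variable; reversing the sum over \<open>g\<close> restores the cyclic
  shape.\<close>

lemma mill_corner:
  "mill (Suc (Suc A)) (Suc (Suc B)) (-1) (-1) (-1) (-1) = mill A B 1 1 1 1"
proof -
  let ?A = "Suc (Suc A)" and ?B = "Suc (Suc B)"
  define T where "T a g = gch (int g + int a + - 1) g * gch (int a + int (?B - g) + - 1) a *
     gch (int (?B - g) + int (?A - a) + - 1) (?B - g) * gch (int (?A - a) + int g + - 1) (?A - a)" for a g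
  have z: "gch (int k - 1) k = (if k = 0 then 1 else 0)" for k by (rule gch_minus_one)
  have g0: "T a 0 = 0" "T a ?B = 0" for a
    using z[of a] z[of "?B"] z[of "?A - a"] by (auto simp: T_def)
  have a0: "T 0 g = 0" "T ?A g = 0" for g
    using z[of g] z[of "?A"] z[of "?B - g"] by (auto simp: T_def)
  have a0': "sum (T 0) X = 0" "sum (T ?A) X = 0" for X
    by (simp_all add: a0)
  have T: "T (Suc a) (Suc g) =
     gch (int (B - g) + int a + 1) (B - g) * gch (int a + int g + 1) a *
     gch (int g + int (A - a) + 1) g * gch (int (A - a) + int (B - g) + 1) (A - a)"
    if "a \<le> A" "g \<le> B" for a g
  proof -
    have sym: "gch (int (Suc k) + int (Suc l) + - 1) (Suc k) = gch (int l + int k + 1) l" for k l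
      using gch_sym[of "Suc k" l] by (simp add: algebra_simps)
    have "Suc (A - a) = ?A - Suc a" "Suc (B - g) = ?B - Suc g" using that by auto
    then show ?thesis
      unfolding T_def using sym[of g a] sym[of a "B - g"] sym[of "B - g" "A - a"] sym[of "A - a" g]
      by (simp add: mult_ac)
  qed
  have "mill ?A ?B (-1) (-1) (-1) (-1) = (\<Sum>a\<le>?A. \<Sum>g\<le>?B. T a g)"
    by (simp add: mill_def T_def)
  also have "\<dots> = (\<Sum>a\<le>A. \<Sum>g\<le>?B. T (Suc a) g)"
    by (simp only: sum.atMost_Suc[of _ "Suc A"] sum.atMost_Suc_shift[of _ A] a0'
        add_0_left add_0_right)
  also have "\<dots> = (\<Sum>a\<le>A. \<Sum>g\<le>B. T (Suc a) (Suc g))"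
    by (simp only: sum.atMost_Suc[of _ "Suc B"] sum.atMost_Suc_shift[of _ B] g0 add_0_left add_0_right)
  also have "\<dots> = (\<Sum>a\<le>A. \<Sum>g\<le>B.
     gch (int (B - g) + int a + 1) (B - g) * gch (int a + int g + 1) a *
     gch (int g + int (A - a) + 1) g * gch (int (A - a) + int (B - g) + 1) (A - a))"
    by (intro sum.cong refl) (simp add: T)
  also have "\<dots> = mill A B 1 1 1 1"
    unfolding mill_def by (rule sum.cong[OF refl], subst sum_atMost_rev) (simp add: diff_diff_cancel)
  finally show ?thesis .
qed

text \<open>Double induction. Lowering an offset keeps \<open>A + B\<close> and is covered by the
  inner induction on the total offset; the other Pascal term raises an offset but has smaller
  \<open>A + B\<close> and is covered by the outer one. With all offsets \<open>-1\<close>,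
  \<open>mill_corner\<close> leads to sizes smaller by two.\<close>

lemma mill_rec:
  assumes "- 1 \<le> s1" "- 1 \<le> s2" "- 1 \<le> r1" "- 1 \<le> r2"
  shows "mill_rec A B s1 s2 r1 r2"
  using assms
proof (induction "A + B" arbitrary: A B s1 s2 r1 r2 rule: less_induct)
  case less
  note outer = less.hyps
  show ?case
    using less.prems
  proof (induction "nat (s1 + s2 + r1 + r2 + 4)" arbitrary: s1 s2 r1 r2 rule: less_induct)
    case less
    note inner = less.hyps and prems = less.prems
    consider "s1 \<ge> 0" | "s2 \<ge> 0" | "r1 \<ge> 0" | "r2 \<ge> 0" | "s1 = - 1" "s2 = - 1" "r1 = - 1" "r2 = - 1"
      using prems by linarith
    then show ?case
    proof cases
      case 1
      show ?thesis
        by (rule mill_rec_step; (rule inner outer)?) (use 1 prems in auto)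
    next
      case 2
      show ?thesis
        by (subst mill_rec_rotate, rule mill_rec_step; subst mill_rec_rotate; (rule inner outer)?) (use 2 prems in auto)
    next
      case 3
      show ?thesis
        by (subst mill_rec_swap, subst mill_rec_rotate, rule mill_rec_step; subst mill_rec_rotate; subst mill_rec_swap;
            (rule inner outer)?) (use 3 prems in auto)
    next
      case 4
      show ?thesis
        by (subst mill_rec_swap, rule mill_rec_step; subst mill_rec_swap; (rule inner outer)?) (use 4 prems in auto)
    next
      case 5
      have "mill_rec A B (- 1) (- 1) (- 1) (- 1)"
      proof (cases "A \<ge> 2 \<and> B \<ge> 2")
        case True
        then obtain C D where AB: "A = Suc (Suc C)" "B = Suc (Suc D)" by (metis add_2_eq_Suc le_Suc_ex)
        have rec: "mill_rec C D 1 1 1 1" using AB by (intro outer) auto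
        \<comment> \<open>If \<open>C = 0\<close>, the mill on the left has first size 1, too small
          for positive variables, and vanishes as the right side does.\<close>
        have L: "mill_left A B (-1) (-1) (-1) (-1) = mill_left C D 1 1 1 1"
          by (cases C) (simp_all add: mill_left_def AB mill_corner mill_corner_0)
        have R: "mill_down A B (-1) (-1) (-1) (-1) = mill_down C D 1 1 1 1"
          by (cases D) (simp_all add: mill_down_def AB mill_corner mill_corner_0)
        \<comment> \<open>Here \<open>A + B - 2 = C + D + 2\<close>; by symmetry of binomials
          choosing \<open>B = D + 2\<close> is choosing \<open>C\<close>, and choosing
          \<open>A\<close> is choosing \<open>D\<close>. The two factors of the product trade
          places.\<close>
        have "gch (int (A + B) + - 1 + - 1) B = gch (int (C + D) + 1 + 1) C"
             "gch (int (A + B) + - 1 + - 1) A = gch (int (C + D) + 1 + 1) D"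
          using gch_sym[of B C] gch_sym[of A D] by (simp_all add: AB algebra_simps)
        then show ?thesis
          using rec unfolding mill_rec_def L R by (simp add: AB mill_corner)
      next
        case False
        consider "A = 0" "B = 0" | "A = 1" "B = 0" | "A = 0" "B = 1" | "A + B \<ge> 2" by linarith
        then show ?thesis
        proof cases
          case 4
          have "gch (int (A + B) + - 1 + - 1) k = of_nat ((A + B - 2) choose k)" for k
            using gch_nat[of "A + B - 2" k] 4 by simp
          moreover have "A + B - 2 < A \<or> A + B - 2 < B" using False 4 by auto
          ultimately have "gch (int (A + B) + - 1 + - 1) B * gch (int (A + B) + - 1 + - 1) A = 0" by auto
          then show ?thesis using False 4
            by (auto simp: mill_rec_def mill_left_def mill_down_def mill_corner_0)
        qed (simp_all add: mill_rec_def mill_left_def mill_down_def mill_corner_0 gch_def, simp_all add: mill_def gch_def)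
      qed
      then show ?thesis using 5 by simp
    qed
  qed
qed

definition millsum :: "nat \<Rightarrow> nat \<Rightarrow> nat \<Rightarrow> real" where
  "millsum m r n = (\<Sum>A\<le>n. mill A (n - A) (int m) (int m) (int r) (int r))"

lemma millsum_0: "millsum m r 0 = 1"
  by (simp add: millsum_def mill_def)

text \<open>Adding the recursion over \<open>A + B = Suc n\<close>, each of the two neighbour terms
  sweeps level \<open>n\<close> once, which gives the factor 2, and Vandermonde's convolution merges
  the products. Only \<open>m + r\<close> survives in the new term.\<close>

lemma millsum_Suc:
  "millsum m r (Suc n) = 2 * millsum m r n + of_nat ((2 * Suc n + 2 * (m + r)) choose Suc n)"
proof -
  let ?s = "int m" and ?r = "int r" and ?N = "Suc n"
  have "mill A (?N - A) ?s ?s ?r ?r = mill_left A (?N - A) ?s ?s ?r ?r + mill_down A (?N - A) ?s ?s ?r ?r +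
      of_nat (((?N + 2 * m) choose (?N - A)) * ((?N + 2 * r) choose A))" if "A \<le> ?N" for A
  proof -
    have "int (A + (?N - A)) + ?s + ?s = int (?N + 2 * m)" "int (A + (?N - A)) + ?r + ?r = int (?N + 2 * r)"
      using that by simp_all
    then show ?thesis
      using mill_rec[of ?s ?s ?r ?r A "?N - A"] unfolding mill_rec_def by (simp only: gch_nat) simp
  qed
  then have "millsum m r ?N = (\<Sum>A\<le>?N. mill_left A (?N - A) ?s ?s ?r ?r) + (\<Sum>A\<le>?N. mill_down A (?N - A) ?s ?s ?r ?r) +
      of_nat (\<Sum>A\<le>?N. ((?N + 2 * r) choose A) * ((?N + 2 * m) choose (?N - A)))"
    unfolding millsum_def by (simp add: sum.distrib mult.commute del: sum.atMost_Suc)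
  also have "(\<Sum>A\<le>?N. mill_left A (?N - A) ?s ?s ?r ?r) = millsum m r n"
    unfolding sum.atMost_Suc_shift by (simp add: mill_left_def millsum_def)
  also have "(\<Sum>A\<le>?N. mill_down A (?N - A) ?s ?s ?r ?r) = millsum m r n"
    by (auto simp: mill_down_def millsum_def Suc_diff_le intro!: sum.cong)
  also have "(\<Sum>A\<le>?N. ((?N + 2 * r) choose A) * ((?N + 2 * m) choose (?N - A))) = (2 * ?N + 2 * (m + r)) choose ?N"
    using vandermonde[of "?N + 2 * r" "?N + 2 * m" ?N] by (simp add: algebra_simps del: sum.atMost_Suc)
  finally show ?thesis by simp
qed

section \<open>Exchanging the ends of two crossing arms\<close>

text \<open>
  The column \<open>(l, u)\<close> consists of the cells at heights \<open>l, \<dots>, u - 1\<close>.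
\<close>

type_synonym col = "int \<times> int"

fun nested :: "int \<Rightarrow> int \<Rightarrow> col list \<Rightarrow> bool" where
  "nested L U [] \<longleftrightarrow> True"
| "nested L U (c # cs) \<longleftrightarrow> L \<le> fst c \<and> fst c < snd c \<and> snd c \<le> U \<and> nested (fst c) (snd c) cs"

lemma nested_iff_nth:
  "nested L U cs \<longleftrightarrow>
     (cs \<noteq> [] \<longrightarrow> L \<le> fst (cs ! 0) \<and> snd (cs ! 0) \<le> U) \<and>
     (\<forall>i. Suc i < length cs \<longrightarrow> fst (cs ! i) \<le> fst (cs ! Suc i) \<and> snd (cs ! Suc i) \<le> snd (cs ! i)) \<and>
     (\<forall>i < length cs. fst (cs ! i) < snd (cs ! i))"
proof (induction cs arbitrary: L U)
  case (Cons c cs)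
  show ?case
    by (simp only: nested.simps Cons) (cases cs; auto simp: All_less_Suc2)
qed simp

lemma nested_append:
  "nested L U (xs @ ys) \<longleftrightarrow>
     nested L U xs \<and> (if xs = [] then nested L U ys else nested (fst (last xs)) (snd (last xs)) ys)"
  by (induction xs arbitrary: L U) auto

lemma nested_nth_mono:
  assumes "nested L U cs" "i \<le> j" "j < length cs"
  shows "fst (cs ! i) \<le> fst (cs ! j)" "snd (cs ! j) \<le> snd (cs ! i)"
proof -
  have "fst (cs ! i) \<le> fst (cs ! j) \<and> snd (cs ! j) \<le> snd (cs ! i)"
    using assms(2,3)
  proof (induction j rule: dec_induct)
    case (step n)
    then show ?case using assms(1) by (fastforce simp: nested_iff_nth)
  qed simp
  then show "fst (cs ! i) \<le> fst (cs ! j)" "snd (cs ! j) \<le> snd (cs ! i)" by auto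
qed

lemma nested_bounds:
  assumes "nested L U cs" "c \<in> set cs"
  shows "L \<le> fst c" "fst c < snd c" "snd c \<le> U"
  using assms by (induction cs arbitrary: L U) fastforce+

definition below :: "col \<Rightarrow> col \<Rightarrow> bool" where
  "below h g \<longleftrightarrow> fst h < fst g \<and> snd h < snd g"

text \<open>
  If the columns \<open>G\<close> and \<open>H\<close> have lower edges \<open>l\<close>, \<open>l'\<close> and upper edges \<open>u\<close>, \<open>u'\<close>, then the exchanged
  tails have lower edges \<open>tl l' + 1\<close> followed by \<open>last u'\<close> and \<open>hd l'\<close> followed by \<open>butlast l - 1\<close>, and
  upper edges \<open>hd u\<close> followed by \<open>butlast u' + 1\<close> and \<open>tl u - 1\<close> followed by \<open>last l\<close>.
\<close>

definition upper_tail :: "col list \<Rightarrow> col list \<Rightarrow> col list" where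
  "upper_tail G H = map (\<lambda>k. (if Suc k < length H then fst (H ! Suc k) + 1 else snd (last H),
                              if k = 0 then snd (hd G) else snd (H ! (k - 1)) + 1)) [0..<length H]"

definition lower_tail :: "col list \<Rightarrow> col list \<Rightarrow> col list" where
  "lower_tail G H = map (\<lambda>k. (if k = 0 then fst (hd H) else fst (G ! (k - 1)) - 1,
                              if Suc k < length G then snd (G ! Suc k) - 1 else fst (last G))) [0..<length G]"

lemma length_tails [simp]:
  "length (upper_tail G H) = length H" "length (lower_tail G H) = length G"
  by (simp_all add: upper_tail_def lower_tail_def)

lemma tails_Nil [simp]:
  "upper_tail G H = [] \<longleftrightarrow> H = []" "lower_tail G H = [] \<longleftrightarrow> G = []"
  using length_tails[of G H] by (metis length_0_conv)+

lemma tails_last: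
  "H \<noteq> [] \<Longrightarrow> fst (last (upper_tail G H)) = snd (last H)"
  "G \<noteq> [] \<Longrightarrow> snd (last (lower_tail G H)) = fst (last G)"
  by (simp_all add: last_conv_nth) (simp_all add: upper_tail_def lower_tail_def last_conv_nth)

text \<open>The new tails again start with a crossing pair, and the two outer edges at the crossing,
  the top of \<open>hd G\<close> and the bottom of \<open>hd H\<close>, are kept.\<close>

lemma tails_hd:
  assumes "nested L U G" "nested L' U' H" "G \<noteq> []" "H \<noteq> []" "below (hd H) (hd G)"
  shows "snd (hd (upper_tail G H)) = snd (hd G)" "fst (hd (lower_tail G H)) = fst (hd H)"
    "fst (hd H) < fst (hd (upper_tail G H))" "snd (hd (lower_tail G H)) < snd (hd G)"
proof -
  have "fst (H ! 0) \<le> fst (H ! 1)" if "1 < length H"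
    using nested_nth_mono[OF assms(2), of 0 1] that by simp
  moreover have "snd (G ! 1) \<le> snd (G ! 0)" if "1 < length G"
    using nested_nth_mono[OF assms(1), of 0 1] that by simp
  moreover have "fst (hd H) < snd (last H)"
    using nested_bounds[OF assms(2), of "last H"] nested_nth_mono[OF assms(2), of 0 "length H - 1"] assms(4)
    by (simp add: hd_conv_nth last_conv_nth)
  moreover have "fst (last G) < snd (hd G)"
    using nested_bounds[OF assms(1), of "last G"] nested_nth_mono[OF assms(1), of 0 "length G - 1"] assms(3)
    by (simp add: hd_conv_nth last_conv_nth)
  ultimately show "snd (hd (upper_tail G H)) = snd (hd G)" "fst (hd (lower_tail G H)) = fst (hd H)"
    "fst (hd H) < fst (hd (upper_tail G H))" "snd (hd (lower_tail G H)) < snd (hd G)"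
    using assms(3,4) by (auto simp: upper_tail_def lower_tail_def hd_map hd_conv_nth)
qed

text \<open>A new column at position \<open>i\<close> of the upper tail takes its bottom from
  \<open>H ! Suc i\<close> and its top from \<open>H ! (i - 1)\<close>; it is nonempty because
  \<open>H\<close> is nested. At position 0 the top comes from \<open>G\<close> and the strict
  inequalities of \<open>below\<close> are needed. The lower tail is the mirror image. The bounds on
  \<open>L1\<close>, \<open>U1\<close>, \<open>L2\<close>, \<open>U2\<close> are what the columns in
  front of the tails must satisfy.\<close>

lemma tails_nested:
  assumes "nested L U G" "nested L' U' H" "G \<noteq> []" "H \<noteq> []" "below (hd H) (hd G)"
    and "L1 \<le> fst (hd H) + 1" "snd (hd G) \<le> U1"
    and "L2 \<le> fst (hd H)" "snd (hd G) \<le> U2 + 1"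
  shows "nested L1 U1 (upper_tail G H)" "nested L2 U2 (lower_tail G H)"
proof -
  note hds = tails_hd[OF assms(1-5)]
  have G: "fst (G ! i) \<le> fst (G ! Suc i)" "snd (G ! Suc i) \<le> snd (G ! i)" if "Suc i < length G" for i
    using assms(1) that by (auto simp: nested_iff_nth)
  have H: "fst (H ! i) \<le> fst (H ! Suc i)" "snd (H ! Suc i) \<le> snd (H ! i)" if "Suc i < length H" for i
    using assms(2) that by (auto simp: nested_iff_nth)
  have Gp: "fst (G ! i) < snd (G ! i)" if "i < length G" for i
    using assms(1) that by (auto simp: nested_iff_nth)
  have Hp: "fst (H ! i) < snd (H ! i)" if "i < length H" for i
    using assms(2) that by (auto simp: nested_iff_nth)
  have b: "fst (H ! 0) < fst (G ! 0)" "snd (H ! 0) < snd (G ! 0)"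
    using assms(3-5) by (auto simp: below_def hd_conv_nth)
  show "nested L1 U1 (upper_tail G H)"
    unfolding nested_iff_nth
  proof (intro conjI impI allI)
    assume "upper_tail G H \<noteq> []"
    then show "L1 \<le> fst (upper_tail G H ! 0)" "snd (upper_tail G H ! 0) \<le> U1"
      using hds assms(6,7) by (auto simp flip: hd_conv_nth)
  next
    fix i assume i: "Suc i < length (upper_tail G H)"
    have "fst (H ! Suc i) < snd (last H)" if "Suc (Suc i) = length H"
    proof -
      have "length H - 1 = Suc i" using that by linarith
      then show ?thesis using Hp[of "Suc i"] assms(4) that by (simp add: last_conv_nth)
    qed
    moreover have "Suc (Suc i) = length H" if "\<not> Suc (Suc i) < length H" using that i by simp
    ultimately show "fst (upper_tail G H ! i) \<le> fst (upper_tail G H ! Suc i)"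
      using i H(1)[of "Suc i"] by (auto simp: upper_tail_def)
    show "snd (upper_tail G H ! Suc i) \<le> snd (upper_tail G H ! i)"
      using i H(2)[of "i - 1"] b assms(3,4) by (cases i) (auto simp: upper_tail_def hd_conv_nth)
  next
    fix i assume i: "i < length (upper_tail G H)"
    have le: "snd (H ! j) \<le> snd (H ! k)" if "k \<le> j" "j < length H" for j k
      using nested_nth_mono(2)[OF assms(2) that] .
    have "snd (last H) \<le> snd (H ! (i - 1))"
      using le[of "i - 1" "length H - 1"] i assms(4) by (simp add: last_conv_nth)
    moreover have "snd (last H) < snd (G ! 0)" using le[of 0 "length H - 1"] b assms(4) by (simp add: last_conv_nth)
    moreover have "fst (H ! Suc i) < snd (H ! (i - 1))" "fst (H ! Suc i) + 1 < snd (G ! 0)" if "Suc i < length H"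
      using Hp[OF that] le[OF _ that, of "i - 1"] le[OF _ that, of 0] b by linarith+
    ultimately show "fst (upper_tail G H ! i) < snd (upper_tail G H ! i)"
      using i assms(3) by (auto simp: upper_tail_def hd_conv_nth)
  qed
  show "nested L2 U2 (lower_tail G H)"
    unfolding nested_iff_nth
  proof (intro conjI impI allI)
    assume "lower_tail G H \<noteq> []"
    then show "L2 \<le> fst (lower_tail G H ! 0)" "snd (lower_tail G H ! 0) \<le> U2"
      using hds assms(8,9) by (auto simp flip: hd_conv_nth)
  next
    fix i assume i: "Suc i < length (lower_tail G H)"
    have "fst (last G) \<le> snd (G ! Suc i) - 1" if "Suc (Suc i) = length G"
    proof -
      have "length G - 1 = Suc i" using that by linarith
      then show ?thesis using Gp[of "Suc i"] assms(3) that by (simp add: last_conv_nth)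
    qed
    moreover have "Suc (Suc i) = length G" if "\<not> Suc (Suc i) < length G" using that i by simp
    ultimately show "snd (lower_tail G H ! Suc i) \<le> snd (lower_tail G H ! i)"
      using i G(2)[of "Suc i"] by (auto simp: lower_tail_def)
    show "fst (lower_tail G H ! i) \<le> fst (lower_tail G H ! Suc i)"
      using i G(1)[of "i - 1"] b assms(3,4) by (cases i) (auto simp: lower_tail_def hd_conv_nth)
  next
    fix i assume i: "i < length (lower_tail G H)"
    have le: "fst (G ! k) \<le> fst (G ! j)" if "k \<le> j" "j < length G" for j k
      using nested_nth_mono(1)[OF assms(1) that] .
    have "fst (G ! (i - 1)) \<le> fst (last G)"
      using le[of "i - 1" "length G - 1"] i assms(3) by (simp add: last_conv_nth)
    moreover have "fst (H ! 0) < fst (last G)" using le[of 0 "length G - 1"] b assms(3) by (simp add: last_conv_nth)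
    moreover have "fst (G ! (i - 1)) < snd (G ! Suc i)" "fst (H ! 0) < snd (G ! Suc i) - 1" if "Suc i < length G"
      using Gp[OF that] le[OF _ that, of "i - 1"] le[OF _ that, of 0] b by linarith+
    ultimately show "fst (lower_tail G H ! i) < snd (lower_tail G H ! i)"
      using i assms(4) by (auto simp: lower_tail_def hd_conv_nth)
  qed
qed

text \<open>The unit shifts and the shifts of position cancel. The innermost edges that have no
  place in the shifted lists, \<open>snd (last H)\<close> and \<open>fst (last G)\<close>, are
  stored as last edges of the opposite tails, and the first outer edges are kept, so nothing is
  lost.\<close>

lemma tails_involution:
  assumes "G \<noteq> []" "H \<noteq> []"
  shows "upper_tail (upper_tail G H) (lower_tail G H) = G"
    "lower_tail (upper_tail G H) (lower_tail G H) = H"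
proof -
  show "upper_tail (upper_tail G H) (lower_tail G H) = G"
  proof (rule nth_equalityI)
    fix i assume "i < length (upper_tail (upper_tail G H) (lower_tail G H))"
    then have i: "i < length G" by simp
    have "fst (G ! i) = fst (last G)" if "\<not> Suc i < length G"
    proof -
      have "i = length G - 1" using that i by simp
      then show ?thesis using assms(1) by (simp add: last_conv_nth)
    qed
    then have "fst (upper_tail (upper_tail G H) (lower_tail G H) ! i) = fst (G ! i)"
      using i tails_last(2)[OF assms(1), of H]
      by (auto simp: upper_tail_def[of "upper_tail G H"]) (simp add: lower_tail_def)
    moreover have "snd (upper_tail (upper_tail G H) (lower_tail G H) ! i) = snd (G ! i)"
      using i assms by (cases i) (auto simp: upper_tail_def lower_tail_def hd_conv_nth)
    ultimately show "upper_tail (upper_tail G H) (lower_tail G H) ! i = G ! i"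
      by (simp add: prod_eq_iff)
  qed simp
  show "lower_tail (upper_tail G H) (lower_tail G H) = H"
  proof (rule nth_equalityI)
    fix i assume "i < length (lower_tail (upper_tail G H) (lower_tail G H))"
    then have i: "i < length H" by simp
    have "snd (H ! i) = snd (last H)" if "\<not> Suc i < length H"
    proof -
      have "i = length H - 1" using that i by simp
      then show ?thesis using assms(2) by (simp add: last_conv_nth)
    qed
    then have "snd (lower_tail (upper_tail G H) (lower_tail G H) ! i) = snd (H ! i)"
      using i tails_last(1)[OF assms(2), of G]
      by (auto simp: lower_tail_def[of "upper_tail G H"]) (simp add: upper_tail_def)
    moreover have "fst (lower_tail (upper_tail G H) (lower_tail G H) ! i) = fst (H ! i)"
      using i assms by (cases i) (auto simp: upper_tail_def lower_tail_def hd_conv_nth)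
    ultimately show "lower_tail (upper_tail G H) (lower_tail G H) ! i = H ! i"
      by (simp add: prod_eq_iff)
  qed simp
qed

text \<open>The lexicographically first crossing. That no column of \<open>H\<close> at all is below
  an earlier column of \<open>G\<close> is what allows it to be found again after the tails have
  been exchanged.\<close>

definition first_down :: "col list \<Rightarrow> col list \<Rightarrow> nat \<Rightarrow> nat \<Rightarrow> bool" where
  "first_down G H a b \<longleftrightarrow> a < length G \<and> b < length H \<and> below (H ! b) (G ! a) \<and>
     (\<forall>i<a. \<forall>h\<in>set H. \<not> below h (G ! i)) \<and> (\<forall>j<b. \<not> below (H ! j) (G ! a))"

definition crossing :: "col list \<Rightarrow> col list \<Rightarrow> bool" where
  "crossing G H \<longleftrightarrow> (\<exists>g\<in>set G. \<exists>h\<in>set H. below h g)"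

lemma first_down_unique:
  assumes "first_down G H a b" "first_down G H a' b'"
  shows "a = a' \<and> b = b'"
proof -
  have "\<not> a < a'" "\<not> a' < a" using assms unfolding first_down_def by (metis nth_mem)+
  then have "a = a'" by simp
  then have "\<not> b < b'" "\<not> b' < b" using assms unfolding first_down_def by metis+
  then show ?thesis using \<open>a = a'\<close> by simp
qed

lemma crossing_iff_first_down: "crossing G H \<longleftrightarrow> (\<exists>a b. first_down G H a b)"
proof
  assume "crossing G H"
  then have ex: "\<exists>a. a < length G \<and> (\<exists>h\<in>set H. below h (G ! a))"
    unfolding crossing_def by (metis in_set_conv_nth)
  define a where "a = (LEAST a. a < length G \<and> (\<exists>h\<in>set H. below h (G ! a)))"
  have a: "a < length G" "\<exists>h\<in>set H. below h (G ! a)"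
    using LeastI_ex[OF ex] unfolding a_def by auto
  have a_min: "\<not> below h (G ! i)" if "i < a" "h \<in> set H" for i h
    using not_less_Least[of i] that a(1) unfolding a_def by (metis (mono_tags, lifting) a_def order.strict_trans)
  from a(2) have ex: "\<exists>b. b < length H \<and> below (H ! b) (G ! a)" by (metis in_set_conv_nth)
  define b where "b = (LEAST b. b < length H \<and> below (H ! b) (G ! a))"
  have b: "b < length H" "below (H ! b) (G ! a)"
    using LeastI_ex[OF ex] unfolding b_def by auto
  have "\<not> below (H ! j) (G ! a)" if "j < b" for j
    using not_less_Least[of j] that b(1) unfolding b_def by (metis (mono_tags, lifting) b_def order.strict_trans)
  then show "\<exists>a b. first_down G H a b" unfolding first_down_def using a(1) b a_min by blast
qed (unfold crossing_def first_down_def, metis nth_mem)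

definition swap_at :: "nat \<Rightarrow> nat \<Rightarrow> col list \<times> col list \<Rightarrow> col list \<times> col list" where
  "swap_at a b = (\<lambda>(G, H). (take a G @ upper_tail (drop a G) (drop b H), take b H @ lower_tail (drop a G) (drop b H)))"

text \<open>Minimality of the crossing lets the new tails be glued to the old prefixes. If a prefix
  is empty, the outer interval takes its place, and then \<open>L1 \<le> L2 + 1\<close> and
  \<open>U1 \<le> U2 + 1\<close> are what is required.\<close>

lemma swap_at:
  assumes "nested L1 U1 G" "nested L2 U2 H" "L1 \<le> L2 + 1" "U1 \<le> U2 + 1"
    and ev: "first_down G H a b" and G'H': "swap_at a b (G, H) = (G', H')"
  shows "nested L1 U1 G'" "nested L2 U2 H'" "first_down G' H' a b" "swap_at a b (G', H') = (G, H)"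
    "fst (last G') = snd (last H)" "snd (last H') = fst (last G)" "length G' + length H' = length G + length H"
proof -
  define Gt Ht where "Gt = drop a G" and "Ht = drop b H"
  have a: "a < length G" and b: "b < length H" and ab: "below (H ! b) (G ! a)"
    and amin: "\<And>i h. i < a \<Longrightarrow> h \<in> set H \<Longrightarrow> \<not> below h (G ! i)"
    and bmin: "\<And>j. j < b \<Longrightarrow> \<not> below (H ! j) (G ! a)"
    using ev by (auto simp: first_down_def)
  have ne: "Gt \<noteq> []" "Ht \<noteq> []" using a b by (auto simp: Gt_def Ht_def)
  have hd: "hd Gt = G ! a" "hd Ht = H ! b" using a b by (simp_all add: Gt_def Ht_def hd_drop_conv_nth)
  have G': "G' = take a G @ upper_tail Gt Ht" and H': "H' = take b H @ lower_tail Gt Ht"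
    using G'H' by (auto simp: swap_at_def Gt_def Ht_def)
  have nG: "nested L1 U1 (take a G)" "nested L1 U1 Gt \<or> a > 0" "\<exists>L U. nested L U Gt"
    using assms(1) nested_append[of L1 U1 "take a G" Gt] by (auto simp: Gt_def split: if_splits)
  have nH: "nested L2 U2 (take b H)" "\<exists>L U. nested L U Ht"
    using assms(2) nested_append[of L2 U2 "take b H" Ht] by (auto simp: Ht_def split: if_splits)
  obtain L U L' U' where tails: "nested L U Gt" "nested L' U' Ht" using nG nH by blast
  have bel: "below (hd Ht) (hd Gt)" using ab hd by simp
  note hds = tails_hd[OF tails ne bel]
  \<comment> \<open>\<open>H ! b\<close> has a lower top than \<open>G ! a\<close>, hence than
    \<open>G ! i\<close>; so it can fail to be below \<open>G ! i\<close> only because of its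
    bottom.\<close>
  have gL: "fst (G ! i) \<le> fst (H ! b)" "snd (G ! a) \<le> snd (G ! i)" if "i < a" for i
  proof -
    show *: "snd (G ! a) \<le> snd (G ! i)" using nested_nth_mono[OF assms(1), of i a] that a by simp
    show "fst (G ! i) \<le> fst (H ! b)"
      using amin[OF that, of "H ! b"] b * ab by (auto simp: below_def)
  qed
  \<comment> \<open>Likewise \<open>H ! j\<close> has a lower bottom than \<open>G ! a\<close>, so
    it can fail to be below \<open>G ! a\<close> only because of its top.\<close>
  have hU: "snd (G ! a) \<le> snd (H ! j)" "fst (H ! j) \<le> fst (H ! b)" if "j < b" for j
  proof -
    show *: "fst (H ! j) \<le> fst (H ! b)" using nested_nth_mono[OF assms(2), of j b] that b by simp
    show "snd (G ! a) \<le> snd (H ! j)"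
      using bmin[OF that] * ab by (auto simp: below_def)
  qed
  have G0: "L1 \<le> fst (G ! a)" "snd (G ! a) \<le> U1" and H0: "L2 \<le> fst (H ! b)" "snd (H ! b) \<le> U2"
    using nested_bounds[OF assms(1), of "G ! a"] nested_bounds[OF assms(2), of "H ! b"] a b by auto
  have lastG: "last (take a G) = G ! (a - 1)" if "a > 0" using that a by (subst last_conv_nth) (auto simp: min_def)
  have lastH: "last (take b H) = H ! (b - 1)" if "b > 0" using that b by (subst last_conv_nth) (auto simp: min_def)
  show "nested L1 U1 G'"
  proof (cases "a = 0")
    case True
    then show ?thesis unfolding G'
      using tails_nested(1)[OF tails ne bel, of L1 U1 "fst (hd Ht)" "snd (hd Gt) - 1"] G0 H0 hd assms(3)
      by simp
  next
    case False
    then show ?thesis unfolding G'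
      using tails_nested(1)[OF tails ne bel, of "fst (G ! (a - 1))" "snd (G ! (a - 1))" "fst (hd Ht)" "snd (hd Gt) - 1"]
        gL[of "a - 1"] hd nG(1) lastG a by (auto simp: nested_append)
  qed
  show "nested L2 U2 H'"
  proof (cases "b = 0")
    case True
    then show ?thesis unfolding H'
      using tails_nested(2)[OF tails ne bel, of "fst (hd Ht)" "snd (hd Gt)" L2 U2] G0 H0 hd assms(4)
      by simp
  next
    case False
    then show ?thesis unfolding H'
      using tails_nested(2)[OF tails ne bel, of "fst (hd Ht)" "snd (hd Gt)" "fst (H ! (b - 1))" "snd (H ! (b - 1))"]
        hU[of "b - 1"] hd nH(1) lastH b by (auto simp: nested_append)
  qed
  have ne': "upper_tail Gt Ht \<noteq> []" "lower_tail Gt Ht \<noteq> []" using ne by simp_all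
  have len: "length (take a G) = a" "length (take b H) = b" using a b by simp_all
  have hd': "G' ! a = hd (upper_tail Gt Ht)" "H' ! b = hd (lower_tail Gt Ht)"
    using ne' len unfolding G' H' by (simp_all add: nth_append hd_conv_nth)
  show "first_down G' H' a b"
    unfolding first_down_def
  proof (intro conjI allI impI ballI)
    show "a < length G'" "b < length H'" using ne len unfolding G' H' by simp_all
    show "below (H' ! b) (G' ! a)" unfolding hd' below_def using hds by simp
  next
    fix i h assume i: "i < a" and h: "h \<in> set H'"
    have Gi: "G' ! i = G ! i" using i len unfolding G' by (simp add: nth_append)
    consider "h \<in> set (take b H)" | "h \<in> set (lower_tail Gt Ht)" using h unfolding H' by auto
    then show "\<not> below h (G' ! i)"
    proof cases
      case 1
      then show ?thesis using amin[OF i, of h] set_take_subset[of b H] Gi by auto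
    next
      case 2
      \<comment> \<open>All columns of the lower tail start no lower than \<open>H ! b\<close>, thus
        no lower than \<open>G ! i\<close>: no earlier crossing is created.\<close>
      have "nested (fst (hd Ht)) (snd (hd Gt) - 1) (lower_tail Gt Ht)"
        by (rule tails_nested(2)[OF tails ne bel order.trans[OF _ order.refl] order.refl]) auto
      from nested_bounds(1)[OF this 2] show ?thesis using gL[OF i] Gi hd by (auto simp: below_def)
    qed
  next
    fix j assume j: "j < b"
    have "H' ! j = H ! j" using j len unfolding H' by (simp add: nth_append)
    then show "\<not> below (H' ! j) (G' ! a)" using hU[OF j] hds hd hd' by (auto simp: below_def)
  qed
  have "drop a G' = upper_tail Gt Ht" "drop b H' = lower_tail Gt Ht" "take a G' = take a G" "take b H' = take b H"
    using len unfolding G' H' by simp_all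
  then show "swap_at a b (G', H') = (G, H)"
    using tails_involution[OF ne] by (simp add: swap_at_def Gt_def Ht_def)
  show "fst (last G') = snd (last H)" "snd (last H') = fst (last G)"
    using ne ne' tails_last[of Ht Gt] tails_last(2)[of Gt Ht] unfolding G' H'
    by (auto simp: Gt_def Ht_def)
  show "length G' + length H' = length G + length H"
    using a b unfolding G' H' by (simp add: Gt_def Ht_def)
qed

definition event :: "col list \<times> col list \<Rightarrow> nat \<times> nat" where
  "event GH = (SOME ab. first_down (fst GH) (snd GH) (fst ab) (snd ab))"

lemma event_eqI: "first_down G H a b \<Longrightarrow> event (G, H) = (a, b)"
  unfolding event_def by (rule some_equality) (auto dest: first_down_unique)

definition cross_swap :: "col list \<times> col list \<Rightarrow> col list \<times> col list" where
  "cross_swap GH = swap_at (fst (event GH)) (snd (event GH)) GH"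

lemma cross_swap:
  assumes "nested L1 U1 G" "nested L2 U2 H" "L1 \<le> L2 + 1" "U1 \<le> U2 + 1"
    and "crossing G H" and G'H': "cross_swap (G, H) = (G', H')"
  shows "nested L1 U1 G'" "nested L2 U2 H'" "crossing G' H'" "cross_swap (G', H') = (G, H)"
    "fst (last G') = snd (last H)" "snd (last H') = fst (last G)" "length G' + length H' = length G + length H"
proof -
  obtain a b where ev: "first_down G H a b" using assms(5) crossing_iff_first_down by blast
  have "swap_at a b (G, H) = (G', H')" using G'H' event_eqI[OF ev] by (simp add: cross_swap_def)
  note * = swap_at[OF assms(1-4) ev this]
  show "nested L1 U1 G'" "nested L2 U2 H'" "fst (last G') = snd (last H)" "snd (last H') = fst (last G)"
    "length G' + length H' = length G + length H" using * by auto
  show "crossing G' H'" using *(3) crossing_iff_first_down by blast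
  show "cross_swap (G', H') = (G, H)" using *(4) event_eqI[OF *(3)] by (simp add: cross_swap_def)
qed

section \<open>Column triples and the count of crossing triples\<close>

definition slant :: "col \<Rightarrow> col \<Rightarrow> bool" where
  "slant c d \<longleftrightarrow> fst c \<le> fst d \<and> snd c \<le> snd d \<and> fst d < snd c"

definition para :: "col list \<Rightarrow> bool" where
  "para M \<longleftrightarrow> M \<noteq> [] \<and> fst (hd M) = 0 \<and> successively slant M \<and> (\<forall>c\<in>set M. fst c < snd c)"

text \<open>The bounds \<open>1\<close> and \<open>snd (last M) - 1\<close> express the choice of
  the first column on the bottom line and of the last one on the top line, which makes the cut
  unique. The bottom line has height 0, so \<open>snd (last M)\<close> is the height and
  \<open>n\<close> the semi-perimeter.\<close>

definition triples :: "nat \<Rightarrow> (col list \<times> col list \<times> col list) set" where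
  "triples n = {(G, M, H). para M \<and> nested 1 (snd (hd M)) G \<and> nested (fst (last M)) (snd (last M) - 1) H \<and>
     int (length G + length M + length H) + snd (last M) = int n}"

section \<open>Counting sorted integer lists\<close>

text \<open>Pascal's rule once more, by induction on the length plus the width of the range, with
  \<open>hi\<close> fixed: either the list starts with \<open>lo\<close>, or it lives in the range
  from \<open>lo + 1\<close>.\<close>

lemma sorted_list_range:
  assumes "lo \<le> (hi :: int)"
  shows "finite {xs. length xs = n \<and> sorted xs \<and> set xs \<subseteq> {lo..hi}} \<and>
    card {xs. length xs = n \<and> sorted xs \<and> set xs \<subseteq> {lo..hi}} = (n + nat (hi - lo)) choose n"
proof -
  define S where "S n lo = {xs :: int list. length xs = n \<and> sorted xs \<and> set xs \<subseteq> {lo..hi}}" for n lo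
  have "finite (S n lo) \<and> card (S n lo) = (n + d) choose n" if "hi - lo = int d" for n lo d
    using that
  proof (induction "n + d" arbitrary: n d lo)
    case 0
    then have "S n lo = {[]}" by (auto simp: S_def)
    then show ?case using 0 by simp
  next
    case (Suc k)
    show ?case
    proof (cases n)
      case 0
      then have "S n lo = {[]}" by (auto simp: S_def)
      then show ?thesis using 0 by simp
    next
      case n: (Suc m)
      have first: "finite (S m lo) \<and> card (S m lo) = (m + d) choose m"
        using Suc n by auto
      have split: "S n lo = Cons lo ` S m lo \<union> S n (lo + 1)"
      proof (intro equalityI subsetI)
        fix xs assume xs: "xs \<in> S n lo"
        then obtain y ys where ys: "xs = y # ys" using n by (cases xs) (auto simp: S_def)
        show "xs \<in> Cons lo ` S m lo \<union> S n (lo + 1)"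
        proof (cases "y = lo")
          case True
          then show ?thesis using xs ys n by (auto simp: S_def)
        next
          case False
          then show ?thesis using xs ys n by (fastforce simp: S_def)
        qed
      next
        fix xs assume "xs \<in> Cons lo ` S m lo \<union> S n (lo + 1)"
        then show "xs \<in> S n lo" using Suc.prems n by (auto simp: S_def subset_iff)
      qed
      have disj: "Cons lo ` S m lo \<inter> S n (lo + 1) = {}" by (auto simp: S_def)
      have second: "finite (S n (lo + 1)) \<and> card (S n (lo + 1)) = (if d = 0 then 0 else (n + (d - 1)) choose n)"
      proof (cases d)
        case 0
        then have "S n (lo + 1) = {}" using Suc.prems n by (auto simp: S_def length_Suc_conv)
        then show ?thesis using 0 by simp
      next
        case (Suc d')
        then show ?thesis using Suc.hyps(1)[of n d' "lo + 1"] Suc.hyps(2) Suc.prems by simp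
      qed
      have "card (S n lo) = card (S m lo) + card (S n (lo + 1))"
        unfolding split using first second disj by (subst card_Un_disjoint) (auto simp: card_image)
      also have "\<dots> = (n + d) choose n"
        using first second n by (cases d) auto
      finally show ?thesis using first second split by simp
    qed
  qed
  from this[of lo "nat (hi - lo)" n] show ?thesis using assms by (simp add: S_def)
qed

lemma sorted_list_last:
  assumes "lo \<le> (e :: int)"
  shows "finite {xs. length xs = Suc n \<and> sorted xs \<and> (\<forall>x\<in>set xs. lo \<le> x) \<and> last xs = e} \<and>
    card {xs. length xs = Suc n \<and> sorted xs \<and> (\<forall>x\<in>set xs. lo \<le> x) \<and> last xs = e} = (n + nat (e - lo)) choose n"
proof -
  have "{xs. length xs = Suc n \<and> sorted xs \<and> (\<forall>x\<in>set xs. lo \<le> x) \<and> last xs = e} =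
    (\<lambda>xs. xs @ [e]) ` {xs. length xs = n \<and> sorted xs \<and> set xs \<subseteq> {lo..e}}" (is "?L = ?R")
  proof (intro equalityI subsetI)
    fix xs assume xs: "xs \<in> ?L"
    then have "xs \<noteq> []" by auto
    then have eq: "xs = butlast xs @ [e]" using xs by (metis (mono_tags, lifting) append_butlast_last_id mem_Collect_eq)
    then have "sorted (butlast xs @ [e])" "\<forall>x\<in>set (butlast xs @ [e]). lo \<le> x" using xs by auto
    then have "butlast xs \<in> {xs. length xs = n \<and> sorted xs \<and> set xs \<subseteq> {lo..e}}"
      using xs by (auto simp: sorted_append)
    then show "xs \<in> ?R" using eq by blast
  next
    fix xs assume "xs \<in> ?R"
    then show "xs \<in> ?L" using assms by (auto simp: sorted_append subset_iff)
  qed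
  moreover have "inj_on (\<lambda>xs. xs @ [e]) X" for X by (simp add: inj_on_def)
  ultimately show ?thesis using sorted_list_range[OF assms, of n] by (simp add: card_image)
qed

lemma sorted_list_hd:
  assumes "f \<le> (hi :: int)"
  shows "finite {xs. length xs = Suc n \<and> sorted xs \<and> (\<forall>x\<in>set xs. x \<le> hi) \<and> hd xs = f} \<and>
    card {xs. length xs = Suc n \<and> sorted xs \<and> (\<forall>x\<in>set xs. x \<le> hi) \<and> hd xs = f} = (n + nat (hi - f)) choose n"
proof -
  have "{xs. length xs = Suc n \<and> sorted xs \<and> (\<forall>x\<in>set xs. x \<le> hi) \<and> hd xs = f} =
    Cons f ` {xs. length xs = n \<and> sorted xs \<and> set xs \<subseteq> {f..hi}}"
    using assms by (auto simp: length_Suc_conv image_iff subset_iff)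
  then show ?thesis using sorted_list_range[OF assms, of n] by (simp add: card_image)
qed

lemma nested_iff_sorted:
  "nested L U G \<longleftrightarrow> sorted (map fst G) \<and> sorted (rev (map snd G)) \<and>
     (\<forall>c\<in>set G. L \<le> fst c \<and> fst c < snd c \<and> snd c \<le> U)"
proof (induction G arbitrary: L U)
  case (Cons c G)
  show ?case by (simp only: nested.simps Cons) (fastforce simp: sorted_append)
qed simp

lemma successively_slant:
  "successively slant M \<longleftrightarrow> sorted (map fst M) \<and> sorted (map snd M) \<and> successively (\<lambda>c d. fst d < snd c) M"
proof (induction M rule: induct_list012)
  case (3 c d M)
  have "sorted (map f (c # d # M)) \<longleftrightarrow> f c \<le> f d \<and> sorted (map f (d # M))" for f :: "col \<Rightarrow> int"
    by (simp only: list.map sorted2)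
  then show ?case using 3(2) unfolding successively.simps slant_def by blast
qed simp_all

section \<open>Crossing triples with a prescribed nonnegative gap between the ends of the
  arms\<close>

definition gap_triples :: "nat \<Rightarrow> nat \<Rightarrow> nat \<Rightarrow> (col list \<times> col list \<times> col list) set" where
  "gap_triples m r n = {(G, M, H) \<in> triples n. G \<noteq> [] \<and> H \<noteq> [] \<and> length M = m \<and>
     fst (last G) = snd (last H) + int r}"

text \<open>
  The four sorted lists are the boundary paths: the lower edges of \<open>G\<close>, the lower edges of \<open>M @ H\<close>,
  the upper edges of \<open>rev G @ M\<close> and the upper edges of \<open>rev H\<close>. For \<open>e \<ge> f\<close> they are independent.
\<close>

definition arms :: "nat \<Rightarrow> nat \<Rightarrow> nat \<Rightarrow> int \<Rightarrow> int \<Rightarrow> int \<Rightarrow> (col list \<times> col list \<times> col list) set" where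
  "arms a b m e f h = {(G, M, H). length G = Suc a \<and> length M = m \<and> length H = Suc b \<and>
     sorted (map fst G) \<and> (\<forall>x\<in>set (map fst G). 1 \<le> x) \<and> last (map fst G) = e \<and>
     sorted (map fst (M @ H)) \<and> (\<forall>x\<in>set (map fst (M @ H)). x \<le> f - 1) \<and> hd (map fst (M @ H)) = 0 \<and>
     sorted (rev (map snd G) @ map snd M) \<and> (\<forall>x\<in>set (rev (map snd G) @ map snd M). e + 1 \<le> x) \<and>
       last (rev (map snd G) @ map snd M) = h \<and>
     sorted (rev (map snd H)) \<and> (\<forall>x\<in>set (rev (map snd H)). x \<le> h - 1) \<and> hd (rev (map snd H)) = f}"

lemma last_le_sorted: "sorted xs \<Longrightarrow> x \<in> set xs \<Longrightarrow> x \<le> (last xs :: int)"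
  by (metis last_in_set linorder_not_le empty_iff list.set(1) sorted_append sorted_simps(2) split_list_last
      last_append last_ConsR last_ConsL order_refl list.discI)

lemma hd_le_sorted: "sorted xs \<Longrightarrow> x \<in> set xs \<Longrightarrow> (hd xs :: int) \<le> x"
  by (cases xs) auto

text \<open>From left to right the point is \<open>f - 1 < e + 1\<close>: it separates the lower
  edges of \<open>M\<close> from all its upper edges, so overlap and nonemptiness are free.
  Conversely the innermost columns of \<open>G\<close> and \<open>H\<close> are nonempty, and
  monotonicity spreads the resulting bounds \<open>e + 1\<close> and \<open>f - 1\<close> along the
  paths.\<close>

lemma arms_iff:
  assumes "e \<ge> f" "m > 0"
  shows "(G, M, H) \<in> arms a b m e f h \<longleftrightarrow>
     para M \<and> nested 1 (snd (hd M)) G \<and> nested (fst (last M)) (snd (last M) - 1) H \<and>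
     length G = Suc a \<and> length M = m \<and> length H = Suc b \<and>
     fst (last G) = e \<and> snd (last H) = f \<and> snd (last M) = h" (is "?L \<longleftrightarrow> ?R")
proof
  assume L: ?L
  then have ne: "G \<noteq> []" "M \<noteq> []" "H \<noteq> []" using assms by (auto simp: arms_def)
  have len: "length G = Suc a" "length M = m" "length H = Suc b" using L by (auto simp: arms_def)
  have srt: "sorted (map fst G)" "sorted (map fst M)" "sorted (map fst H)"
      "sorted (rev (map snd G))" "sorted (map snd M)" "sorted (rev (map snd H))"
    using L by (auto simp: arms_def sorted_append)
  have ends: "fst (last G) = e" "fst (hd M) = 0" "snd (last M) = h" "snd (last H) = f"
    using L ne by (auto simp: arms_def last_map hd_map hd_rev)
  have G: "1 \<le> fst c" "fst c \<le> e" "e + 1 \<le> snd c" if "c \<in> set G" for c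
    using L that last_le_sorted[of "map fst G" "fst c"] by (auto simp: arms_def)
  have M: "fst c \<le> f - 1" "e + 1 \<le> snd c" if "c \<in> set M" for c
    using L that by (auto simp: arms_def)
  have H: "fst c \<le> f - 1" "f \<le> snd c" "snd c \<le> h - 1" if "c \<in> set H" for c
    using L that hd_le_sorted[of "rev (map snd H)" "snd c"] by (auto simp: arms_def)
  have GM: "snd c \<le> snd d" if "c \<in> set G" "d \<in> set M" for c d
    using L that by (auto simp: arms_def sorted_append)
  have MH: "fst c \<le> fst d" if "c \<in> set M" "d \<in> set H" for c d
    using L that by (auto simp: arms_def sorted_append)
  have over: "fst d < snd c" if "c \<in> set M" "d \<in> set M" for c d
    using M(1)[OF that(2)] M(2)[OF that(1)] assms(1) by linarith
  have "successively (\<lambda>c d. fst d < snd c) M"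
    unfolding successively_conv_nth by (simp add: over)
  then have "para M"
    using srt ends ne over by (simp add: para_def successively_slant)
  moreover have "fst c < snd c" if "c \<in> set G" for c using G[OF that] by linarith
  then have "nested 1 (snd (hd M)) G"
    using srt G(1) GM ne by (simp add: nested_iff_sorted)
  moreover have "fst c < snd c" if "c \<in> set H" for c using H[OF that] by linarith
  then have "nested (fst (last M)) (snd (last M) - 1) H"
    using srt H(3) MH ne ends by (simp add: nested_iff_sorted)
  ultimately show ?R using len ends by blast
next
  assume R: ?R
  then have ne: "G \<noteq> []" "M \<noteq> []" "H \<noteq> []" using assms by auto
  have sM: "sorted (map fst M)" "sorted (map snd M)" using R by (auto simp: para_def successively_slant)
  have sG: "sorted (map fst G)" "sorted (rev (map snd G))" and sH: "sorted (map fst H)" "sorted (rev (map snd H))"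
    and bG: "\<And>c. c \<in> set G \<Longrightarrow> 1 \<le> fst c \<and> fst c < snd c \<and> snd c \<le> snd (hd M)"
    and bH: "\<And>c. c \<in> set H \<Longrightarrow> fst (last M) \<le> fst c \<and> fst c < snd c \<and> snd c \<le> h - 1"
    using R by (auto simp: nested_iff_sorted)
  have G: "snd (last G) \<le> snd c" if "c \<in> set G" for c
    using that hd_le_sorted[OF sG(2), of "snd c"] ne by (auto simp: hd_rev last_map)
  have M: "fst c \<le> fst (last M)" "snd (hd M) \<le> snd c" if "c \<in> set M" for c
    using that last_le_sorted[OF sM(1), of "fst c"] hd_le_sorted[OF sM(2), of "snd c"] ne by (auto simp: last_map hd_map)
  have H: "fst c \<le> fst (last H)" if "c \<in> set H" for c
    using that last_le_sorted[OF sH(1), of "fst c"] ne by (auto simp: last_map)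
  have ends: "fst (last H) < f" "e < snd (last G)" "fst (last M) \<le> fst (last H)" "snd (last G) \<le> snd (hd M)"
    using R ne bG[of "last G"] bH[of "last H"] by auto
  have 1: "sorted (map fst (M @ H))"
    using sM(1) sH(1) M(1) bH by (fastforce simp: sorted_append)
  have 2: "sorted (rev (map snd G) @ map snd M)"
    using sG(2) sM(2) M(2) bG by (fastforce simp: sorted_append)
  have 3: "x \<le> f - 1" if "x \<in> set (map fst (M @ H))" for x
    using that M(1) H ends by fastforce
  have 4: "e + 1 \<le> x" if "x \<in> set (rev (map snd G) @ map snd M)" for x
    using that M(2) G ends by fastforce
  have 5: "hd (map fst (M @ H)) = 0" "last (rev (map snd G) @ map snd M) = h" "last (map fst G) = e" "hd (rev (map snd H)) = f"
    using R ne by (auto simp: last_map hd_map hd_rev para_def hd_append)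
  show ?L
    unfolding arms_def using R 1 2 3 4 5 sG sH bG bH by auto
qed

lemma card_arms:
  assumes "e \<ge> f" "m > 0" "f \<ge> 1" "h \<ge> e + 1"
  shows "finite (arms a b m e f h) \<and> card (arms a b m e f h) =
    ((a + nat (e - 1)) choose a) * ((m + b + nat (f - 1)) choose (m + b)) *
    ((a + m + nat (h - e - 1)) choose (a + m)) * ((b + nat (h - 1 - f)) choose b)"
proof -
  define L1 where "L1 = {xs. length xs = Suc a \<and> sorted xs \<and> (\<forall>x\<in>set xs. 1 \<le> x) \<and> last xs = e}"
  define L2 where "L2 = {xs. length xs = Suc (m + b) \<and> sorted xs \<and> (\<forall>x\<in>set xs. x \<le> f - 1) \<and> hd xs = 0}"
  define L3 where "L3 = {xs. length xs = Suc (a + m) \<and> sorted xs \<and> (\<forall>x\<in>set xs. e + 1 \<le> x) \<and> last xs = h}"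
  define L4 where "L4 = {xs. length xs = Suc b \<and> sorted xs \<and> (\<forall>x\<in>set xs. x \<le> h - 1) \<and> hd xs = f}"
  define split where "split = (\<lambda>(G, M, H). (map fst G, map fst (M @ H), rev (map snd G) @ map snd M, rev (map snd H))
     :: int list \<times> int list \<times> int list \<times> int list)"
  \<comment> \<open>The lengths fixed in \<open>arms\<close> tell where the second and third path
    pass from one part of the triple to the next.\<close>
  define join where "join = (\<lambda>(l1, l2, l3, l4).
     (zip l1 (rev (take (Suc a) l3)), zip (take m l2) (drop (Suc a) l3), zip (drop m l2) (rev l4))
     :: col list \<times> col list \<times> col list)"
  have arms_conv: "(G, M, H) \<in> arms a b m e f h \<longleftrightarrow> length G = Suc a \<and> length M = m \<and> length H = Suc b \<and>
      map fst G \<in> L1 \<and> map fst (M @ H) \<in> L2 \<and> rev (map snd G) @ map snd M \<in> L3 \<and> rev (map snd H) \<in> L4" for G M H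
    unfolding arms_def L1_def L2_def L3_def L4_def by auto
  have join_split: "join (split x) = x" if arm: "x \<in> arms a b m e f h" for x
  proof -
    obtain G M H where x: "x = (G, M, H)" by (metis prod_cases3)
    then have "length G = Suc a" "length M = m" using arm unfolding x arms_conv by auto
    then have *: "rev (take (Suc a) (rev (map snd G) @ map snd M)) = map snd G"
      "drop (Suc a) (rev (map snd G) @ map snd M) = map snd M"
      "take m (map fst (M @ H)) = map fst M" "drop m (map fst (M @ H)) = map fst H"
      by simp_all
    show ?thesis unfolding x split_def join_def prod.case * rev_rev_ident zip_map_fst_snd ..
  qed
  have split_join: "split (G, M, H) = x \<and> length G = Suc a \<and> length M = m \<and> length H = Suc b"
    if xL: "x \<in> L1 \<times> L2 \<times> L3 \<times> L4" and GMH: "join x = (G, M, H)" for x G M H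
  proof -
    obtain l1 l2 l3 l4 where x: "x = (l1, l2, l3, l4)" by (metis prod_cases4)
    have len: "length l1 = Suc a" "length l2 = Suc (m + b)" "length l3 = Suc (a + m)" "length l4 = Suc b"
      using xL unfolding x L1_def L2_def L3_def L4_def by simp_all
    then have "map fst (zip l1 (rev (take (Suc a) l3))) = l1" "rev (map snd (zip l1 (rev (take (Suc a) l3)))) = take (Suc a) l3"
      "map fst (zip (take m l2) (drop (Suc a) l3)) = take m l2" "map snd (zip (take m l2) (drop (Suc a) l3)) = drop (Suc a) l3"
      "map fst (zip (drop m l2) (rev l4)) = drop m l2" "rev (map snd (zip (drop m l2) (rev l4))) = l4"
      by simp_all
    then show ?thesis using len GMH unfolding x split_def join_def prod.case map_append by auto
  qed
  have "bij_betw split (arms a b m e f h) (L1 \<times> L2 \<times> L3 \<times> L4)"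
  proof (rule bij_betw_byWitness[where f' = join])
    show "\<forall>x\<in>arms a b m e f h. join (split x) = x" using join_split by blast
    show "\<forall>x\<in>L1 \<times> L2 \<times> L3 \<times> L4. split (join x) = x" using split_join by (metis prod_cases3)
    show "split ` arms a b m e f h \<subseteq> L1 \<times> L2 \<times> L3 \<times> L4"
    proof (rule image_subsetI)
      fix x assume arm: "x \<in> arms a b m e f h"
      obtain G M H where x: "x = (G, M, H)" by (metis prod_cases3)
      show "split x \<in> L1 \<times> L2 \<times> L3 \<times> L4"
        using arm unfolding x arms_conv split_def prod.case mem_Sigma_iff by blast
    qed
    show "join ` (L1 \<times> L2 \<times> L3 \<times> L4) \<subseteq> arms a b m e f h"
    proof (rule image_subsetI)
      fix x assume x: "x \<in> L1 \<times> L2 \<times> L3 \<times> L4"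
      obtain G M H where GMH: "join x = (G, M, H)" by (metis prod_cases3)
      note s = split_join[OF x GMH]
      then have "split (G, M, H) \<in> L1 \<times> L2 \<times> L3 \<times> L4" using x by simp
      then show "join x \<in> arms a b m e f h"
        using s unfolding GMH arms_conv split_def prod.case mem_Sigma_iff by blast
    qed
  qed
  moreover have "finite (L1 \<times> L2 \<times> L3 \<times> L4) \<and> card (L1 \<times> L2 \<times> L3 \<times> L4) =
    ((a + nat (e - 1)) choose a) * ((m + b + nat (f - 1)) choose (m + b)) *
    ((a + m + nat (h - e - 1)) choose (a + m)) * ((b + nat (h - 1 - f)) choose b)"
  proof -
    have *: "h - (e + 1) = h - e - 1" "f - 1 - 0 = f - 1" by simp_all
    have "finite L1 \<and> card L1 = (a + nat (e - 1)) choose a"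
      unfolding L1_def using assms by (intro sorted_list_last) simp
    moreover have "finite L2 \<and> card L2 = (m + b + nat (f - 1)) choose (m + b)"
      unfolding L2_def using sorted_list_hd[of 0 "f - 1" "m + b"] assms unfolding * by simp
    moreover have "finite L3 \<and> card L3 = (a + m + nat (h - e - 1)) choose (a + m)"
      unfolding L3_def using sorted_list_last[of "e + 1" h "a + m"] assms unfolding * by simp
    moreover have "finite L4 \<and> card L4 = (b + nat (h - 1 - f)) choose b"
      unfolding L4_def using assms by (intro sorted_list_hd) simp
    ultimately show ?thesis
      by (simp only: card_cartesian_product finite_cartesian_product mult.assoc)
  qed
  ultimately show ?thesis by (metis (no_types, lifting) bij_betw_finite bij_betw_same_card)
qed

definition mill_index :: "nat \<Rightarrow> (nat \<times> nat \<times> nat) set" where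
  "mill_index N = (SIGMA A:{..N}. {..A} \<times> {..N - A})"

text \<open>The free quantities are \<open>a = length G - 1\<close>,
  \<open>A - a = length H - 1\<close>, \<open>g = h - e - 1\<close> and
  \<open>N - A - g = f - 1\<close>; they add up to \<open>N\<close>. The four units taken off,
  together with \<open>m\<close> and \<open>r\<close>, make the semi-perimeter
  \<open>N + (m + r + 4)\<close>.\<close>

definition mill_arms :: "nat \<Rightarrow> nat \<Rightarrow> nat \<Rightarrow> nat \<times> nat \<times> nat \<Rightarrow> (col list \<times> col list \<times> col list) set" where
  "mill_arms m r N = (\<lambda>(A, a, g). arms a (A - a) m (int (N - A - g) + 1 + int r) (int (N - A - g) + 1)
     (int (N - A - g) + 1 + int r + int g + 1))"

lemma gap_triples_eq:
  assumes "m > 0"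
  shows "gap_triples m r n = (if n < m + r + 4 then {} else
    (\<Union>i\<in>mill_index (n - (m + r + 4)). mill_arms m r (n - (m + r + 4)) i))" (is "_ = ?R")
proof (intro equalityI subsetI)
  fix x assume x: "x \<in> gap_triples m r n"
  obtain G M H where GMH: "x = (G, M, H)" by (metis prod_cases3)
  define a b f h where defs: "a = length G - 1" "b = length H - 1" "f = snd (last H)" "h = snd (last M)"
  have conds: "para M" "nested 1 (snd (hd M)) G" "nested (fst (last M)) (h - 1) H"
      "int (length G + length M + length H) + h = int n" "G \<noteq> []" "H \<noteq> []" "length M = m" "fst (last G) = f + int r"
    using x GMH defs by (auto simp: gap_triples_def triples_def)
  then have lens: "length G = Suc a" "length H = Suc b"
    using conds(5,6) defs(1,2) by (simp_all flip: length_greater_0_conv)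
  have arm: "x \<in> arms a b m (f + int r) f h"
    unfolding GMH using conds lens assms by (subst arms_iff) (simp_all add: defs(3,4)[symmetric])
  have f1: "f \<ge> 1"
    using arm assms unfolding GMH arms_def by (cases M) auto
  have "h \<ge> f + int r + 1"
    using arm assms unfolding GMH arms_def by (cases M rule: rev_cases) auto
  then obtain g where g: "h = f + int r + 1 + int g" by (metis zle_iff_zadd)
  obtain f0 where f0: "f = 1 + int f0" using f1 by (metis zle_iff_zadd)
  have n: "n = a + b + f0 + g + (m + r + 4)"
    using conds(4,7) lens g f0 by simp
  then have N: "n - (m + r + 4) = a + b + f0 + g" by simp
  have "a + b + f0 + g - (a + b) - g = f0" by simp
  then have "x \<in> mill_arms m r (n - (m + r + 4)) (a + b, a, g)"
    using arm g f0 unfolding mill_arms_def prod.case N by (simp add: algebra_simps)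
  moreover have "(a + b, a, g) \<in> mill_index (n - (m + r + 4))"
    unfolding N mill_index_def by simp
  ultimately show "x \<in> ?R" using n by (metis (no_types, lifting) UN_I linorder_not_less le_add2)
next
  fix x assume x: "x \<in> ?R"
  then have n: "\<not> n < m + r + 4" by (auto split: if_splits)
  define N where "N = n - (m + r + 4)"
  have n': "n = N + (m + r + 4)" using n by (simp add: N_def)
  obtain i where i: "i \<in> mill_index N" "x \<in> mill_arms m r N i"
    using x n unfolding N_def by (auto simp only: if_False)
  obtain A a g where iA: "i = (A, a, g)" by (metis prod_cases3)
  have Aag: "A \<le> N" "a \<le> A" "g \<le> N - A" using i(1) by (auto simp: iA mill_index_def)
  obtain G M H where GMH: "x = (G, M, H)" by (metis prod_cases3)
  define f where "f = int (N - A - g) + 1"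
  have arm: "(G, M, H) \<in> arms a (A - a) m (f + int r) f (f + int r + int g + 1)"
    using i(2) unfolding GMH iA mill_arms_def f_def by simp
  have *: "para M" "nested 1 (snd (hd M)) G" "nested (fst (last M)) (snd (last M) - 1) H"
     "length G = Suc a" "length M = m" "length H = Suc (A - a)"
     "fst (last G) = f + int r" "snd (last H) = f" "snd (last M) = f + int r + int g + 1"
    using iffD1[OF arms_iff arm] assms by auto
  have "int (length G + length M + length H) + snd (last M) = int n"
    using * Aag by (simp add: n' f_def of_nat_diff)
  moreover have "G \<noteq> []" "H \<noteq> []" using * by auto
  ultimately show "x \<in> gap_triples m r n"
    using * unfolding GMH gap_triples_def triples_def by simp
qed

lemma card_gap_triples:
  assumes "m > 0"
  shows "real (card (gap_triples m r n)) = (if n < m + r + 4 then 0 else millsum m r (n - (m + r + 4)))"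
    and "finite (gap_triples m r n)"
proof -
  define N where "N = n - (m + r + 4)"
  have eq: "gap_triples m r n = (if n < m + r + 4 then {} else (\<Union>i\<in>mill_index N. mill_arms m r N i))"
    unfolding gap_triples_eq[OF assms] N_def ..
  have finI: "finite (mill_index N)" unfolding mill_index_def by auto
  have finF: "finite (mill_arms m r N i)" for i
    unfolding mill_arms_def using assms by (cases i) (auto simp: card_arms)
  show "finite (gap_triples m r n)" unfolding eq using finI finF by auto
  have disj: "mill_arms m r N i \<inter> mill_arms m r N j = {}" if "i \<in> mill_index N" "j \<in> mill_index N" "i \<noteq> j" for i j
  proof (rule ccontr)
    assume "mill_arms m r N i \<inter> mill_arms m r N j \<noteq> {}"
    then obtain G M H where x: "(G, M, H) \<in> mill_arms m r N i" "(G, M, H) \<in> mill_arms m r N j" by fast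
    obtain A a g A' a' g' where ij: "i = (A, a, g)" "j = (A', a', g')" by (metis prod_cases3)
    have le: "a \<le> A" "g \<le> N - A" "A \<le> N" "a' \<le> A'" "g' \<le> N - A'" "A' \<le> N"
      using that unfolding ij mill_index_def by auto
    have "a = a'" "A - a = A' - a'" "int (N - A - g) + 1 = int (N - A' - g') + 1"
      using x unfolding ij mill_arms_def arms_def prod.case mem_Collect_eq by (elim conjE; simp)+
    then have "i = j" using le unfolding ij by auto
    then show False using that by simp
  qed
  have cardF: "real (card (mill_arms m r N (A, a, g))) =
      gch (int g + int a + int m) g * gch (int a + int (N - A - g) + int r) a *
     gch (int (N - A - g) + int (A - a) + int m) (N - A - g) * gch (int (A - a) + int g + int r) (A - a)"
    for A a g
  proof -
    define b f where bf: "b = A - a" "f = N - A - g"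
    have nats: "nat (int f + 1 + int r - 1) = f + r" "nat (int f + 1 - 1) = f"
      "nat (int f + 1 + int r + int g + 1 - (int f + 1 + int r) - 1) = g"
      "nat (int f + 1 + int r + int g + 1 - 1 - (int f + 1)) = r + g"
      by linarith+
    have "card (mill_arms m r N (A, a, g)) = ((a + (f + r)) choose a) * ((m + b + f) choose (m + b)) *
      ((a + m + g) choose (a + m)) * ((b + (r + g)) choose b)"
      unfolding mill_arms_def prod.case bf[symmetric]
      using card_arms[of "int f + 1" "int f + 1 + int r" m "int f + 1 + int r + int g + 1" a b] assms
      unfolding nats by simp
    \<comment> \<open>The paths containing \<open>M\<close> are to be indexed by their rises instead
      of their columns: only then do the four binomials follow each other cyclically in
      \<open>g\<close>, \<open>a\<close>, \<open>f\<close>, \<open>b\<close>.\<close>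
    also have "(m + b + f) choose (m + b) = (f + b + m) choose f"
      using binomial_symmetric[of f "f + b + m"] by (simp add: add_ac)
    also have "(a + m + g) choose (a + m) = (g + a + m) choose g"
      using binomial_symmetric[of g "g + a + m"] by (simp add: add_ac)
    finally show ?thesis
      unfolding bf[symmetric] of_nat_add[symmetric] gch_nat by (simp add: add_ac mult_ac)
  qed
  show "real (card (gap_triples m r n)) = (if n < m + r + 4 then 0 else millsum m r (n - (m + r + 4)))"
  proof (cases "n < m + r + 4")
    case False
    have "card (gap_triples m r n) = (\<Sum>i\<in>mill_index N. card (mill_arms m r N i))"
      unfolding eq using False finI finF disj by (simp add: card_UN_disjoint)
    then have "real (card (gap_triples m r n)) = (\<Sum>(A, a, g)\<in>mill_index N. real (card (mill_arms m r N (A, a, g))))"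
      by (simp add: case_prod_beta)
    also have "\<dots> = (\<Sum>A\<le>N. \<Sum>a\<le>A. \<Sum>g\<le>N - A. real (card (mill_arms m r N (A, a, g))))"
      unfolding mill_index_def by (simp add: sum.Sigma sum.cartesian_product case_prod_beta)
    also have "\<dots> = millsum m r N"
      unfolding millsum_def mill_def cardF ..
    finally show ?thesis using False N_def by simp
  qed (simp add: eq)
qed

lemma para_bounds:
  assumes "para M" "c \<in> set M"
  shows "0 \<le> fst c" "fst c < snd c" "snd c \<le> snd (last M)" "fst c \<le> fst (last M)" "snd (hd M) \<le> snd c"
proof -
  have s: "sorted (map fst M)" "sorted (map snd M)" and ne: "M \<noteq> []" "fst (hd M) = 0"
    using assms by (auto simp: para_def successively_slant)
  show "fst c < snd c" using assms by (auto simp: para_def)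
  show "0 \<le> fst c" "snd c \<le> snd (last M)" "fst c \<le> fst (last M)" "snd (hd M) \<le> snd c"
    using hd_le_sorted[OF s(1), of "fst c"] last_le_sorted[OF s(2), of "snd c"] last_le_sorted[OF s(1), of "fst c"]
      hd_le_sorted[OF s(2), of "snd c"] assms(2) ne
    by (auto simp: hd_map last_map)
qed

lemma triples_bounds:
  assumes "(G, M, H) \<in> triples n" "c \<in> set G \<union> set M \<union> set H"
  shows "0 \<le> fst c" "fst c < snd c" "snd c \<le> int n"
proof -
  have M: "para M" and G: "nested 1 (snd (hd M)) G" and H: "nested (fst (last M)) (snd (last M) - 1) H"
    and n: "snd (last M) \<le> int n" using assms by (auto simp: triples_def)
  have ne: "hd M \<in> set M" "last M \<in> set M" using M by (auto simp: para_def)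
  note b = para_bounds[OF M]
  consider "c \<in> set G" | "c \<in> set M" | "c \<in> set H" using assms(2) by blast
  then have "0 \<le> fst c \<and> fst c < snd c \<and> snd c \<le> snd (last M)"
  proof cases
    case 1
    show ?thesis using nested_bounds[OF G 1] b(3)[OF ne(1)] by linarith
  next
    case 2
    show ?thesis using b[OF 2] by linarith
  next
    case 3
    show ?thesis using nested_bounds[OF H 3] b(1)[OF ne(2)] by linarith
  qed
  then show "0 \<le> fst c" "fst c < snd c" "snd c \<le> int n" using n by auto
qed

lemma finite_triples: "finite (triples n)"
proof -
  let ?L = "{xs. set xs \<subseteq> {0..int n} \<times> {0..int n} \<and> length xs \<le> n}"
  have "triples n \<subseteq> ?L \<times> ?L \<times> ?L"
  proof
    fix x assume "x \<in> triples n"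
    moreover obtain G M H where x: "x = (G, M, H)" by (metis prod_cases3)
    ultimately have t: "(G, M, H) \<in> triples n" by simp
    note b = triples_bounds[OF t]
    have "last M \<in> set M" using t by (auto simp: triples_def para_def)
    then have "0 \<le> snd (last M)" using b[of "last M"] by auto
    then have "length G \<le> n" "length M \<le> n" "length H \<le> n" using t by (auto simp: triples_def)
    moreover have "c \<in> {0..int n} \<times> {0..int n}" if "c \<in> set G \<union> set M \<union> set H" for c
      using b[OF that] by (cases c) auto
    ultimately show "x \<in> ?L \<times> ?L \<times> ?L" unfolding x by auto
  qed
  moreover have "finite ?L" by (intro finite_lists_length_le) auto
  ultimately show ?thesis by (meson finite_SigmaI finite_subset)
qed

definition crossing_triples :: "nat \<Rightarrow> (col list \<times> col list \<times> col list) set" where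
  "crossing_triples n = {(G, M, H) \<in> triples n. crossing G H}"

text \<open>If the last column of \<open>H\<close> ends no higher than the last column of
  \<open>G\<close> begins, these two nonempty columns already cross.\<close>

lemma gap_triples_crossing: "gap_triples m r n \<subseteq> crossing_triples n"
proof
  fix x assume x: "x \<in> gap_triples m r n"
  obtain G M H where GMH: "x = (G, M, H)" by (metis prod_cases3)
  have t: "(G, M, H) \<in> triples n" "G \<noteq> []" "H \<noteq> []" "fst (last G) = snd (last H) + int r"
    using x by (auto simp: GMH gap_triples_def)
  have "last G \<in> set G" "last H \<in> set H" using t by auto
  moreover from this have "below (last H) (last G)"
    using triples_bounds[OF t(1), of "last G"] triples_bounds[OF t(1), of "last H"] t(4) by (auto simp: below_def)
  ultimately show "x \<in> crossing_triples n"
    using t(1) unfolding GMH crossing_triples_def crossing_def by blast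
qed

text \<open>The exchange negates the gap, so positive and negative gaps are equally frequent and
  \<open>r > 0\<close> gets weight 2. Neither the gap nor the length of \<open>M\<close> can exceed
  \<open>n\<close>.\<close>

lemma card_crossing_triples:
  "card (crossing_triples n) = (\<Sum>m=1..n. \<Sum>r=0..n. (if r = 0 then 1 else 2) * card (gap_triples m r n))"
proof -
  define gap :: "col list \<times> col list \<times> col list \<Rightarrow> int" where
    "gap = (\<lambda>(G, M, H). fst (last G) - snd (last H))"
  let ?C = "crossing_triples n"
  have fin: "finite ?C" by (rule finite_subset[OF _ finite_triples[of n]]) (auto simp: crossing_triples_def)
  define flip where "flip = (\<lambda>(G, M, H). let (G', H') = cross_swap (G, H) in (G', M :: col list, H'))"
  have flip: "flip x \<in> ?C \<and> flip (flip x) = x \<and> gap (flip x) = - gap x" if "x \<in> ?C" for x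
  proof -
    obtain G M H where x: "x = (G, M, H)" by (metis prod_cases3)
    have t: "(G, M, H) \<in> triples n" and c: "crossing G H" using that by (auto simp: x crossing_triples_def)
    have M: "para M" and G: "nested 1 (snd (hd M)) G" and H: "nested (fst (last M)) (snd (last M) - 1) H"
      and n: "int (length G + length M + length H) + snd (last M) = int n" using t by (auto simp: triples_def)
    have M': "hd M \<in> set M" "last M \<in> set M" using M by (auto simp: para_def)
    \<comment> \<open>The unit by which the arms stay away from the bottom and the top line is
      exactly the slack that \<open>cross_swap\<close> allows.\<close>
    have le: "1 \<le> fst (last M) + 1" "snd (hd M) \<le> snd (last M) - 1 + 1"
      using para_bounds(1)[OF M M'(2)] para_bounds(3)[OF M M'(1)] by auto
    obtain G' H' where G'H': "cross_swap (G, H) = (G', H')" by fastforce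
    note s = cross_swap[OF G H le c G'H']
    have "flip x = (G', M, H')" using G'H' by (simp add: flip_def x)
    moreover have "(G', M, H') \<in> ?C"
      using s M n by (auto simp: crossing_triples_def triples_def simp flip: of_nat_add)
    moreover have "flip (G', M, H') = x" using s(4) by (simp add: flip_def x)
    moreover have "gap (G', M, H') = - gap x" using s(5,6) by (simp add: gap_def x)
    ultimately show ?thesis by simp
  qed
  have "bij_betw flip {x\<in>?C. gap x < 0} {x\<in>?C. gap x > 0}"
    by (rule bij_betw_byWitness[where f' = flip]) (use flip in auto)
  then have eq: "card {x\<in>?C. gap x < 0} = card {x\<in>?C. gap x > 0}" by (rule bij_betw_same_card)
  have "card ?C = card ({x\<in>?C. gap x < 0} \<union> {x\<in>?C. \<not> gap x < 0})"
    by (rule arg_cong[where f = card]) auto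
  also have "\<dots> = card {x\<in>?C. gap x < 0} + card {x\<in>?C. \<not> gap x < 0}"
    using fin by (intro card_Un_disjoint) auto
  also have "card {x\<in>?C. \<not> gap x < 0} = card ({x\<in>?C. gap x > 0} \<union> {x\<in>?C. gap x = 0})"
    by (rule arg_cong[where f = card]) auto
  also have "\<dots> = card {x\<in>?C. gap x > 0} + card {x\<in>?C. gap x = 0}"
    using fin by (intro card_Un_disjoint) auto
  finally have cardC: "card ?C = 2 * card {x\<in>?C. gap x > 0} + card {x\<in>?C. gap x = 0}" using eq by simp
  have gapset: "x \<in> gap_triples m r n \<longleftrightarrow> x \<in> ?C \<and> gap x = int r \<and> length (fst (snd x)) = m" for x m r
  proof
    assume x: "x \<in> gap_triples m r n"
    then have "x \<in> ?C" using gap_triples_crossing by blast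
    then show "x \<in> ?C \<and> gap x = int r \<and> length (fst (snd x)) = m"
      using x by (cases x) (simp add: gap_triples_def gap_def)
  next
    assume "x \<in> ?C \<and> gap x = int r \<and> length (fst (snd x)) = m"
    then show "x \<in> gap_triples m r n"
      by (cases x) (auto simp: gap_triples_def gap_def crossing_triples_def crossing_def)
  qed
  have bounds: "gap x \<le> int n \<and> 1 \<le> length (fst (snd x)) \<and> length (fst (snd x)) \<le> n" if "x \<in> ?C" for x
  proof -
    obtain G M H where x: "x = (G, M, H)" by (metis prod_cases3)
    have t: "(G, M, H) \<in> triples n" and "G \<noteq> []" "H \<noteq> []" "M \<noteq> []"
      using that by (auto simp: x crossing_triples_def crossing_def triples_def para_def)
    then have "last G \<in> set G" "last H \<in> set H" "last M \<in> set M" by auto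
    then have "gap x \<le> int n" "0 < snd (last M)"
      using triples_bounds[OF t, of "last G"] triples_bounds[OF t, of "last H"] triples_bounds[OF t, of "last M"]
      by (auto simp: gap_def x)
    then show ?thesis using t \<open>M \<noteq> []\<close> by (auto simp: x triples_def Suc_le_eq)
  qed
  have fing: "finite (gap_triples m r n)" for m r
    by (rule finite_subset[OF gap_triples_crossing fin])
  have zero: "card {x\<in>?C. gap x = 0} = (\<Sum>m=1..n. card (gap_triples m 0 n))"
  proof -
    have "{x\<in>?C. gap x = 0} = (\<Union>m\<in>{1..n}. gap_triples m 0 n)"
      using bounds by (auto simp: gapset)
    moreover have "card (\<Union>m\<in>{1..n}. gap_triples m 0 n) = (\<Sum>m=1..n. card (gap_triples m 0 n))"
      using fing by (intro card_UN_disjoint) (auto simp: gapset)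
    ultimately show ?thesis by simp
  qed
  have pos: "card {x\<in>?C. gap x > 0} = (\<Sum>m=1..n. \<Sum>r=1..n. card (gap_triples m r n))"
  proof -
    have "{x\<in>?C. gap x > 0} = (\<Union>(m, r)\<in>{1..n} \<times> {1..n}. gap_triples m r n)" (is "?L = ?R")
    proof (intro equalityI subsetI)
      fix x assume x: "x \<in> ?L"
      then have "x \<in> gap_triples (length (fst (snd x))) (nat (gap x)) n" by (simp add: gapset)
      moreover have "nat (gap x) \<in> {1..n}" "length (fst (snd x)) \<in> {1..n}" using x bounds[of x] by auto
      ultimately show "x \<in> ?R" by blast
    qed (auto simp: gapset)
    moreover have "card (\<Union>(m, r)\<in>{1..n} \<times> {1..n}. gap_triples m r n) =
        (\<Sum>(m, r)\<in>{1..n} \<times> {1..n}. card (gap_triples m r n))"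
      using fing by (subst card_UN_disjoint) (auto simp: gapset case_prod_beta)
    ultimately show ?thesis by (simp add: sum.cartesian_product)
  qed
  have "(\<Sum>r=0..n. (if r = 0 then 1 else 2) * card (gap_triples m r n)) =
      card (gap_triples m 0 n) + 2 * (\<Sum>r=1..n. card (gap_triples m r n))" for m
    by (subst sum.atLeast_Suc_atMost) (simp_all add: sum_distrib_left)
  then show ?thesis unfolding cardC zero pos by (simp add: sum.distrib sum_distrib_left)
qed

section \<open>Closed form of the crossing count\<close>

definition millcount :: "nat \<Rightarrow> nat \<Rightarrow> real" where
  "millcount j n = (\<Sum>i\<le>n. 2 ^ (n - i) * of_nat ((2 * i + 2 * j) choose i))"

lemma millsum_eq: "millsum m r n = millcount (m + r) n"
proof (induction n)
  case (Suc n)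
  have "(\<Sum>i\<le>n. 2 ^ (Suc n - i) * of_nat ((2 * i + 2 * (m + r)) choose i)) =
      2 * (\<Sum>i\<le>n. 2 ^ (n - i) * (of_nat ((2 * i + 2 * (m + r)) choose i) :: real))"
    by (auto simp: sum_distrib_left Suc_diff_le intro!: sum.cong)
  then show ?case using Suc by (simp add: millsum_Suc millcount_def)
qed (simp add: millsum_0 millcount_def)

text \<open>On the diagonal \<open>m + r = j\<close> with \<open>m \<ge> 1\<close> the weights are
  one 1 and \<open>j - 1\<close> times 2, in total \<open>2 * j - 1\<close>.\<close>

lemma sum_diagonal:
  fixes g :: "nat \<Rightarrow> real"
  assumes "\<And>j. j > n \<Longrightarrow> g j = 0"
  shows "(\<Sum>m=1..n. \<Sum>r=0..n. (if r = 0 then 1 else 2) * g (m + r)) = (\<Sum>j=1..n. (2 * real j - 1) * g j)"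
proof -
  have w: "(\<Sum>r<j. if r = 0 then 1 else 2 :: real) = 2 * real j - 1" if "j \<ge> 1" for j :: nat
    using that by (induction j rule: dec_induct) auto
  have "(\<Sum>m=1..n. \<Sum>r=0..n. (if r = 0 then 1 else 2) * g (m + r)) =
    (\<Sum>m=1..n. \<Sum>r=0..n - m. (if r = 0 then 1 else 2) * g (m + r))"
    by (intro sum.cong refl sum.mono_neutral_right) (auto simp: assms)
  also have "\<dots> = (\<Sum>(m, r)\<in>(SIGMA m:{1..n}. {0..n - m}). (if r = 0 then 1 else 2) * g (m + r))"
    by (simp add: sum.Sigma)
  also have "\<dots> = (\<Sum>(j, r)\<in>(SIGMA j:{1..n}. {..<j}). (if r = 0 then 1 else 2) * g j)"
    by (rule sum.reindex_bij_witness[where i = "\<lambda>(j, r). (j - r, r)" and j = "\<lambda>(m, r). (m + r, r)"]) auto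
  also have "\<dots> = (\<Sum>j=1..n. \<Sum>r<j. (if r = 0 then 1 else 2) * g j)"
    by (simp add: sum.Sigma)
  also have "\<dots> = (\<Sum>j=1..n. (2 * real j - 1) * g j)"
    by (intro sum.cong refl) (simp add: w flip: sum_distrib_right)
  finally show ?thesis .
qed

lemma crossing_count:
  "real (card (crossing_triples n)) =
     (\<Sum>j=1..n. (2 * real j - 1) * (if n < j + 4 then 0 else millcount j (n - (j + 4))))"
proof -
  define g where "g j = (if n < j + 4 then 0 else millcount j (n - (j + 4)))" for j
  have "real (card (crossing_triples n)) = (\<Sum>m=1..n. \<Sum>r=0..n. (if r = 0 then 1 else 2) * real (card (gap_triples m r n)))"
    unfolding card_crossing_triples of_nat_sum by (intro sum.cong refl) simp
  also have "\<dots> = (\<Sum>m=1..n. \<Sum>r=0..n. (if r = 0 then 1 else 2) * g (m + r))"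
    by (intro sum.cong refl) (simp add: card_gap_triples millsum_eq g_def)
  also have "\<dots> = (\<Sum>j=1..n. (2 * real j - 1) * g j)"
    by (rule sum_diagonal) (simp add: g_def)
  finally show ?thesis by (simp add: g_def)
qed

definition crossing_core :: "nat \<Rightarrow> real" where
  "crossing_core N = (\<Sum>j=1..N. (2 * real j - 1) * of_nat ((2 * N) choose (N - j)))"

text \<open>Every \<open>millcount\<close> doubles and gains one binomial, which reads C(2N, N - j)
  with \<open>N = n - 3\<close> whatever \<open>j\<close> is. In the borderline case
  \<open>n = j + 3\<close> the gain is the initial value \<open>millcount j 0 = 1\<close>.\<close>

lemma crossing_count_rec:
  "real (card (crossing_triples (Suc n))) = 2 * real (card (crossing_triples n)) +
     (if n < 3 then 0 else crossing_core (n - 3))"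
proof -
  define g where "g n j = (if n < j + 4 then 0 else millcount j (n - (j + 4)))" for n j
  have step: "g (Suc n) j = 2 * g n j + (if n < j + 3 then 0 else of_nat ((2 * (n - 3)) choose (n - 3 - j)))" for j
  proof (cases "n < j + 4")
    case True
    consider "n < j + 3" | "n = j + 3" using True by linarith
    then show ?thesis by cases (auto simp: g_def millcount_def)
  next
    case False
    then obtain k where k: "n = k + (j + 4)" by (metis le_add_diff_inverse2 linorder_not_less)
    have "millcount j (Suc k) = 2 * millcount j k + of_nat ((2 * Suc k + 2 * j) choose Suc k)"
      using millsum_Suc[of j 0 k] by (simp add: millsum_eq)
    then show ?thesis unfolding g_def k by (simp add: algebra_simps)
  qed
  have "real (card (crossing_triples (Suc n))) = (\<Sum>j=1..Suc n. (2 * real j - 1) * g (Suc n) j)"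
    by (simp only: crossing_count g_def)
  also have "\<dots> = 2 * (\<Sum>j=1..Suc n. (2 * real j - 1) * g n j) +
      (\<Sum>j=1..Suc n. (2 * real j - 1) * (if n < j + 3 then 0 else of_nat ((2 * (n - 3)) choose (n - 3 - j))))"
    unfolding step sum_distrib_left sum.distrib[symmetric] by (intro sum.cong refl) (simp add: algebra_simps)
  also have "(\<Sum>j=1..Suc n. (2 * real j - 1) * g n j) = real (card (crossing_triples n))"
    by (simp add: crossing_count g_def)
  also have "(\<Sum>j=1..Suc n. (2 * real j - 1) * (if n < j + 3 then 0 else of_nat ((2 * (n - 3)) choose (n - 3 - j)))) =
      (if n < 3 then 0 else crossing_core (n - 3))"
  proof (cases "n < 3")
    case False
    have "(\<Sum>j=1..Suc n. (2 * real j - 1) * (if n < j + 3 then 0 else of_nat ((2 * (n - 3)) choose (n - 3 - j)))) =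
       (\<Sum>j=1..n - 3. (2 * real j - 1) * (if n < j + 3 then 0 else of_nat ((2 * (n - 3)) choose (n - 3 - j))))"
      by (rule sum.mono_neutral_right) auto
    also have "\<dots> = crossing_core (n - 3)"
      unfolding crossing_core_def using False by (intro sum.cong refl) auto
    finally show ?thesis using False by simp
  qed (simp add: sum.neutral)
  finally show ?thesis by simp
qed

text \<open>The part with \<open>2 * j\<close> telescopes: by absorption, (N - j + 1) C(2N, N - j +
  1) = (N + j) C(2N, N - j). The remaining part is half of a row of Pascal's triangle without its
  central entry.\<close>

lemma crossing_core_eq:
  "crossing_core N = ((2 * real N + 1) * of_nat ((2 * N) choose N) - 4 ^ N) / 2"
proof -
  define c where "c k = real ((2 * N) choose k)" for k
  have tele: "2 * real j * c (N - j) = real (N - (j - 1)) * c (N - (j - 1)) - real (N - j) * c (N - j)"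
    if j: "j \<in> {1..N}" for j
  proof -
    have k: "Suc (N - j) = N - (j - 1)" "2 * N - (N - j) = N + j" using j by auto
    have "real (N - (j - 1)) * c (N - (j - 1)) = real (N + j) * c (N - j)"
      unfolding c_def k(1)[symmetric] of_nat_mult[symmetric] using binomial_absorption[of "N - j" "2 * N"]
        binomial_absorb_comp[of "2 * N" "N - j"] k(2)
      by (simp del: binomial_Suc_Suc)
    then show ?thesis using j by (simp add: of_nat_diff algebra_simps)
  qed
  have "(\<Sum>j=1..N. 2 * real j * c (N - j)) = (\<Sum>j=1..N. real (N - (j - 1)) * c (N - (j - 1)) - real (N - j) * c (N - j))"
    by (intro sum.cong refl tele)
  also have "\<dots> = real N * c N"
    using sum_telescope''[of 0 N "\<lambda>j. - (real (N - j) * c (N - j))"]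
    by (simp add: atLeastSucAtMost_greaterThanAtMost flip: atLeast0AtMost)
  finally have 1: "(\<Sum>j=1..N. 2 * real j * c (N - j)) = real N * c N" .
  have "(\<Sum>k\<le>2 * N. c k) = 2 ^ (2 * N)"
    unfolding c_def using choose_row_sum[of "2 * N"] by (metis of_nat_sum of_nat_numeral of_nat_power)
  moreover have "(\<Sum>k\<le>2 * N. c k) = (\<Sum>k<N. c k) + (c N + (\<Sum>k\<in>{N<..2 * N}. c k))"
  proof -
    have "{..2 * N} = {..<N} \<union> insert N {N<..2 * N}" by auto
    then have "(\<Sum>k\<le>2 * N. c k) = (\<Sum>k<N. c k) + sum c (insert N {N<..2 * N})"
      by (simp only:) (rule sum.union_disjoint, auto)
    then show ?thesis by simp
  qed
  moreover have "(\<Sum>k\<in>{N<..2 * N}. c k) = (\<Sum>k<N. c k)"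
    by (rule sum.reindex_bij_witness[where i = "\<lambda>k. 2 * N - k" and j = "\<lambda>k. 2 * N - k"])
       (auto simp: c_def intro!: arg_cong[where f = real] binomial_symmetric[symmetric])
  moreover have "(\<Sum>k<N. c k) = (\<Sum>j=1..N. c (N - j))"
    by (rule sum.reindex_bij_witness[where i = "\<lambda>k. N - k" and j = "\<lambda>k. N - k"]) auto
  ultimately have 2: "2 * (\<Sum>j=1..N. c (N - j)) = 4 ^ N - c N" by (simp add: power_mult)
  have "crossing_core N = (\<Sum>j=1..N. 2 * real j * c (N - j)) - (\<Sum>j=1..N. c (N - j))"
    unfolding crossing_core_def c_def by (simp add: algebra_simps flip: sum_subtractf)
  then show ?thesis using 1 2 by (simp add: c_def field_simps)
qed

section \<open>Counting all triples\<close>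

text \<open>Intended as the number of nested chains of \<open>m\<close> columns in an interval of
  length \<open>k\<close>. For \<open>k = 0\<close> truncated subtraction still gives the right
  values, 1 for \<open>m = 0\<close> and 0 otherwise.\<close>

definition nest :: "nat \<Rightarrow> nat \<Rightarrow> nat" where
  "nest k m = (2 * m + k - 1) choose (2 * m)"

text \<open>The bottoms read inwards, followed by the topmost cells \<open>snd c - 1\<close> read
  outwards, form a single sorted list of length \<open>2 * m\<close>; the innermost column is
  nonempty exactly if the two halves fit together.\<close>

lemma card_nested:
  assumes "U - L = int k"
  shows "finite {cs. nested L U cs \<and> length cs = m} \<and> card {cs. nested L U cs \<and> length cs = m} = nest k m"
proof (cases "k = 0")
  case True
  have "{cs. nested L U cs \<and> length cs = m} = (if m = 0 then {[]} else {})"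
    using assms True by (auto simp: length_Suc_conv gr0_conv_Suc)
  then show ?thesis using True by (auto simp: nest_def)
next
  case False
  define S where "S = {xs :: int list. length xs = 2 * m \<and> sorted xs \<and> set xs \<subseteq> {L..U - 1}}"
  define f where "f cs = map fst cs @ rev (map (\<lambda>c. snd c - 1) cs)" for cs :: "col list"
  define g where "g xs = zip (take m xs) (map (\<lambda>x. x + 1) (rev (drop m xs)))" for xs :: "int list"
  have srt: "sorted (rev (map (\<lambda>c. snd c - 1) cs)) = sorted (rev (map snd cs))" for cs :: "col list"
  proof -
    have "(\<lambda>x y :: col. snd y - 1 \<le> snd x - 1) = (\<lambda>x y. snd y \<le> snd x)" by (intro ext) auto
    then show ?thesis unfolding sorted_wrt_rev sorted_wrt_map by (rule arg_cong2[where f = sorted_wrt]) simp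
  qed
  have fS: "f cs \<in> S \<longleftrightarrow> length cs = m \<and> sorted (map fst cs) \<and> sorted (rev (map snd cs)) \<and>
      (\<forall>c\<in>set cs. \<forall>d\<in>set cs. fst c \<le> snd d - 1) \<and> (\<forall>c\<in>set cs. L \<le> fst c \<and> snd c \<le> U)" for cs
  proof -
    have "length (f cs) = 2 * m \<longleftrightarrow> length cs = m" by (auto simp: f_def)
    moreover have "sorted (f cs) \<longleftrightarrow> sorted (map fst cs) \<and> sorted (rev (map snd cs)) \<and>
        (\<forall>c\<in>set cs. \<forall>d\<in>set cs. fst c \<le> snd d - 1)"
      unfolding f_def sorted_append srt by auto
    moreover have "set (f cs) \<subseteq> {L..U - 1} \<longleftrightarrow> (\<forall>c\<in>set cs. L \<le> fst c \<and> fst c \<le> U - 1 \<and> L \<le> snd c - 1 \<and> snd c \<le> U)"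
      unfolding f_def by auto
    ultimately show ?thesis unfolding S_def by fastforce
  qed
  have conv: "nested L U cs \<and> length cs = m \<longleftrightarrow> f cs \<in> S \<and> length cs = m" for cs
  proof
    assume n: "nested L U cs \<and> length cs = m"
    have "fst c \<le> snd d - 1" if "c \<in> set cs" "d \<in> set cs" for c d
    proof -
      have ne: "cs \<noteq> []" using that by auto
      have "fst c \<le> fst (last cs)"
        using n that last_le_sorted[of "map fst cs" "fst c"] ne by (auto simp: nested_iff_sorted last_map)
      moreover have "snd (last cs) \<le> snd d"
        using n that hd_le_sorted[of "rev (map snd cs)" "snd d"] ne by (auto simp: nested_iff_sorted hd_rev last_map)
      moreover have "fst (last cs) < snd (last cs)" using n ne by (auto simp: nested_iff_sorted)
      ultimately show ?thesis by linarith
    qed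
    then show "f cs \<in> S \<and> length cs = m" using n by (simp add: fS nested_iff_sorted)
  next
    assume n: "f cs \<in> S \<and> length cs = m"
    then show "nested L U cs \<and> length cs = m" by (fastforce simp: fS nested_iff_sorted)
  qed
  have gf: "g (f cs) = cs" if "length cs = m" for cs
    using that by (auto simp: f_def g_def rev_map comp_def zip_map_fst_snd)
  have fg: "f (g xs) = xs \<and> length (g xs) = m" if "xs \<in> S" for xs
  proof -
    have "length xs = 2 * m" using that by (simp add: S_def)
    then have "map fst (g xs) = take m xs" "map snd (g xs) = map (\<lambda>x. x + 1) (rev (drop m xs))" "length (g xs) = m"
      by (auto simp: g_def)
    moreover have "map (\<lambda>c. snd c - 1) (g xs) = map (\<lambda>x. x - 1) (map snd (g xs))" by simp
    ultimately show ?thesis by (simp add: f_def rev_map comp_def)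
  qed
  have bij: "bij_betw f {cs. nested L U cs \<and> length cs = m} S"
    by (rule bij_betw_byWitness[where f' = g]) (use conv gf fg in auto)
  have "finite S \<and> card S = (2 * m + nat (U - 1 - L)) choose (2 * m)"
    unfolding S_def using assms False by (intro sorted_list_range) simp
  moreover have "2 * m + nat (U - 1 - L) = 2 * m + k - 1" using assms False by simp
  ultimately show ?thesis
    using bij_betw_same_card[OF bij] bij_betw_finite[OF bij] unfolding nest_def by presburger
qed

abbreviation height_of :: "col \<Rightarrow> int" where
  "height_of c \<equiv> snd c - fst c"

lemma triples_last:
  assumes "(G, M, H) \<in> triples n"
  shows "0 \<le> fst (last M)" "fst (last M) < snd (last M)" "1 \<le> int (length M)"
    "int (length G) + int (length M) + int (length H) + snd (last M) = int n"
proof -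
  have "para M" and n: "int (length G + length M + length H) + snd (last M) = int n"
    using assms by (auto simp: triples_def)
  then have "M \<noteq> []" by (auto simp: para_def)
  then show "0 \<le> fst (last M)" "fst (last M) < snd (last M)" "1 \<le> int (length M)"
    using para_bounds[OF \<open>para M\<close>, of "last M"] by (auto simp: Suc_le_eq)
  show "int (length G) + int (length M) + int (length H) + snd (last M) = int n"
    using n by simp
qed

text \<open>Heights are bounded below instead of prescribed because a further column can overlap the
  last one in \<open>j\<close> rows precisely when the latter has height at least
  \<open>j\<close>.\<close>

definition grow_tail :: "nat \<Rightarrow> nat \<Rightarrow> (col list \<times> col list) set" where
  "grow_tail n k = {(G, M). para M \<and> nested 1 (snd (hd M)) G \<and> int k \<le> height_of (last M) \<and>
     int (length G + length M) + snd (last M) = int n}"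

definition grow :: "nat \<Rightarrow> nat \<Rightarrow> (col list \<times> col list) set" where
  "grow n k = {(G, M) \<in> grow_tail n k. height_of (last M) = int k}"

lemma grow_tail_triples: "(G, M) \<in> grow_tail n k \<Longrightarrow> (G, M, []) \<in> triples n"
  by (simp add: grow_tail_def triples_def)

lemma finite_grow_tail: "finite (grow_tail n k)"
proof (rule finite_subset)
  show "grow_tail n k \<subseteq> (\<lambda>(G, M, H). (G, M)) ` triples n"
    using grow_tail_triples by force
qed (simp add: finite_triples)

lemma finite_grow: "finite (grow n k)"
  by (rule finite_subset[OF _ finite_grow_tail[of n k]]) (auto simp: grow_def)

lemma grow_tail_empty: "n \<le> k \<Longrightarrow> grow_tail n k = {}"
proof (rule ccontr)
  assume le: "n \<le> k" and "grow_tail n k \<noteq> {}"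
  then obtain G M where gm: "(G, M) \<in> grow_tail n k" by fast
  then have "int k \<le> height_of (last M)" by (simp add: grow_tail_def)
  then show False using triples_last[OF grow_tail_triples[OF gm]] le by linarith
qed

lemma card_grow_tail: "card (grow_tail n k) = card (grow n k) + card (grow_tail n (Suc k))"
proof -
  have "grow_tail n k = grow n k \<union> grow_tail n (Suc k)" by (auto simp: grow_def grow_tail_def)
  moreover have "grow n k \<inter> grow_tail n (Suc k) = {}" by (auto simp: grow_def grow_tail_def)
  ultimately show ?thesis by (simp add: card_Un_disjoint finite_grow finite_grow_tail)
qed

definition extend :: "nat \<Rightarrow> nat \<Rightarrow> col list \<times> col list \<Rightarrow> col list \<times> col list" where
  "extend k j = (\<lambda>(G, M). (G, M @ [(snd (last M) - int j, snd (last M) - int j + int k)]))"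

lemma para_snoc:
  "para (M @ [d]) \<longleftrightarrow> (if M = [] then fst d = 0 \<and> 0 < snd d else para M \<and> slant (last M) d \<and> fst d < snd d)"
  by (auto simp: para_def successively_append_iff)

text \<open>The last column of \<open>M\<close> is either the only one, or it is determined by its
  height \<open>k\<close> and its overlap \<open>j\<close> with its predecessor. In the latter case
  it adds 1 to the width and \<open>k - j\<close> to the height.\<close>

lemma grow_eq:
  assumes "k \<ge> 1"
  shows "grow n k = (\<lambda>G. (G, [(0, int k)])) ` {G. nested 1 (int k) G \<and> int (length G) = int n - 1 - int k} \<union>
    (\<Union>j\<in>{1..k}. extend k j ` grow_tail (n - 1 - (k - j)) j)" (is "_ = ?A \<union> ?B")
proof (intro equalityI subsetI)
  fix x assume x: "x \<in> grow n k"
  obtain G M where GM: "x = (G, M)" by fastforce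
  have par: "para M" and G: "nested 1 (snd (hd M)) G" and ht: "height_of (last M) = int k"
    and n: "int (length G + length M) + snd (last M) = int n"
    using x by (auto simp: GM grow_def grow_tail_def)
  obtain M' d where M: "M = M' @ [d]" using par by (metis append_butlast_last_id para_def)
  show "x \<in> ?A \<union> ?B"
  proof (cases "M' = []")
    case True
    then have "d = (0, int k)" using par ht by (simp add: M para_def prod_eq_iff)
    then show ?thesis using True G n by (auto simp: GM M)
  next
    case False
    have par': "para M'" and sl: "slant (last M') d" using par False by (auto simp: M para_snoc)
    define j where "j = nat (snd (last M') - fst d)"
    have jj: "int j = snd (last M') - fst d" "1 \<le> j" "j \<le> k" "int j \<le> height_of (last M')"
      using sl ht by (auto simp: j_def slant_def M)
    have "int (length G + length M') + snd (last M') = int (n - 1 - (k - j))"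
    proof -
      have "0 \<le> snd (last M')"
        using False para_bounds(1,2)[OF par', of "last M'"] by fastforce
      then have "k + 1 \<le> n + j" using n jj ht by (simp add: M)
      then show ?thesis using n jj ht by (simp add: M of_nat_diff)
    qed
    then have "(G, M') \<in> grow_tail (n - 1 - (k - j)) j"
      using par' G jj False by (simp add: grow_tail_def M)
    moreover have "x = extend k j (G, M')"
      using jj ht by (simp add: GM M extend_def prod_eq_iff)
    ultimately show ?thesis using jj by auto
  qed
next
  fix x assume "x \<in> ?A \<union> ?B"
  then consider "x \<in> ?A" | j where "j \<in> {1..k}" "x \<in> extend k j ` grow_tail (n - 1 - (k - j)) j" by blast
  then show "x \<in> grow n k"
  proof cases
    case 1
    then show ?thesis using assms by (auto simp: grow_def grow_tail_def para_def)
  next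
    case 2
    then obtain G M where GM: "(G, M) \<in> grow_tail (n - 1 - (k - j)) j" and x: "x = extend k j (G, M)" by auto
    have par: "para M" and M: "M \<noteq> []" using GM by (auto simp: grow_tail_def para_def)
    \<comment> \<open>The subtraction is truncated, but \<open>grow_tail 0 j\<close> is empty, so
      truncation never produces a spurious element.\<close>
    have "n - 1 - (k - j) > 0" using GM grow_tail_empty[of "n - 1 - (k - j)" j] by (cases "n - 1 - (k - j)") auto
    then have "int (n - 1 - (k - j)) = int n - 1 - (int k - int j)" using 2 by simp
    then show ?thesis
      using GM par M 2 assms by (auto simp: x extend_def grow_def grow_tail_def para_snoc slant_def)
  qed
qed

lemma card_grow:
  assumes "k \<ge> 1"
  shows "card (grow n k) = (if n < k + 1 then 0 else nest (k - 1) (n - 1 - k)) + (\<Sum>j=1..k. card (grow_tail (n - 1 - (k - j)) j))"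
proof -
  let ?S = "{G. nested 1 (int k) G \<and> int (length G) = int n - 1 - int k}"
  let ?A = "(\<lambda>G. (G, [(0 :: int, int k)])) ` ?S" and ?B = "\<lambda>j. extend k j ` grow_tail (n - 1 - (k - j)) j"
  have S: "finite ?S \<and> card ?S = (if n < k + 1 then 0 else nest (k - 1) (n - 1 - k))"
  proof (cases "n < k + 1")
    case False
    then have "?S = {G. nested 1 (int k) G \<and> length G = n - 1 - k}" by auto
    then show ?thesis using card_nested[of "int k" 1 "k - 1" "n - 1 - k"] assms False by simp
  next
    case True
    then have "?S = {}" by auto
    then show ?thesis using True by simp
  qed
  have "inj_on (\<lambda>G. (G, [(0 :: int, int k)])) ?S" by (simp add: inj_on_def)
  then have "card ?A = card ?S" by (rule card_image)
  then have A: "finite ?A" "card ?A = (if n < k + 1 then 0 else nest (k - 1) (n - 1 - k))"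
    using S by simp_all
  have inj: "inj_on (extend k j) X" for j X by (auto simp: inj_on_def extend_def)
  have B: "finite (?B j)" "card (?B j) = card (grow_tail (n - 1 - (k - j)) j)" for j
    using inj by (simp_all add: card_image finite_grow_tail)
  have ne: "M \<noteq> []" if "(G, M) \<in> grow_tail i j" for G M i j using that by (auto simp: grow_tail_def para_def)
  have disj: "?B j \<inter> ?B j' = {}" if "j \<noteq> j'" for j j'
    using that by (auto simp: extend_def)
  have AB: "?A \<inter> (\<Union>j\<in>{1..k}. ?B j) = {}" using ne by (fastforce simp: extend_def)
  have "card (grow n k) = card ?A + card (\<Union>j\<in>{1..k}. ?B j)"
    unfolding grow_eq[OF assms] by (rule card_Un_disjoint[OF A(1) _ AB]) (intro finite_UN_I finite_atLeastAtMost B(1))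
  also have "card (\<Union>j\<in>{1..k}. ?B j) = (\<Sum>j=1..k. card (?B j))"
    by (rule card_UN_disjoint) (use B(1) disj in blast)+
  finally show ?thesis unfolding A(2) B(2) .
qed

definition triples_tail :: "nat \<Rightarrow> nat \<Rightarrow> (col list \<times> col list \<times> col list) set" where
  "triples_tail n k = {(G, M, H) \<in> triples n. int k \<le> height_of (last M)}"

lemma triples_tail_1: "triples_tail n 1 = triples n"
proof -
  have "int 1 \<le> height_of (last M)" if "(G, M, H) \<in> triples n" for G M H
    using triples_last[OF that] by linarith
  then show ?thesis unfolding triples_tail_def by blast
qed

lemma triples_tail_empty: "n \<le> k \<Longrightarrow> triples_tail n k = {}"
proof (rule ccontr)
  assume le: "n \<le> k" and "triples_tail n k \<noteq> {}"
  then obtain G M H where gm: "(G, M, H) \<in> triples n" "int k \<le> height_of (last M)" by (auto simp: triples_tail_def)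
  then show False using triples_last[OF gm(1)] le by linarith
qed

text \<open>Once the last column of \<open>M\<close> has height \<open>k\<close>, the chain
  \<open>H\<close> lives in an interval of length \<open>k - 1\<close>, wherever that column lies.
  The count is therefore a convolution in the length of \<open>H\<close>.\<close>

lemma card_triples_tail:
  assumes "k \<ge> 1"
  shows "card (triples_tail n k) = (\<Sum>i\<le>n. card (grow i k) * nest (k - 1) (n - i)) + card (triples_tail n (Suc k))"
proof -
  define E where "E = {(G, M, H) \<in> triples n. height_of (last M) = int k}"
  have finE: "finite E" "finite (triples_tail n (Suc k))"
    by (rule finite_subset[OF _ finite_triples[of n]]; auto simp: E_def triples_tail_def)+
  have "triples_tail n k = E \<union> triples_tail n (Suc k)" "E \<inter> triples_tail n (Suc k) = {}"
    by (auto simp: E_def triples_tail_def)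
  then have 1: "card (triples_tail n k) = card E + card (triples_tail n (Suc k))"
    using finE by (simp add: card_Un_disjoint)
  define F where "F i = (SIGMA GM:grow i k. {H. nested (fst (last (snd GM))) (snd (last (snd GM)) - 1) H \<and> length H = n - i})" for i
  define assoc where "assoc = (\<lambda>((G, M), H). (G :: col list, M :: col list, H :: col list))"
  have inj: "inj_on assoc X" for X by (auto simp: inj_on_def assoc_def)
  have "E = (\<Union>i\<in>{..n}. assoc ` F i)"
  proof (intro equalityI subsetI)
    fix x assume "x \<in> E"
    moreover obtain G M H where x: "x = (G, M, H)" by (metis prod_cases3)
    ultimately have e: "(G, M, H) \<in> triples n" "height_of (last M) = int k" by (auto simp: E_def)
    note n = triples_last(4)[OF e(1)]
    have "0 \<le> snd (last M)" using triples_last(1,2)[OF e(1)] by linarith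
    then obtain s where s: "snd (last M) = int s" by (metis nonneg_int_cases)
    define i where "i = length G + length M + s"
    have i: "i \<le> n" "length H = n - i" using n s by (simp_all add: i_def)
    have "(G, M) \<in> grow i k" using e s by (simp add: grow_def grow_tail_def triples_def i_def)
    then have "((G, M), H) \<in> F i" using e i by (simp add: F_def triples_def)
    then show "x \<in> (\<Union>i\<in>{..n}. assoc ` F i)" using i unfolding x by (force simp: assoc_def)
  next
    fix x assume "x \<in> (\<Union>i\<in>{..n}. assoc ` F i)"
    then obtain i G M H where i: "i \<le> n" and f: "((G, M), H) \<in> F i" and x: "x = (G, M, H)"
      by (auto simp: assoc_def)
    then show "x \<in> E"
      by (simp add: E_def F_def grow_def grow_tail_def triples_def)
  qed
  moreover have cF: "finite (F i) \<and> card (F i) = card (grow i k) * nest (k - 1) (n - i)" for i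
  proof -
    have c: "finite {H. nested (fst (last M)) (snd (last M) - 1) H \<and> length H = n - i} \<and>
        card {H. nested (fst (last M)) (snd (last M) - 1) H \<and> length H = n - i} = nest (k - 1) (n - i)"
      if "(G, M) \<in> grow i k" for G M
      using that assms by (intro card_nested) (auto simp: grow_def)
    have "card (F i) = (\<Sum>GM\<in>grow i k. card {H. nested (fst (last (snd GM))) (snd (last (snd GM)) - 1) H \<and> length H = n - i})"
      unfolding F_def using c by (intro card_SigmaI) (auto simp: finite_grow)
    also have "\<dots> = (\<Sum>GM\<in>grow i k. nest (k - 1) (n - i))"
      using c by (intro sum.cong refl) auto
    finally have "card (F i) = card (grow i k) * nest (k - 1) (n - i)" by simp
    moreover have "finite (F i)" unfolding F_def using c by (intro finite_SigmaI) (auto simp: finite_grow)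
    ultimately show ?thesis by simp
  qed
  moreover have "card (\<Union>i\<in>{..n}. assoc ` F i) = (\<Sum>i\<le>n. card (assoc ` F i))"
  proof (rule card_UN_disjoint)
    show "\<forall>i\<in>{..n}. \<forall>j\<in>{..n}. i \<noteq> j \<longrightarrow> assoc ` F i \<inter> assoc ` F j = {}"
      by (auto simp: assoc_def F_def grow_def grow_tail_def)
  qed (use cF in auto)
  ultimately have "card E = (\<Sum>i\<le>n. card (grow i k) * nest (k - 1) (n - i))"
    using inj by (simp add: card_image)
  then show ?thesis using 1 by simp
qed

section \<open>Generating functions\<close>

text \<open>Multiplication by the unit \<open>1 - u\<close> cannot raise the order of a series,
  whereas the order of \<open>E k\<close> exceeds \<open>k\<close>. In terms of coefficients: if all
  those below \<open>n\<close> vanish for every \<open>k\<close>, the \<open>n\<close>-th one does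
  not depend on \<open>k\<close>, and it is 0 for large \<open>k\<close>.\<close>

lemma fps_eq_0_if_degrees_grow:
  fixes E :: "nat \<Rightarrow> real fps"
  assumes rec: "\<And>k. k \<ge> 1 \<Longrightarrow> E (Suc k) = (1 - u) * E k" and "fps_nth u 0 = 0"
    and small: "\<And>n k. n \<le> k \<Longrightarrow> fps_nth (E k) n = 0"
  shows "E 1 = 0"
proof -
  have "\<forall>k\<ge>1. fps_nth (E k) n = 0" for n
  proof (induction n rule: less_induct)
    case (less n)
    have step: "fps_nth (E k) n = fps_nth (E (Suc k)) n" if "k \<ge> 1" for k
    proof -
      have "fps_nth (u * E k) n = (\<Sum>i=0..n. fps_nth u i * fps_nth (E k) (n - i))" by (simp add: fps_mult_nth)
      also have "\<dots> = 0"
      proof (intro sum.neutral ballI)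
        fix i assume "i \<in> {0..n}"
        then show "fps_nth u i * fps_nth (E k) (n - i) = 0"
          using less that assms(2) by (cases "i = 0") auto
      qed
      finally have "fps_nth (u * E k) n = 0" .
      moreover have "E k = E (Suc k) + u * E k" using rec[OF that] by (simp add: algebra_simps)
      ultimately show ?thesis by (metis add.right_neutral fps_add_nth)
    qed
    have "fps_nth (E k) n = fps_nth (E (k + i)) n" if "k \<ge> 1" for k i
    proof (induction i)
      case (Suc i)
      then show ?case using step[of "k + i"] that by simp
    qed simp
    then show ?case using small by (metis le_add1 add.commute)
  qed
  then show ?thesis by (simp add: fps_eq_iff)
qed

definition nested_fps :: "nat \<Rightarrow> real fps" where "nested_fps k = Abs_fps (\<lambda>m. of_nat (nest k m))"
definition grow_tail_fps :: "nat \<Rightarrow> real fps" where "grow_tail_fps k = Abs_fps (\<lambda>n. of_nat (card (grow_tail n k)))"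
definition grow_fps :: "nat \<Rightarrow> real fps" where "grow_fps k = Abs_fps (\<lambda>n. of_nat (card (grow n k)))"
definition triples_fps :: "nat \<Rightarrow> real fps" where "triples_fps k = Abs_fps (\<lambda>n. of_nat (card (triples_tail n k)))"

lemma nested_fps_0: "nested_fps 0 = 1"
  by (rule fps_ext) (auto simp: nested_fps_def nest_def)

text \<open>A second difference in the upper argument of a binomial lowers the lower argument by
  two, which is one column fewer.\<close>

lemma nest_rec: "nest (Suc (Suc k)) (Suc p) + nest k (Suc p) = 2 * nest (Suc k) (Suc p) + nest (Suc (Suc k)) p"
proof -
  have *: "Suc (Suc (2 * p)) + Suc (Suc k) - 1 = Suc (Suc (2 * p + k + 1))" "Suc (Suc (2 * p)) + k - 1 = 2 * p + k + 1"
    "Suc (Suc (2 * p)) + Suc k - 1 = Suc (2 * p + k + 1)" "2 * p + Suc (Suc k) - 1 = 2 * p + k + 1"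
    "2 * Suc p = Suc (Suc (2 * p))" by simp_all
  have "(Suc (Suc N) choose Suc (Suc q)) + (N choose Suc (Suc q)) = 2 * (Suc N choose Suc (Suc q)) + (N choose q)" for N q
    by simp
  then show ?thesis unfolding nest_def * .
qed

lemma nested_fps_1: "(1 - fps_X) * nested_fps 1 = 1"
proof (rule fps_ext)
  fix n show "fps_nth ((1 - fps_X) * nested_fps 1) n = fps_nth 1 n"
    by (cases n) (simp_all add: nested_fps_def nest_def algebra_simps)
qed

lemma nested_fps_rec: "(1 - fps_X) * nested_fps (Suc (Suc k)) = 2 * nested_fps (Suc k) - nested_fps k"
proof (rule fps_ext)
  fix n show "fps_nth ((1 - fps_X) * nested_fps (Suc (Suc k))) n = fps_nth (2 * nested_fps (Suc k) - nested_fps k) n"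
  proof (cases n)
    case 0
    then show ?thesis by (simp add: nested_fps_def nest_def algebra_simps)
  next
    case (Suc p)
    have "real (nest (Suc (Suc k)) (Suc p)) + nest k (Suc p) = 2 * nest (Suc k) (Suc p) + nest (Suc (Suc k)) p"
      using nest_rec[of k p] by linarith
    then show ?thesis using Suc by (simp add: nested_fps_def algebra_simps numeral_fps_const)
  qed
qed

lemma grow_tail_fps_split: "grow_tail_fps k = grow_fps k + grow_tail_fps (Suc k)"
  by (rule fps_ext) (simp add: grow_tail_fps_def grow_fps_def card_grow_tail[of _ k])

lemma grow_fps_eq:
  assumes "k \<ge> 1"
  shows "grow_fps k = fps_X ^ (k + 1) * nested_fps (k - 1) + fps_X * (\<Sum>j=1..k. fps_X ^ (k - j) * grow_tail_fps j)"
proof (rule fps_ext)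
  fix n
  have nth: "fps_nth (fps_X * (fps_X ^ (k - j) * grow_tail_fps j)) n = card (grow_tail (n - 1 - (k - j)) j)" for j
  proof (cases "n < Suc (k - j)")
    case True
    then have "n - 1 - (k - j) = 0" by simp
    then have "grow_tail (n - 1 - (k - j)) j = {}" by (intro grow_tail_empty) simp
    then show ?thesis using True
      by (simp only: mult.assoc[symmetric] power_Suc[symmetric] fps_X_power_mult_nth) simp
  next
    case False
    have "n - Suc (k - j) = n - 1 - (k - j)" by simp
    then show ?thesis using False
      by (simp only: mult.assoc[symmetric] power_Suc[symmetric] fps_X_power_mult_nth grow_tail_fps_def fps_nth_Abs_fps if_False)
  qed
  have "fps_nth (grow_fps k) n = real (if n < k + 1 then 0 else nest (k - 1) (n - 1 - k)) + (\<Sum>j=1..k. real (card (grow_tail (n - 1 - (k - j)) j)))"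
    unfolding grow_fps_def fps_nth_Abs_fps card_grow[OF assms] of_nat_add of_nat_sum ..
  also have "real (if n < k + 1 then 0 else nest (k - 1) (n - 1 - k)) = fps_nth (fps_X ^ (k + 1) * nested_fps (k - 1)) n"
    unfolding fps_X_power_mult_nth nested_fps_def by simp
  also have "(\<Sum>j=1..k. real (card (grow_tail (n - 1 - (k - j)) j))) = fps_nth (fps_X * (\<Sum>j=1..k. fps_X ^ (k - j) * grow_tail_fps j)) n"
    unfolding sum_distrib_left fps_sum_nth nth ..
  finally show "fps_nth (grow_fps k) n = fps_nth (fps_X ^ (k + 1) * nested_fps (k - 1) + fps_X * (\<Sum>j=1..k. fps_X ^ (k - j) * grow_tail_fps j)) n"
    by simp
qed

lemma grow_tail_fps_2: "grow_tail_fps 2 = (1 - fps_X) * grow_tail_fps 1 - fps_X ^ 2"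
proof -
  have "grow_fps 1 = fps_X ^ 2 + fps_X * grow_tail_fps 1"
    using grow_fps_eq[of 1] by (simp add: nested_fps_0 power2_eq_square)
  moreover have "grow_tail_fps 1 = grow_fps 1 + grow_tail_fps 2"
    using grow_tail_fps_split[of 1] by (simp only: numeral_2_eq_2 One_nat_def)
  then have "grow_tail_fps 2 = grow_tail_fps 1 - grow_fps 1" by (simp only: add_diff_cancel_left')
  ultimately show ?thesis by (simp only: left_diff_distrib mult_1 diff_diff_eq add.commute)
qed

text \<open>The sum over overlaps for \<open>Suc k\<close> is \<open>fps_X\<close> times that for
  \<open>k\<close> plus a single new term, so subtracting removes the sums of growing length and
  leaves a three-term recursion.\<close>

lemma grow_tail_fps_rec:
  assumes "k \<ge> 1"
  shows "grow_tail_fps (Suc (Suc k)) = grow_tail_fps (Suc k) - fps_X * grow_tail_fps k - fps_X ^ (k + 2) * (nested_fps k - nested_fps (k - 1))"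
proof -
  define R where "R k = (\<Sum>j=1..k. fps_X ^ (k - j) * grow_tail_fps j)" for k
  have "R (Suc k) = (\<Sum>j=1..k. fps_X ^ (Suc k - j) * grow_tail_fps j) + grow_tail_fps (Suc k)"
    by (simp add: R_def)
  also have "(\<Sum>j=1..k. fps_X ^ (Suc k - j) * grow_tail_fps j) = fps_X * R k"
    unfolding R_def sum_distrib_left by (intro sum.cong refl) (simp add: Suc_diff_le)
  finally have R: "R (Suc k) = fps_X * R k + grow_tail_fps (Suc k)" .
  have v: "grow_fps k = fps_X ^ (k + 1) * nested_fps (k - 1) + fps_X * R k"
    "grow_fps (Suc k) = fps_X ^ (k + 2) * nested_fps k + fps_X * R (Suc k)"
    using grow_fps_eq[OF assms] grow_fps_eq[of "Suc k"] unfolding R_def by simp_all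
  have "grow_tail_fps (Suc (Suc k)) = grow_tail_fps (Suc k) - grow_fps (Suc k)"
    unfolding grow_tail_fps_split[of "Suc k"] by simp
  also have "\<dots> = grow_tail_fps (Suc k) - fps_X * (grow_fps k + grow_tail_fps (Suc k)) - fps_X ^ (k + 2) * (nested_fps k - nested_fps (k - 1))"
    unfolding v R by (simp add: algebra_simps)
  also have "grow_fps k + grow_tail_fps (Suc k) = grow_tail_fps k" by (rule grow_tail_fps_split[symmetric])
  finally show ?thesis .
qed

lemma grow_tail_fps_small: "n \<le> k \<Longrightarrow> fps_nth (grow_tail_fps k) n = 0"
  by (simp add: grow_tail_fps_def grow_tail_empty)

lemma mult_nth_small:
  fixes f g :: "real fps"
  shows "(\<And>i. i \<le> n \<Longrightarrow> fps_nth g i = 0) \<Longrightarrow> fps_nth (f * g) n = 0"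
  by (auto simp: fps_mult_nth intro!: sum.neutral)

text \<open>The homogeneous part of \<open>grow_tail_fps_rec\<close> has characteristic equation x^2
  - x + X = 0 with roots \<open>u\<close> and \<open>1 - u\<close>. The combination
  \<open>W - u * V\<close> eliminates the root \<open>u\<close>, and the term with \<open>T\<close>
  absorbs the inhomogeneity. Here \<open>V\<close>, \<open>W\<close> and \<open>a\<close>,
  \<open>b\<close> stand for consecutive members of the two sequences of series.\<close>

lemma V_step:
  fixes u X a b T V W :: "'a :: idom"
  assumes "X = u * (1 - u)"
  shows "(1 - u) * (1 - 2 * u) * (W - X * V - T * (b - a) - u * W) - X * T * (2 * b - a - (1 - u) * b) =
     (1 - u) * ((1 - u) * (1 - 2 * u) * (W - u * V) - T * ((1 - X) * b - (1 - u) * a))"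
  unfolding assms by (simp add: power2_eq_square algebra_simps)

text \<open>Two linear equations for the first two members of the sequence; eliminating
  \<open>W\<close> leaves \<open>V\<close> with the coefficient
  \<open>1 - X - u = (1 - u) ^ 2\<close>. The common factor \<open>(1 - u) ^ 3\<close> is cancelled
  where it is known to be nonzero.\<close>

lemma V_start:
  fixes u X V W :: "'a :: idom"
  assumes "X = u * (1 - u)" "W = (1 - X) * V - X ^ 2" "(1 - u) * (1 - 2 * u) * (W - u * V) = X ^ 3 * u"
  shows "(1 - u) ^ 3 * ((1 - 2 * u) * V) = (1 - u) ^ 3 * X ^ 2"
proof -
  have "1 - X - u = (1 - u) ^ 2" unfolding assms(1) by (simp add: power2_eq_square algebra_simps)
  moreover have "W - u * V = (1 - X - u) * V - X ^ 2" unfolding assms(2) by (simp add: algebra_simps)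
  ultimately have VW: "(1 - u) ^ 2 * V = W - u * V + X ^ 2" by simp
  have "(1 - u) ^ 3 * ((1 - 2 * u) * V) = (1 - u) * (1 - 2 * u) * ((1 - u) ^ 2 * V)"
    by (simp add: power2_eq_square power3_eq_cube mult_ac)
  also have "\<dots> = (1 - u) * (1 - 2 * u) * (W - u * V) + (1 - u) * (1 - 2 * u) * X ^ 2"
    unfolding VW by (simp only: distrib_left)
  also have "\<dots> = X ^ 2 * (X * u + (1 - u) * (1 - 2 * u))"
    unfolding assms(3) by (simp add: power2_eq_square power3_eq_cube algebra_simps)
  also have "X * u + (1 - u) * (1 - 2 * u) = (1 - u) ^ 3"
    unfolding assms(1) by (simp add: power3_eq_cube algebra_simps)
  finally show ?thesis by simp
qed

text \<open>
  A form, quadratic in \<open>(V, W, a, b)\<close>, whose step from \<open>k\<close> to \<open>k + 1\<close> telescopes the sum of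
  \<open>grow_fps k * nested_fps (k - 1)\<close>; its coefficients were found by solving a linear system.
\<close>

definition T_form :: "'a :: idom \<Rightarrow> 'a \<Rightarrow> 'a \<Rightarrow> 'a \<Rightarrow> 'a \<Rightarrow> 'a \<Rightarrow> 'a" where
  "T_form X T V W a b = (1 - 4 * X) * (1 - 2 * X) * ((1 - 5 * X) * V * a + 2 * X * V * b + 2 * X * W * a - W * b) +
     T * ((1 - 4 * X + X ^ 2 + 4 * X ^ 3) * a ^ 2 + (- 3 + 12 * X - 8 * X ^ 2) * a * b + (2 - 7 * X + 4 * X ^ 2) * b ^ 2)"

text \<open>The last argument of the form is meant to be \<open>1 - X\<close> times a series of
  nested chains. Its next value is then \<open>2 * b - a\<close>, by \<open>nested_fps_rec\<close>,
  and no division by \<open>1 - X\<close> occurs.\<close>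

lemma T_step:
  fixes X T V W a b :: "'a :: idom"
  shows "T_form X (X * T) W (W - X * V - T * (b - a)) b (2 * b - a) =
    T_form X T V W a ((1 - X) * b) - (1 - 4 * X) ^ 2 * (1 - 2 * X) * ((V - W) * a)"
proof -
  define D q where "D = (1 - 4 * X) * (1 - 2 * X)"
    and "q c d = (1 - 4 * X + X ^ 2 + 4 * X ^ 3) * c ^ 2 + (- 3 + 12 * X - 8 * X ^ 2) * c * d + (2 - 7 * X + 4 * X ^ 2) * d ^ 2" for c d
  have 1: "(1 - 5 * X) * W * b + 2 * X * W * (2 * b - a) + 2 * X * (W - X * V) * b - (W - X * V) * (2 * b - a) =
     (1 - 5 * X) * V * a + 2 * X * V * ((1 - X) * b) + 2 * X * W * a - W * ((1 - X) * b) - (1 - 4 * X) * ((V - W) * a)"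
    by (simp add: algebra_simps)
  have 2: "X * q b (2 * b - a) - D * ((b - a) * (2 * X * b - (2 * b - a))) = q a ((1 - X) * b)"
    unfolding q_def D_def by algebra
  have "T_form X (X * T) W (W - X * V - T * (b - a)) b (2 * b - a) =
      D * ((1 - 5 * X) * W * b + 2 * X * W * (2 * b - a) + 2 * X * (W - X * V) * b - (W - X * V) * (2 * b - a)) +
      T * (X * q b (2 * b - a) - D * ((b - a) * (2 * X * b - (2 * b - a))))"
    unfolding T_form_def D_def[symmetric] q_def[symmetric] by (simp add: algebra_simps)
  also have "\<dots> = D * ((1 - 5 * X) * V * a + 2 * X * V * ((1 - X) * b) + 2 * X * W * a - W * ((1 - X) * b)) +
      T * q a ((1 - X) * b) - (1 - 4 * X) * D * ((V - W) * a)"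
    unfolding 1 2 by (simp add: algebra_simps)
  finally show ?thesis
    unfolding T_form_def D_def q_def by (simp add: power2_eq_square mult.assoc)
qed

lemma T_start:
  fixes X V :: "'a :: idom"
  shows "T_form X (X ^ 3) V ((1 - X) * V - X ^ 2) 1 1 =
     (1 - 4 * X) * (1 - 2 * X) * X ^ 2 * (1 - 2 * X - 2 * V) + X ^ 4 * (1 - 3 * X + 4 * X ^ 2)"
  unfolding T_form_def mult_1_right power_one by algebra

text \<open>
  The kernel root \<open>u\<close> of \<open>u * (1 - u) = t\<close> turns the recursion in \<open>k\<close> into a geometric one, which is
  incompatible with the growing order of \<open>grow_tail_fps k\<close> unless its initial value vanishes.
\<close>

lemma grow_tail_fps_1:
  fixes s :: "real fps"
  assumes s: "s ^ 2 = 1 - 4 * fps_X" and s0: "fps_nth s 0 = 1"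
  shows "s * grow_tail_fps 1 = fps_X ^ 2"
proof -
  define u where "u = fps_const (1 / 2) * (1 - s)"
  have s_u: "s = 1 - 2 * u"
  proof -
    have "2 * fps_const (1 / 2) = (1 :: real fps)" by (simp add: numeral_fps_const fps_const_mult)
    then have "2 * u = 1 - s" by (simp add: u_def flip: mult.assoc)
    then show ?thesis by simp
  qed
  have X: "fps_X = u * (1 - u)"
  proof -
    have "4 * fps_X = 4 * (u * (1 - u))"
      using s unfolding s_u by (simp add: power2_eq_square algebra_simps)
    then show ?thesis by simp
  qed
  have u0: "fps_nth u 0 = 0" using s0 by (simp add: u_def)
  \<comment> \<open>The deviation from the solution belonging to the inhomogeneous term, cleared of
    denominators; by \<open>V_step\<close> it is multiplied by \<open>1 - u\<close> from one
    \<open>k\<close> to the next.\<close>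
  define E where "E k = (1 - u) * (1 - 2 * u) * (grow_tail_fps (Suc k) - u * grow_tail_fps k) -
    fps_X ^ (k + 2) * ((1 - fps_X) * nested_fps k - (1 - u) * nested_fps (k - 1))" for k
  have "E 1 = 0"
  proof (rule fps_eq_0_if_degrees_grow[OF _ u0])
    fix k :: nat assume k: "k \<ge> 1"
    define a b T W V where "a = nested_fps (k - 1)" and "b = nested_fps k" and "T = (fps_X :: real fps) ^ (k + 2)"
      and "W = grow_tail_fps (Suc k)" and "V = grow_tail_fps k"
    have "(1 - fps_X) * nested_fps (Suc k) = 2 * b - a"
      using nested_fps_rec[of "k - 1"] k by (simp add: a_def b_def T_def W_def V_def)
    moreover have "grow_tail_fps (Suc (Suc k)) = W - fps_X * V - T * (b - a)"
      using grow_tail_fps_rec[OF k] by (simp add: a_def b_def T_def W_def V_def)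
    ultimately have "E (Suc k) = (1 - u) * (1 - 2 * u) * (W - fps_X * V - T * (b - a) - u * W) -
        fps_X * T * (2 * b - a - (1 - u) * b)"
      by (simp add: E_def a_def b_def T_def W_def V_def)
    moreover have "E k = (1 - u) * (1 - 2 * u) * (W - u * V) - T * ((1 - fps_X) * b - (1 - u) * a)"
      by (simp add: E_def a_def b_def T_def W_def V_def)
    ultimately show "E (Suc k) = (1 - u) * E k"
      using V_step[OF X] by simp
  next
    fix n k :: nat assume "n \<le> k"
    then have small: "fps_nth (f * grow_tail_fps (Suc k)) n = 0" "fps_nth (f * grow_tail_fps k) n = 0" for f
      by (auto intro!: mult_nth_small grow_tail_fps_small)
    have "E k = (1 - u) * (1 - 2 * u) * grow_tail_fps (Suc k) - (1 - u) * (1 - 2 * u) * u * grow_tail_fps k -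
        fps_X ^ (k + 2) * ((1 - fps_X) * nested_fps k - (1 - u) * nested_fps (k - 1))"
      unfolding E_def by (simp add: right_diff_distrib mult.assoc)
    then show "fps_nth (E k) n = 0"
      using \<open>n \<le> k\<close> by (simp only: fps_sub_nth fps_X_power_mult_nth small) simp
  qed
  then have "(1 - u) * (1 - 2 * u) * (grow_tail_fps 2 - u * grow_tail_fps 1) = fps_X ^ 3 * u"
    by (simp add: E_def nested_fps_1[simplified] nested_fps_0 numeral_2_eq_2 numeral_3_eq_3)
  then have "(1 - u) ^ 3 * ((1 - 2 * u) * grow_tail_fps 1) = (1 - u) ^ 3 * fps_X ^ 2"
    by (rule V_start[OF X grow_tail_fps_2])
  moreover have "(1 - u) ^ 3 \<noteq> 0"
  proof
    assume "(1 - u) ^ 3 = 0"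
    then have "fps_nth (1 - u) 0 = 0" by simp
    then show False using u0 by simp
  qed
  ultimately show ?thesis unfolding s_u by simp
qed

lemma triples_fps_split:
  assumes "k \<ge> 1"
  shows "triples_fps k = grow_fps k * nested_fps (k - 1) + triples_fps (Suc k)"
  by (rule fps_ext) (simp add: triples_fps_def grow_fps_def nested_fps_def card_triples_tail[OF assms] fps_mult_nth atLeast0AtMost)

lemma triples_fps_1:
  "(1 - 4 * fps_X) ^ 2 * (1 - 2 * fps_X) * triples_fps 1 =
     (1 - 4 * fps_X) * (1 - 2 * fps_X) * fps_X ^ 2 * (1 - 2 * fps_X - 2 * grow_tail_fps 1) +
     fps_X ^ 4 * (1 - 3 * fps_X + 4 * fps_X ^ 2)"
proof -
  let ?X = "fps_X :: real fps"
  define E where "E k = (1 - 4 * ?X) ^ 2 * (1 - 2 * ?X) * triples_fps k -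
     T_form ?X (?X ^ (k + 2)) (grow_tail_fps k) (grow_tail_fps (Suc k)) (nested_fps (k - 1)) ((1 - ?X) * nested_fps k)" for k
  have "E 1 = 0"
  \<comment> \<open>With telescoping the difference does not change with \<open>k\<close> at all,
    hence the ratio \<open>1 - 0\<close>.\<close>
  proof (rule fps_eq_0_if_degrees_grow[where u = 0])
    fix k :: nat assume k: "k \<ge> 1"
    define a b T W V Z where defs: "a = nested_fps (k - 1)" "b = nested_fps k" "T = ?X ^ (k + 2)"
      "W = grow_tail_fps (Suc k)" "V = grow_tail_fps k" "Z = triples_fps (Suc k)"
    have c: "(1 - ?X) * nested_fps (Suc k) = 2 * b - a"
      using nested_fps_rec[of "k - 1"] k by (simp add: defs)
    have V2: "grow_tail_fps (Suc (Suc k)) = W - ?X * V - T * (b - a)"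
      using grow_tail_fps_rec[OF k] by (simp add: defs)
    have "grow_fps k = V - W" using grow_tail_fps_split[of k] by (simp add: defs)
    then have T: "triples_fps k = (V - W) * a + Z"
      using triples_fps_split[OF k] by (simp add: defs)
    have 1: "E (Suc k) = (1 - 4 * ?X) ^ 2 * (1 - 2 * ?X) * Z - T_form ?X (?X * T) W (W - ?X * V - T * (b - a)) b (2 * b - a)"
      unfolding E_def V2 c by (simp add: defs)
    have 2: "E k = (1 - 4 * ?X) ^ 2 * (1 - 2 * ?X) * ((V - W) * a + Z) - T_form ?X T V W a ((1 - ?X) * b)"
      unfolding E_def T by (simp add: defs)
    show "E (Suc k) = (1 - 0) * E k"
      unfolding 1 2 T_step by (simp add: algebra_simps)
  next
    fix n k :: nat assume nk: "n \<le> k"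
    have small: "fps_nth (f * triples_fps k) n = 0" "fps_nth (f * grow_tail_fps k) n = 0" "fps_nth (f * grow_tail_fps (Suc k)) n = 0" for f
      using nk by (auto intro!: mult_nth_small grow_tail_fps_small simp: triples_fps_def triples_tail_empty)
    define a b where "a = nested_fps (k - 1)" and "b = (1 - ?X) * nested_fps k"
    define f1 f2 f3 f4 where "f1 = (1 - 4 * ?X) ^ 2 * (1 - 2 * ?X)"
      and "f2 = (1 - 4 * ?X) * (1 - 2 * ?X) * ((1 - 5 * ?X) * a + 2 * ?X * b)"
      and "f3 = (1 - 4 * ?X) * (1 - 2 * ?X) * (2 * ?X * a - b)"
      and "f4 = (1 - 4 * ?X + ?X ^ 2 + 4 * ?X ^ 3) * a ^ 2 + (- 3 + 12 * ?X - 8 * ?X ^ 2) * a * b + (2 - 7 * ?X + 4 * ?X ^ 2) * b ^ 2"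
    have form: "T_form X T V W a b = ((1 - 4 * X) * (1 - 2 * X) * ((1 - 5 * X) * a + 2 * X * b)) * V +
        ((1 - 4 * X) * (1 - 2 * X) * (2 * X * a - b)) * W +
        T * ((1 - 4 * X + X ^ 2 + 4 * X ^ 3) * a ^ 2 + (- 3 + 12 * X - 8 * X ^ 2) * a * b + (2 - 7 * X + 4 * X ^ 2) * b ^ 2)"
      for X T V W a b :: "real fps"
      unfolding T_form_def by (simp add: ring_distribs mult_ac)
    have "E k = f1 * triples_fps k - (f2 * grow_tail_fps k + f3 * grow_tail_fps (Suc k) + ?X ^ (k + 2) * f4)"
      unfolding E_def form f1_def f2_def f3_def f4_def a_def b_def ..
    then show "fps_nth (E k) n = 0"
      using nk by (simp only: fps_sub_nth fps_add_nth fps_X_power_mult_nth small) simp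
  qed simp
  then have "(1 - 4 * ?X) ^ 2 * (1 - 2 * ?X) * triples_fps 1 = T_form ?X (?X ^ 3) (grow_tail_fps 1) (grow_tail_fps 2) 1 1"
    unfolding E_def using nested_fps_1 by (simp add: nested_fps_0 numeral_2_eq_2 numeral_3_eq_3)
  then show ?thesis
    unfolding grow_tail_fps_2 T_start .
qed

section \<open>The series of crossing triples and the final algebra\<close>

definition crossing_fps :: "real fps" where "crossing_fps = Abs_fps (\<lambda>n. of_nat (card (crossing_triples n)))"

lemma crossing_fps: "(1 - 2 * fps_X) * crossing_fps = fps_X ^ 4 * Abs_fps crossing_core"
proof (rule fps_ext)
  fix n
  show "fps_nth ((1 - 2 * fps_X) * crossing_fps) n = fps_nth (fps_X ^ 4 * Abs_fps crossing_core) n"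
  proof (cases n)
    case 0
    then show ?thesis using crossing_count[of 0] by (simp add: crossing_fps_def)
  next
    case (Suc m)
    have "(1 - 2 * fps_X) * crossing_fps = crossing_fps - fps_const 2 * (fps_X * crossing_fps)"
      by (simp add: algebra_simps numeral_fps_const)
    then show ?thesis
      using crossing_count_rec[of m] Suc by (simp add: crossing_fps_def fps_X_power_mult_nth)
  qed
qed

lemma central_binomial_rec: "Suc n * ((2 * Suc n) choose Suc n) = 2 * ((2 * n + 1) * ((2 * n) choose n))"
proof -
  have "Suc n * ((2 * Suc n) choose Suc n) = (2 * n + 2) * ((2 * n + 1) choose n)"
    using binomial_absorption[of n "2 * Suc n"] by simp
  moreover have "(n + 1) * ((2 * n + 1) choose n) = (2 * n + 1) * ((2 * n) choose n)"
    using binomial_absorb_comp[of "2 * n + 1" n] by simp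
  ultimately show ?thesis by (metis (no_types, lifting) mult.assoc mult_2 distrib_left_numeral mult.right_neutral)
qed

text \<open>These are the coefficients of (1 - 4t)^(-3/2). From \<open>n\<close> to
  \<open>Suc n\<close> both sides are multiplied by 2 (2n + 3) / (n + 1).\<close>

lemma central_gbinomial:
  "((- 3 / 2) gchoose n) * (- 4) ^ n = (2 * real n + 1) * of_nat ((2 * n) choose n)"
proof (induction n)
  case (Suc n)
  define c d where "c = real ((2 * n) choose n)" and "d = real ((2 * Suc n) choose Suc n)"
  have g: "((- 3 / 2 :: real) gchoose (Suc n)) * (real n + 1) = ((- 3 / 2) gchoose n) * (- 3 / 2 - real n)"
    using gbinomial_mult_1[of "- 3 / 2 :: real" n] by (simp add: algebra_simps)
  have "real (Suc n * ((2 * Suc n) choose Suc n)) = real (2 * ((2 * n + 1) * ((2 * n) choose n)))"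
    by (simp only: central_binomial_rec)
  then have d: "(real n + 1) * d = 2 * (2 * real n + 1) * c"
    by (simp add: c_def d_def algebra_simps del: binomial_Suc_Suc)
  have "(((- 3 / 2) gchoose Suc n) * (- 4) ^ Suc n) * (real n + 1) =
      (((- 3 / 2 :: real) gchoose Suc n) * (real n + 1)) * (- 4) ^ n * (- 4)" by simp
  also have "\<dots> = (((- 3 / 2) gchoose n) * (- 4) ^ n) * (- 3 / 2 - real n) * (- 4)"
    unfolding g by simp
  also have "\<dots> = (2 * real n + 1) * c * (6 + 4 * real n)" unfolding Suc c_def by (simp add: algebra_simps)
  also have "\<dots> = (2 * real n + 3) * ((real n + 1) * d)" unfolding d by (simp add: algebra_simps)
  finally have "(((- 3 / 2) gchoose Suc n) * (- 4) ^ Suc n) * (real n + 1) = ((2 * real n + 3) * d) * (real n + 1)"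
    by (simp add: mult_ac)
  moreover have "real n + 1 \<noteq> 0" by linarith
  ultimately have "((- 3 / 2) gchoose Suc n) * (- 4) ^ Suc n = (2 * real n + 3) * d"
    using mult_right_cancel[of "real n + 1"] by blast
  then show ?case unfolding d_def by (simp add: algebra_simps del: binomial_Suc_Suc)
qed simp

text \<open>By \<open>crossing_core_eq\<close>, twice the series is (1 - 4t)^(-3/2) - 1 / (1 - 4t);
  the statement is this with denominators cleared.\<close>

lemma crossing_core_fps:
  "2 * Abs_fps crossing_core * (1 - 4 * fps_X) * one_minus_4t_three_halves =
     (1 - 4 * fps_X) - one_minus_4t_three_halves"
proof -
  define F G where "F = Abs_fps (\<lambda>n. (2 * real n + 1) * of_nat ((2 * n) choose n))"
    and "G = Abs_fps (\<lambda>n. 4 ^ n :: real)"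
  have core: "2 * Abs_fps crossing_core = F - G"
    by (rule fps_ext) (simp add: crossing_core_eq F_def G_def numeral_fps_const field_simps)
  have G: "(1 - 4 * fps_X) * G = 1"
  proof (rule fps_ext)
    fix n
    have "(1 - 4 * fps_X) * G = G - fps_const 4 * (fps_X * G)"
      by (simp add: algebra_simps numeral_fps_const)
    then show "fps_nth ((1 - 4 * fps_X) * G) n = fps_nth 1 n"
      by (cases n) (simp_all add: G_def)
  qed
  have X0: "fps_nth (- 4 * fps_X :: real fps) 0 = 0" by simp
  have "- 4 * fps_X = fps_const (- 4) * (fps_X :: real fps)" by (simp add: numeral_fps_const)
  then have nth: "fps_nth (fps_binomial (- 3 / 2 :: real) oo (- 4 * fps_X)) n = ((- 3 / 2) gchoose n) * (- 4) ^ n" for n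
    by (simp add: fps_compose_linear)
  have "fps_binomial (- 3 / 2) oo (- 4 * fps_X) = F"
    by (intro fps_ext) (simp only: nth central_gbinomial F_def fps_nth_Abs_fps)
  moreover have "fps_binomial (3 / 2) * fps_binomial (- 3 / 2 :: real) = 1"
    using fps_binomial_add_mult[of "3 / 2 :: real" "- 3 / 2"] by (simp add: fps_binomial_0)
  ultimately have F: "one_minus_4t_three_halves * F = 1"
    using fps_compose_mult_distrib[OF X0, of "fps_binomial (3 / 2)" "fps_binomial (- 3 / 2)"]
    unfolding one_minus_4t_three_halves_def by simp
  have "2 * Abs_fps crossing_core * (1 - 4 * fps_X) * one_minus_4t_three_halves =
     (1 - 4 * fps_X) * (one_minus_4t_three_halves * F) - ((1 - 4 * fps_X) * G) * one_minus_4t_three_halves"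
    unfolding core by (simp add: algebra_simps)
  then show ?thesis unfolding F G by simp
qed

lemma sqrt_fps:
  obtains s :: "real fps" where "s ^ 2 = 1 - 4 * fps_X" "fps_nth s 0 = 1" "one_minus_4t_three_halves = s ^ 3"
proof
  let ?s = "fps_binomial (1 / 2) oo (- 4 * fps_X) :: real fps"
  have X0: "fps_nth (- 4 * fps_X :: real fps) 0 = 0" by simp
  have pow: "?s ^ k = fps_binomial (of_nat k / 2) oo (- 4 * fps_X)" for k
  proof (induction k)
    case (Suc k)
    have "?s ^ Suc k = (fps_binomial (1 / 2) * fps_binomial (of_nat k / 2)) oo (- 4 * fps_X)"
      using Suc fps_compose_mult_distrib[OF X0] by simp
    also have "fps_binomial (1 / 2) * fps_binomial (of_nat k / 2) = fps_binomial (of_nat (Suc k) / 2 :: real)"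
      by (simp add: add_divide_distrib flip: fps_binomial_add_mult)
    finally show ?case .
  qed (simp add: fps_binomial_0)
  show "?s ^ 2 = 1 - 4 * fps_X"
    unfolding pow by (simp add: fps_binomial_1 fps_compose_add_distrib)
  show "one_minus_4t_three_halves = ?s ^ 3"
    unfolding pow one_minus_4t_three_halves_def by simp
  show "fps_nth ?s 0 = 1" by (simp add: fps_compose_def)
qed

text \<open>Pure algebra over an integral domain. In the irrational part all triples contribute
  \<open>4 * (1 - 2 * X)\<close> and the crossing ones 1, which add up to \<open>5 - 8 * X\<close>.
  In the rational part the factor \<open>1 - 2 * X\<close> cancels.\<close>

lemma combine_identities:
  fixes X V1 T q qV K C :: "'a :: idom"
  assumes "(1 - 4 * X) ^ 2 * (1 - 2 * X) * T = (1 - 4 * X) * (1 - 2 * X) * X ^ 2 * (1 - 2 * X - 2 * V1) + X ^ 4 * (1 - 3 * X + 4 * X ^ 2)"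
    and "q * V1 = (1 - 4 * X) * X ^ 2"
    and "(1 - 2 * X) * K = X ^ 4 * C"
    and "2 * C * (1 - 4 * X) * q = (1 - 4 * X) - q"
  shows "(T - K) * ((2 * (1 - 4 * X) ^ 2) * (2 * (1 - 2 * X) * q)) =
     X ^ 2 * (2 - 12 * X + 19 * X ^ 2 - 4 * X ^ 3) * (2 * (1 - 2 * X) * q) - X ^ 4 * (5 - 8 * X) * (2 * (1 - 4 * X) ^ 2)"
proof -
  have "(T - K) * ((2 * (1 - 4 * X) ^ 2) * (2 * (1 - 2 * X) * q)) =
     4 * q * ((1 - 4 * X) ^ 2 * (1 - 2 * X) * T) - 4 * (1 - 4 * X) ^ 2 * q * ((1 - 2 * X) * K)"
    by (simp add: algebra_simps)
  also have "\<dots> = 4 * ((1 - 4 * X) * (1 - 2 * X) * X ^ 2 * ((1 - 2 * X) * q - 2 * (q * V1)) + q * (X ^ 4 * (1 - 3 * X + 4 * X ^ 2)))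
      - 2 * (1 - 4 * X) * X ^ 4 * (2 * C * (1 - 4 * X) * q)"
    unfolding assms(1,3) by algebra
  also have "\<dots> = X ^ 2 * (2 - 12 * X + 19 * X ^ 2 - 4 * X ^ 3) * (2 * (1 - 2 * X) * q) - X ^ 4 * (5 - 8 * X) * (2 * (1 - 4 * X) ^ 2)"
    unfolding assms(2,4) by algebra
  finally show ?thesis .
qed

lemma gf_identity:
  "triples_fps 1 - crossing_fps =
     (let t = fps_X :: real fps in
        t^2 * (2 - 12 * t + 19 * t^2 - 4 * t^3) / (2 * (1 - 4 * t)^2)
        - t^4 * (5 - 8 * t) / (2 * (1 - 2 * t) * one_minus_4t_three_halves))"
proof -
  let ?X = "fps_X :: real fps" and ?q = one_minus_4t_three_halves
  obtain s :: "real fps" where s: "s ^ 2 = 1 - 4 * fps_X" "fps_nth s 0 = 1" "?q = s ^ 3"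
    by (rule sqrt_fps)
  have "?q * grow_tail_fps 1 = s ^ 2 * (s * grow_tail_fps 1)" unfolding s(3) by (simp add: power3_eq_cube power2_eq_square mult_ac)
  then have qV: "?q * grow_tail_fps 1 = (1 - 4 * ?X) * ?X ^ 2" unfolding grow_tail_fps_1[OF s(1,2)] s(1) .
  define D1 D2 N1 N2 where "D1 = 2 * (1 - 4 * ?X) ^ 2" and "D2 = 2 * (1 - 2 * ?X) * ?q"
    and "N1 = ?X ^ 2 * (2 - 12 * ?X + 19 * ?X ^ 2 - 4 * ?X ^ 3)" and "N2 = ?X ^ 4 * (5 - 8 * ?X)"
  have D0: "fps_nth D1 0 \<noteq> 0" "fps_nth D2 0 \<noteq> 0"
    by (simp_all add: D1_def D2_def s(2,3) power2_eq_square power3_eq_cube)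
  then have nz: "D1 \<noteq> 0" "D2 \<noteq> 0" by auto
  have dm: "f / g * g = f" if "fps_nth g 0 \<noteq> 0" for f g :: "real fps"
    using that by (simp add: fps_divide_unit mult.assoc inverse_mult_eq_1)
  have "(N1 / D1 - N2 / D2) * (D1 * D2) = N1 / D1 * D1 * D2 - N2 / D2 * D2 * D1"
    by (simp add: algebra_simps)
  also have "\<dots> = N1 * D2 - N2 * D1" unfolding dm[OF D0(1)] dm[OF D0(2)] ..
  also have "\<dots> = (triples_fps 1 - crossing_fps) * (D1 * D2)"
    using combine_identities[OF triples_fps_1 qV crossing_fps crossing_core_fps] by (simp add: D1_def D2_def N1_def N2_def)
  finally have "triples_fps 1 - crossing_fps = N1 / D1 - N2 / D2" using nz by simp
  then show ?thesis by (simp add: Let_def D1_def D2_def N1_def N2_def)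
qed

section \<open>Paths with at most one turn\<close>

lemma
  assumes "convex_polyomino P"
  shows convex_row: "(x1, y) \<in> P \<Longrightarrow> (x2, y) \<in> P \<Longrightarrow> x1 \<le> x \<Longrightarrow> x \<le> x2 \<Longrightarrow> (x, y) \<in> P"
    and convex_col: "(x, y1) \<in> P \<Longrightarrow> (x, y2) \<in> P \<Longrightarrow> y1 \<le> y \<Longrightarrow> y \<le> y2 \<Longrightarrow> (x, y) \<in> P"
  using assms unfolding convex_polyomino_def by blast+

lemma edge_connected_cut:
  assumes "edge_connected P" "a \<in> P" "b \<in> P" "a \<in> S" "b \<notin> S"
  shows "\<exists>c\<in>P. \<exists>d\<in>P. c \<in> S \<and> d \<notin> S \<and> edge_adjacent c d"
proof -
  let ?R = "{(u, v). u \<in> P \<and> v \<in> P \<and> edge_adjacent u v}"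
  have "(a, b) \<in> ?R\<^sup>*" using assms by (auto simp: edge_connected_def)
  then have "a \<in> S \<longrightarrow> b \<in> S \<or> (\<exists>c d. c \<in> P \<and> d \<in> P \<and> c \<in> S \<and> d \<notin> S \<and> edge_adjacent c d)"
    by (induction rule: rtrancl_induct) blast+
  then show ?thesis using assms by blast
qed

lemma adjacent_columns_meet:
  assumes "convex_polyomino P" "(i, a) \<in> P" "(j, b) \<in> P" "i \<le> x" "x < j"
  obtains y where "(x, y) \<in> P" "(x + 1, y) \<in> P"
proof -
  have "edge_connected P" using assms(1) by (simp add: convex_polyomino_def polyomino_def)
  from edge_connected_cut[OF this assms(2,3), of "{c. fst c \<le> x}"]
  have "\<exists>c\<in>P. \<exists>d\<in>P. fst c \<le> x \<and> x < fst d \<and> edge_adjacent c d"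
    using assms(4,5) by (simp add: not_le)
  then obtain c d where cd: "c \<in> P" "d \<in> P" "fst c \<le> x" "x < fst d" "edge_adjacent c d"
    by blast
  have "\<bar>fst c - fst d\<bar> + \<bar>snd c - snd d\<bar> = 1"
    using cd(5) by (simp add: edge_adjacent_def)
  then have "fst c = x" "fst d = x + 1" "snd c = snd d" using cd(3,4) by arith+
  then have "(x, snd c) = c" "(x + 1, snd c) = d" by (metis prod.collapse)+
  then show ?thesis using that[of "snd c"] cd(1,2) by simp
qed

text \<open>A discrete intermediate value theorem: neighbouring columns are intervals that share a
  row, so no height can be skipped on the way from one column to another.\<close>

lemma column_between:
  assumes P: "convex_polyomino P" and "(i, y1) \<in> P" "(m, y2) \<in> P" "i \<le> m"
    and "y1 \<le> y \<and> y \<le> y2 \<or> y2 \<le> y \<and> y \<le> y1"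
  obtains x where "i \<le> x" "x \<le> m" "(x, y) \<in> P"
proof -
  have "\<exists>x. i \<le> x \<and> x \<le> m \<and> (x, y) \<in> P"
    using assms(4,3,5)
  proof (induction m arbitrary: y2 rule: int_ge_induct)
    case base
    then show ?case using assms(2) convex_col[OF P, of i] by blast
  next
    case (step m)
    obtain z where z: "(m, z) \<in> P" "(m + 1, z) \<in> P"
      using adjacent_columns_meet[OF P assms(2) step.prems(1), of m] step.hyps by auto
    show ?case
    proof (cases "z \<le> y \<and> y \<le> y2 \<or> y2 \<le> y \<and> y \<le> z")
      case True
      then have "(m + 1, y) \<in> P" using convex_col[OF P] z(2) step.prems(1) by blast
      then show ?thesis using step.hyps by (intro exI[of _ "m + 1"]) auto
    next
      case False
      then have "y1 \<le> y \<and> y \<le> z \<or> z \<le> y \<and> y \<le> y1" using step.prems(2) by auto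
      then obtain x where "i \<le> x" "x \<le> m" "(x, y) \<in> P" using step.IH[OF z(1)] by blast
      then show ?thesis by (intro exI[of _ x]) auto
    qed
  qed
  then show ?thesis using that by blast
qed

lemma nw_reach_refl: "a \<in> P \<Longrightarrow> nw_reach P a a"
  unfolding nw_reach_def nw_path_def by (rule exI[of _ "[a]"]) simp

lemma nw_reach_step:
  assumes "nw_step a b" "a \<in> P" "nw_reach P b c"
  shows "nw_reach P a c"
proof -
  obtain p where "nw_path P b p c" using assms(3) by (auto simp: nw_reach_def)
  then have "nw_path P a (a # p) c"
    using assms(1,2) by (cases p) (auto simp: nw_path_def)
  then show ?thesis by (auto simp: nw_reach_def)
qed

lemma nw_reach_north:
  assumes "y \<le> z" "\<And>y'. y \<le> y' \<Longrightarrow> y' \<le> z \<Longrightarrow> (x, y') \<in> P" "nw_reach P (x, z) c"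
  shows "nw_reach P (x, y) c"
  using assms
proof (induction y rule: int_le_induct)
  case (step y)
  show ?case
  proof (rule nw_reach_step)
    show "nw_step (x, y - 1) (x, y)" by (simp add: nw_step_def)
    show "(x, y - 1) \<in> P" using step by simp
    show "nw_reach P (x, y) c" using step by simp
  qed
qed simp

text \<open>In a convex polyomino nothing obstructs a north-west connection: between neighbouring
  columns there is always a common row between the heights \<open>y\<close> and \<open>y'\<close>,
  where the step west can be made.\<close>

lemma nw_reach_convex:
  assumes P: "convex_polyomino P" and "(i, y') \<in> P" "i \<le> j" "(j, y) \<in> P" "y \<le> y'"
  shows "nw_reach P (j, y) (i, y')"
  using assms(3-5)
proof (induction j arbitrary: y rule: int_ge_induct)
  case base
  show ?case
    by (rule nw_reach_north[OF base(2)]) (use base assms(2) convex_col[OF P] nw_reach_refl in blast)+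
next
  case (step j)
  have "\<exists>z. (j, z) \<in> P \<and> (j + 1, z) \<in> P \<and> y \<le> z \<and> z \<le> y'"
  proof -
    obtain z where z: "(j, z) \<in> P" "(j + 1, z) \<in> P"
      using adjacent_columns_meet[OF P assms(2) step.prems(1), of j] step.hyps by auto
    consider "y \<le> z \<and> z \<le> y'" | "y' < z" | "z < y" by linarith
    then show ?thesis
    proof cases
      case 1
      then show ?thesis using z by blast
    next
      case 2
      then have "(j + 1, y') \<in> P" using convex_col[OF P step.prems(1) z(2)] step.prems(2) by simp
      moreover from this have "(j, y') \<in> P" using convex_row[OF P assms(2)] step.hyps by simp
      ultimately show ?thesis using step.prems(2) by blast
    next
      case 3
      obtain x where "i \<le> x" "x \<le> j" "(x, y) \<in> P"
        by (rule column_between[OF P assms(2) z(1), of y]) (use step 3 in auto)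
      then have "(j, y) \<in> P" using convex_row[OF P _ step.prems(1)] by simp
      then show ?thesis using step.prems by blast
    qed
  qed
  then obtain z where z: "(j, z) \<in> P" "(j + 1, z) \<in> P" "y \<le> z" "z \<le> y'" by blast
  have "nw_reach P (j + 1, z) (i, y')"
    by (rule nw_reach_step[OF _ z(2) step.IH[OF z(1,4)]]) (simp add: nw_step_def)
  then show ?case
    by (rule nw_reach_north[OF z(3), rotated]) (use convex_col[OF P step.prems(1) z(2)] in blast)
qed

lemma direction_changes_Cons:
  "direction_changes (a # b # c # p) = (if b - a = c - b then 0 else 1) + direction_changes (b # c # p)"
proof -
  let ?S = "\<lambda>p. {i. i + 2 < length p \<and> p ! (i + 1) - p ! i \<noteq> p ! (i + 2) - p ! (i + 1)}"
  have "?S (a # b # c # p) = (if b - a = c - b then {} else {0}) \<union> Suc ` ?S (b # c # p)"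
  proof (intro equalityI subsetI)
    fix i assume i: "i \<in> ?S (a # b # c # p)"
    then show "i \<in> (if b - a = c - b then {} else {0}) \<union> Suc ` ?S (b # c # p)"
      by (cases i) auto
  qed (auto split: if_splits)
  moreover have "finite (?S (b # c # p))" by (rule finite_subset[of _ "{..length (b # c # p)}"]) auto
  ultimately show ?thesis
    unfolding direction_changes_def by (simp add: card_Un_disjoint card_image)
qed

lemma straight_path:
  assumes "successively nw_step (a # b # p)" "direction_changes (a # b # p) = 0"
  shows "(b - a = (0, 1) \<longrightarrow> fst (last (b # p)) = fst a) \<and> (b - a = (-1, 0) \<longrightarrow> snd (last (b # p)) = snd a)"
  using assms
proof (induction p arbitrary: a b)
  case Nil
  then show ?case by (cases a; cases b) auto
next
  case (Cons c p)
  then have *: "b - a = c - b" and "direction_changes (b # c # p) = 0"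
    by (simp_all add: direction_changes_Cons split: if_splits)
  then have IH: "(c - b = (0, 1) \<longrightarrow> fst (last (c # p)) = fst b) \<and> (c - b = (-1, 0) \<longrightarrow> snd (last (c # p)) = snd b)"
    using Cons by simp
  show ?case using IH * by (cases a; cases b) auto
qed

text \<open>With at most one turn the path follows two sides of the rectangle spanned by its ends
  and so visits one of the two other corners; the first step decides which.\<close>

lemma corner_of_path:
  assumes "successively nw_step (a # b # p)" "direction_changes (a # b # p) \<le> 1"
  shows "(b - a = (0, 1) \<longrightarrow> (fst a, snd (last (b # p))) \<in> set (a # b # p)) \<and>
    (b - a = (-1, 0) \<longrightarrow> (fst (last (b # p)), snd a) \<in> set (a # b # p))"
  using assms
proof (induction p arbitrary: a b)
  case Nil
  then show ?case by (cases a; cases b) auto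
next
  case (Cons c p)
  have st: "successively nw_step (b # c # p)" using Cons.prems by simp
  show ?case
  proof (cases "b - a = c - b")
    case True
    then have "direction_changes (b # c # p) \<le> 1" using Cons.prems by (simp add: direction_changes_Cons)
    from Cons.IH[OF st this] show ?thesis using True by (cases a; cases b) (auto simp: zero_prod_def)
  next
    case False
    then have "direction_changes (b # c # p) = 0" using Cons.prems by (simp add: direction_changes_Cons)
    from straight_path[OF st this] Cons.prems False show ?thesis
      by (cases a; cases b) (auto simp: nw_step_def)
  qed
qed

lemma D_NW_cells_le_1:
  assumes "nw_reach P a b"
  shows "D_NW_cells P a b \<le> 1 \<longleftrightarrow> (\<exists>p. nw_path P a p b \<and> direction_changes p \<le> 1)"
proof
  let ?S = "{direction_changes p | p. nw_path P a p b}"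
  have "?S \<noteq> {}" using assms by (auto simp: nw_reach_def)
  then have "Inf ?S \<in> ?S" by (rule Inf_nat_def1)
  then obtain p where p: "nw_path P a p b" "D_NW_cells P a b = direction_changes p"
    unfolding D_NW_cells_def by blast
  assume "D_NW_cells P a b \<le> 1"
  then show "\<exists>p. nw_path P a p b \<and> direction_changes p \<le> 1" using p by auto
next
  assume "\<exists>p. nw_path P a p b \<and> direction_changes p \<le> 1"
  then obtain p where p: "nw_path P a p b" "direction_changes p \<le> 1" by blast
  then have "D_NW_cells P a b \<le> direction_changes p"
    unfolding D_NW_cells_def by (intro cInf_lower) auto
  then show "D_NW_cells P a b \<le> 1" using p by simp
qed

lemma nw_path_in: "nw_path P a p b \<Longrightarrow> a \<in> P \<and> b \<in> P"
  by (auto simp: nw_path_def)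

lemma D_NW_le_1:
  assumes "finite P" "P \<noteq> {}"
  shows "D_NW P \<le> 1 \<longleftrightarrow> (\<forall>a b. nw_reach P a b \<longrightarrow> (\<exists>p. nw_path P a p b \<and> direction_changes p \<le> 1))"
proof -
  let ?S = "{D_NW_cells P a b | a b. nw_reach P a b}"
  have "?S \<subseteq> (\<lambda>(a, b). D_NW_cells P a b) ` (P \<times> P)"
    using nw_path_in by (fastforce simp: nw_reach_def)
  then have "finite ?S" using assms(1) by (meson finite_SigmaI finite_imageI finite_subset)
  moreover have "?S \<noteq> {}" using assms(2) nw_reach_refl by blast
  ultimately have "Max ?S \<le> 1 \<longleftrightarrow> (\<forall>x\<in>?S. x \<le> 1)" by (rule Max_le_iff)
  then have "D_NW P \<le> 1 \<longleftrightarrow> (\<forall>a b. nw_reach P a b \<longrightarrow> D_NW_cells P a b \<le> 1)"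
    unfolding D_NW_def by blast
  then show ?thesis using D_NW_cells_le_1 by blast
qed

lemma nw_path_mono:
  assumes "nw_path P a p b"
  shows "fst b \<le> fst a" "snd a \<le> snd b"
proof -
  have "p \<noteq> [] \<Longrightarrow> successively nw_step p \<Longrightarrow> fst (last p) \<le> fst (hd p) \<and> snd (hd p) \<le> snd (last p)"
  proof (induction p rule: induct_list012)
    case (3 c d p)
    then show ?case by (cases c; cases d) (fastforce simp: nw_step_def)
  qed auto
  then show "fst b \<le> fst a" "snd a \<le> snd b" using assms by (auto simp: nw_path_def)
qed

lemma corner_in:
  assumes "nw_path P a p b" "direction_changes p \<le> 1"
  shows "(fst a, snd b) \<in> P \<or> (fst b, snd a) \<in> P"
proof (cases p)
  case (Cons c q)
  show ?thesis
  proof (cases q)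
    case Nil
    then show ?thesis using assms Cons by (auto simp: nw_path_def)
  next
    case q: (Cons d r)
    have p: "p = a # d # r" "b = last (d # r)" "successively nw_step (a # d # r)" "set (a # d # r) \<subseteq> P"
      using assms Cons q by (auto simp: nw_path_def)
    have "nw_step a d" using p by simp
    then show ?thesis
      using corner_of_path[OF p(3)] assms(2) p unfolding nw_step_def by (metis subsetD)
  qed
qed (use assms in \<open>simp add: nw_path_def\<close>)

text \<open>The path is parametrised by time, and \<open>d\<close> is the only moment at which it
  may turn.\<close>

lemma path_of_function:
  assumes f: "\<And>k. k \<le> N \<Longrightarrow> f k \<in> P" and st: "\<And>k. k < N \<Longrightarrow> nw_step (f k) (f (Suc k))"
    and dir: "\<And>k. Suc k < N \<Longrightarrow> Suc k \<noteq> d \<Longrightarrow> f (Suc k) - f k = f (Suc (Suc k)) - f (Suc k)"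
  shows "nw_path P (f 0) (map f [0..<Suc N]) (f N) \<and> direction_changes (map f [0..<Suc N]) \<le> 1"
proof
  let ?p = "map f [0..<Suc N]"
  have nth: "?p ! k = f k" if "k \<le> N" for k using that by (simp del: upt_Suc)
  have "successively nw_step ?p"
    unfolding successively_conv_nth using st nth by (simp del: upt_Suc)
  then show "nw_path P (f 0) ?p (f N)"
    unfolding nw_path_def using f by (auto simp: hd_map last_map simp del: upt_Suc)
  have "{i. i + 2 < length ?p \<and> ?p ! (i + 1) - ?p ! i \<noteq> ?p ! (i + 2) - ?p ! (i + 1)} \<subseteq> {d - 1}"
  proof
    fix i assume "i \<in> {i. i + 2 < length ?p \<and> ?p ! (i + 1) - ?p ! i \<noteq> ?p ! (i + 2) - ?p ! (i + 1)}"
    then have "Suc i < N" "f (Suc i) - f i \<noteq> f (Suc (Suc i)) - f (Suc i)"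
      using nth[of i] nth[of "i + 1"] nth[of "i + 2"] by auto
    then have "Suc i = d" using dir[of i] by blast
    then show "i \<in> {d - 1}" by simp
  qed
  then have "direction_changes ?p \<le> card {d - 1}"
    unfolding direction_changes_def by (intro card_mono) auto
  then show "direction_changes ?p \<le> 1" by simp
qed

lemma west_north_path:
  assumes P: "convex_polyomino P" and "(j, y1) \<in> P" "(i, y2) \<in> P" "(i, y1) \<in> P" "i \<le> j" "y1 \<le> y2"
  shows "\<exists>p. nw_path P (j, y1) p (i, y2) \<and> direction_changes p \<le> 1"
proof -
  define d e where "d = nat (j - i)" and "e = nat (y2 - y1)"
  define f where "f k = (if k \<le> d then (j - int k, y1) else (i, y1 + int (k - d)))" for k
  have "nw_path P (f 0) (map f [0..<Suc (d + e)]) (f (d + e)) \<and> direction_changes (map f [0..<Suc (d + e)]) \<le> 1"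
  proof (rule path_of_function[where d = d])
    fix k assume "k \<le> d + e"
    then show "f k \<in> P"
      using convex_row[OF P assms(4,2), of "j - int k"] convex_col[OF P assms(4,3), of "y1 + int (k - d)"] assms(5,6)
      by (auto simp: f_def d_def e_def)
  qed (use assms(5) in \<open>auto simp: f_def d_def nw_step_def Suc_diff_le\<close>)
  moreover have "f 0 = (j, y1)" "f (d + e) = (i, y2)" using assms(5,6) by (auto simp: f_def d_def e_def)
  ultimately show ?thesis by metis
qed

lemma north_west_path:
  assumes P: "convex_polyomino P" and "(j, y1) \<in> P" "(i, y2) \<in> P" "(j, y2) \<in> P" "i \<le> j" "y1 \<le> y2"
  shows "\<exists>p. nw_path P (j, y1) p (i, y2) \<and> direction_changes p \<le> 1"
proof -
  define d e where "d = nat (y2 - y1)" and "e = nat (j - i)"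
  define f where "f k = (if k \<le> d then (j, y1 + int k) else (j - int (k - d), y2))" for k
  have "nw_path P (f 0) (map f [0..<Suc (d + e)]) (f (d + e)) \<and> direction_changes (map f [0..<Suc (d + e)]) \<le> 1"
  proof (rule path_of_function[where d = d])
    fix k assume "k \<le> d + e"
    then show "f k \<in> P"
      using convex_col[OF P assms(2,4), of "y1 + int k"] convex_row[OF P assms(3,4), of "j - int (k - d)"] assms(5,6)
      by (auto simp: f_def d_def e_def)
  qed (use assms(6) in \<open>auto simp: f_def d_def nw_step_def Suc_diff_le\<close>)
  moreover have "f 0 = (j, y1)" "f (d + e) = (i, y2)" using assms(5,6) by (auto simp: f_def d_def e_def)
  ultimately show ?thesis by metis
qed

text \<open>A pair of columns whose western member sticks out above and whose eastern member sticks
  out below the other one is exactly what a single change of direction cannot bridge.\<close>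

lemma ascending_iff:
  assumes P: "convex_polyomino P"
  shows "ascending P \<longleftrightarrow>
    (\<forall>i j y1 y2. (j, y1) \<in> P \<longrightarrow> (i, y2) \<in> P \<longrightarrow> i \<le> j \<longrightarrow> y1 \<le> y2 \<longrightarrow> (i, y1) \<in> P \<or> (j, y2) \<in> P)"
proof -
  have fin: "finite P" "P \<noteq> {}" using P by (simp_all add: convex_polyomino_def polyomino_def)
  show ?thesis
    unfolding ascending_def D_NW_le_1[OF fin]
  proof (intro iffI conjI allI impI)
    fix i j y1 y2
    assume asc: "convex_polyomino P \<and> (\<forall>a b. nw_reach P a b \<longrightarrow> (\<exists>p. nw_path P a p b \<and> direction_changes p \<le> 1))"
      and c: "(j, y1) \<in> P" "(i, y2) \<in> P" "i \<le> j" "y1 \<le> y2"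
    have "nw_reach P (j, y1) (i, y2)" using nw_reach_convex[OF P c(2,3,1,4)] .
    then obtain p where "nw_path P (j, y1) p (i, y2)" "direction_changes p \<le> 1" using asc by blast
    from corner_in[OF this] show "(i, y1) \<in> P \<or> (j, y2) \<in> P" by auto
  next
    fix a b
    assume *: "\<forall>i j y1 y2. (j, y1) \<in> P \<longrightarrow> (i, y2) \<in> P \<longrightarrow> i \<le> j \<longrightarrow> y1 \<le> y2 \<longrightarrow> (i, y1) \<in> P \<or> (j, y2) \<in> P"
      and "nw_reach P a b"
    then obtain p where p: "nw_path P a p b" by (auto simp: nw_reach_def)
    obtain j y1 i y2 where ab: "a = (j, y1)" "b = (i, y2)" by fastforce
    have c: "(j, y1) \<in> P" "(i, y2) \<in> P" "i \<le> j" "y1 \<le> y2"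
      using nw_path_in[OF p] nw_path_mono[OF p] ab by auto
    then have "(i, y1) \<in> P \<or> (j, y2) \<in> P" using * by blast
    then show "\<exists>p. nw_path P a p b \<and> direction_changes p \<le> 1"
      unfolding ab using west_north_path[OF P c(1,2) _ c(3,4)] north_west_path[OF P c(1,2) _ c(3,4)] by blast
  qed (use P in auto)
qed

section \<open>Polyominoes as column sequences\<close>

definition cells :: "col list \<Rightarrow> cell set" where
  "cells cs = {(x, y). 0 \<le> x \<and> x < int (length cs) \<and> fst (cs ! nat x) \<le> y \<and> y < snd (cs ! nat x)}"

definition overlap :: "col \<Rightarrow> col \<Rightarrow> bool" where
  "overlap c d \<longleftrightarrow> fst d < snd c \<and> fst c < snd d"

text \<open>A normal form for translation classes, with the lower left corner of the bounding
  rectangle at the origin and \<open>h\<close> as its height. Overlap stands for connectivity, the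
  condition on three columns for row convexity, and the last condition for the ascending property in
  the form of \<open>ascending_iff\<close>.\<close>

definition ascending_cols :: "col list \<Rightarrow> int \<Rightarrow> bool" where
  "ascending_cols cs h \<longleftrightarrow> cs \<noteq> [] \<and> (\<forall>c\<in>set cs. 0 \<le> fst c \<and> fst c < snd c \<and> snd c \<le> h) \<and>
     (\<exists>c\<in>set cs. fst c = 0) \<and> (\<exists>c\<in>set cs. snd c = h) \<and>
     (\<forall>i. Suc i < length cs \<longrightarrow> overlap (cs ! i) (cs ! Suc i)) \<and>
     (\<forall>i j k y. i < j \<longrightarrow> j < k \<longrightarrow> k < length cs \<longrightarrow> fst (cs ! i) \<le> y \<and> y < snd (cs ! i) \<longrightarrow>
        fst (cs ! k) \<le> y \<and> y < snd (cs ! k) \<longrightarrow> fst (cs ! j) \<le> y \<and> y < snd (cs ! j)) \<and>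
     (\<forall>i j. i < j \<longrightarrow> j < length cs \<longrightarrow> \<not> below (cs ! j) (cs ! i))"

lemma cells_iff:
  "(x, y) \<in> cells cs \<longleftrightarrow> (\<exists>i. x = int i \<and> i < length cs \<and> fst (cs ! i) \<le> y \<and> y < snd (cs ! i))"
proof
  assume "(x, y) \<in> cells cs"
  then show "\<exists>i. x = int i \<and> i < length cs \<and> fst (cs ! i) \<le> y \<and> y < snd (cs ! i)"
    by (intro exI[of _ "nat x"]) (simp add: cells_def nat_less_iff)
qed (auto simp: cells_def)

lemma cells_int_iff [simp]:
  "(int i, y) \<in> cells cs \<longleftrightarrow> i < length cs \<and> fst (cs ! i) \<le> y \<and> y < snd (cs ! i)"
  by (simp add: cells_iff)

lemma ascending_cols_nth:
  assumes "ascending_cols cs h" "i < length cs"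
  shows "0 \<le> fst (cs ! i)" "fst (cs ! i) < snd (cs ! i)" "snd (cs ! i) \<le> h"
  using assms nth_mem[OF assms(2)] unfolding ascending_cols_def by blast+

lemma cells_bounds:
  assumes "ascending_cols cs h" "(x, y) \<in> cells cs"
  shows "0 \<le> x" "x < int (length cs)" "0 \<le> y" "y < h"
proof -
  obtain i where "x = int i" "i < length cs" "fst (cs ! i) \<le> y" "y < snd (cs ! i)"
    using assms(2) by (auto simp: cells_iff)
  then show "0 \<le> x" "x < int (length cs)" "0 \<le> y" "y < h"
    using ascending_cols_nth[OF assms(1), of i] by auto
qed

lemma finite_cells: "ascending_cols cs h \<Longrightarrow> finite (cells cs)"
  by (rule finite_subset[of _ "{0..<int (length cs)} \<times> {0..<h}"]) (auto dest: cells_bounds)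

lemma fst_cells:
  assumes "ascending_cols cs h"
  shows "fst ` cells cs = {0..<int (length cs)}"
proof (intro equalityI subsetI)
  fix x assume "x \<in> fst ` cells cs"
  then show "x \<in> {0..<int (length cs)}" using cells_bounds[OF assms] by auto
next
  fix x assume x: "x \<in> {0..<int (length cs)}"
  then obtain i where i: "x = int i" "i < length cs"
    by (metis atLeastLessThan_iff nonneg_int_cases of_nat_less_iff)
  then have "(x, fst (cs ! i)) \<in> cells cs" using ascending_cols_nth[OF assms i(2)] by simp
  then show "x \<in> fst ` cells cs" by force
qed

lemma cells_nonempty: "ascending_cols cs h \<Longrightarrow> cells cs \<noteq> {}"
  using fst_cells[of cs h] by (auto simp: ascending_cols_def)

lemma Min_Max_cells:
  assumes "ascending_cols cs h"
  shows "Min (fst ` cells cs) = 0" "Max (fst ` cells cs) = int (length cs) - 1"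
    "Min (snd ` cells cs) = 0" "Max (snd ` cells cs) = h - 1"
proof -
  have fin: "finite (fst ` cells cs)" "finite (snd ` cells cs)" using finite_cells[OF assms] by auto
  have len: "length cs > 0" using assms by (simp add: ascending_cols_def)
  show "Min (fst ` cells cs) = 0" "Max (fst ` cells cs) = int (length cs) - 1"
    using fin len by (auto simp: fst_cells[OF assms] intro!: Min_eqI Max_eqI)
  have "\<exists>c\<in>set cs. fst c = 0" "\<exists>c\<in>set cs. snd c = h" using assms by (simp_all add: ascending_cols_def)
  then obtain i j where i: "i < length cs" "fst (cs ! i) = 0" and j: "j < length cs" "snd (cs ! j) = h"
    by (metis in_set_conv_nth)
  have "(int i, 0) \<in> cells cs" "(int j, h - 1) \<in> cells cs"
    using i j ascending_cols_nth[OF assms i(1)] ascending_cols_nth[OF assms j(1)] by auto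
  from this[THEN imageI, of snd] have "0 \<in> snd ` cells cs" "h - 1 \<in> snd ` cells cs" by simp_all
  then show "Min (snd ` cells cs) = 0" "Max (snd ` cells cs) = h - 1"
    using fin(2) cells_bounds(3,4)[OF assms] by (auto intro!: Min_eqI Max_eqI)
qed

lemma semi_perimeter_cells:
  assumes "ascending_cols cs h"
  shows "int (semi_perimeter (cells cs)) = int (length cs) + h"
proof -
  have "0 < length cs" using assms by (simp add: ascending_cols_def)
  then have "0 \<le> h" using ascending_cols_nth[OF assms] by fastforce
  then show ?thesis
    unfolding semi_perimeter_def width_def height_def Min_Max_cells[OF assms] by simp
qed

lemma edge_connected_cells:
  assumes "ascending_cols cs h"
  shows "edge_connected (cells cs)"
proof -
  define R where "R = {(u, v). u \<in> cells cs \<and> v \<in> cells cs \<and> edge_adjacent u v}"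
  have "sym R" by (auto simp: R_def sym_def edge_adjacent_def abs_minus_commute)
  then have symR: "sym (R\<^sup>*)" by (rule sym_rtrancl)
  have up: "((int i, y), (int i, z)) \<in> R\<^sup>*"
    if "i < length cs" "fst (cs ! i) \<le> y" "y \<le> z" "z < snd (cs ! i)" for i y z
    using that(3,4)
  proof (induction z rule: int_ge_induct)
    case (step z)
    have "((int i, z), (int i, z + 1)) \<in> R"
      using that(1,2) step by (auto simp: R_def edge_adjacent_def)
    then show ?case using step by (auto intro: rtrancl.rtrancl_into_rtrancl)
  qed simp
  have column: "((int i, y), (int i, z)) \<in> R\<^sup>*"
    if "(int i, y) \<in> cells cs" "(int i, z) \<in> cells cs" for i y z
    using up[of i y z] up[of i z y] that symD[OF symR] by (cases "y \<le> z") auto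
  have base: "((int 0, fst (cs ! 0)), (int i, fst (cs ! i))) \<in> R\<^sup>*" if "i < length cs" for i
    using that
  proof (induction i)
    case (Suc i)
    have "overlap (cs ! i) (cs ! Suc i)" using assms Suc.prems by (simp add: ascending_cols_def)
    then have "\<exists>y. (int i, y) \<in> cells cs \<and> (int (Suc i), y) \<in> cells cs"
      using ascending_cols_nth[OF assms, of i] ascending_cols_nth[OF assms, of "Suc i"] Suc.prems
      unfolding cells_int_iff overlap_def
      by (intro exI[of _ "max (fst (cs ! i)) (fst (cs ! Suc i))"]) auto
    then obtain y where y: "(int i, y) \<in> cells cs" "(int (Suc i), y) \<in> cells cs" by blast
    have c: "(int i, fst (cs ! i)) \<in> cells cs" "(int (Suc i), fst (cs ! Suc i)) \<in> cells cs"
      unfolding cells_int_iff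
      using ascending_cols_nth[OF assms, of i] ascending_cols_nth[OF assms, of "Suc i"] Suc.prems by auto
    have "((int i, y), (int (Suc i), y)) \<in> R" using y by (auto simp: R_def edge_adjacent_def)
    then show ?case
      using Suc.IH Suc.prems column[OF c(1) y(1)] column[OF y(2) c(2)]
      by (meson Suc_lessD r_into_rtrancl rtrancl_trans)
  qed simp
  have all: "((int 0, fst (cs ! 0)), a) \<in> R\<^sup>*" if "a \<in> cells cs" for a
  proof -
    obtain i y where a: "a = (int i, y)" and i: "i < length cs" using \<open>a \<in> cells cs\<close> by (cases a) (auto simp: cells_iff)
    then have "(int i, fst (cs ! i)) \<in> cells cs" using ascending_cols_nth[OF assms i] by simp
    then show ?thesis using base[OF i] column[of i "fst (cs ! i)" y] that a by (meson rtrancl_trans)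
  qed
  show ?thesis
    unfolding edge_connected_def R_def[symmetric]
    using all symD[OF symR] by (meson rtrancl_trans)
qed

lemma convex_cells:
  assumes "ascending_cols cs h"
  shows "convex_polyomino (cells cs)"
  unfolding convex_polyomino_def polyomino_def
proof (intro conjI allI impI)
  show "finite (cells cs)" "cells cs \<noteq> {}" "edge_connected (cells cs)"
    using assms finite_cells cells_nonempty edge_connected_cells by blast+
next
  fix y x1 x x2 assume c: "(x1, y) \<in> cells cs" "(x2, y) \<in> cells cs" "x1 \<le> x" "x \<le> x2"
  then obtain i k where ik: "x1 = int i" "x2 = int k" by (auto simp: cells_iff)
  then obtain j where j: "x = int j" using c by (metis nonneg_int_cases of_nat_0_le_iff order_trans)
  have "i \<le> j" "j \<le> k" using c ik j by auto
  show "(x, y) \<in> cells cs"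
  proof (cases "i < j \<and> j < k")
    case True
    then show ?thesis using assms c ik j unfolding ascending_cols_def cells_int_iff by fastforce
  next
    case False
    then have "j = i \<or> j = k" using \<open>i \<le> j\<close> \<open>j \<le> k\<close> by auto
    then show ?thesis using c ik j by auto
  qed
next
  fix x y1 y y2 assume "(x, y1) \<in> cells cs" "(x, y2) \<in> cells cs" "y1 \<le> y" "y \<le> y2"
  then show "(x, y) \<in> cells cs" by (auto simp: cells_iff)
qed

lemma ascending_cells:
  assumes "ascending_cols cs h"
  shows "ascending (cells cs)"
  unfolding ascending_iff[OF convex_cells[OF assms]]
proof (intro allI impI)
  fix x x' y1 y2 assume c: "(x', y1) \<in> cells cs" "(x, y2) \<in> cells cs" "x \<le> x'" "y1 \<le> y2"
  then obtain i j where ij: "x = int i" "x' = int j" by (auto simp: cells_iff)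
  show "(x, y1) \<in> cells cs \<or> (x', y2) \<in> cells cs"
  proof (cases "i = j")
    case False
    then have "\<not> below (cs ! j) (cs ! i)" using assms c ij by (simp add: ascending_cols_def)
    then show ?thesis using c ij by (auto simp: below_def)
  qed (use c ij in auto)
qed

lemma image_plus_pair: "(x, y) \<in> (+) v ` S \<longleftrightarrow> (x - fst v, y - snd v) \<in> (S :: cell set)"
proof
  assume "(x, y) \<in> (+) v ` S"
  then obtain s where "s \<in> S" "(x, y) = v + s" by auto
  then show "(x - fst v, y - snd v) \<in> S" by (cases v; cases s) auto
next
  assume "(x - fst v, y - snd v) \<in> S"
  then show "(x, y) \<in> (+) v ` S" by (rule rev_image_eqI) (simp add: prod_eq_iff)
qed

lemma ascending_polyomino_cols:
  assumes "ascending P"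
  obtains v cs h where "ascending_cols cs h" "P = (+) v ` cells cs"
proof -
  have P: "convex_polyomino P" using assms by (simp add: ascending_def)
  then have fin: "finite P" and ne: "P \<noteq> {}" by (simp_all add: convex_polyomino_def polyomino_def)
  define x0 x1 y0 y1 where "x0 = Min (fst ` P)" and "x1 = Max (fst ` P)"
    and "y0 = Min (snd ` P)" and "y1 = Max (snd ` P)"
  have bounds: "x0 \<le> x" "x \<le> x1" "y0 \<le> y" "y \<le> y1" if "(x, y) \<in> P" for x y
  proof -
    have "x \<in> fst ` P" "y \<in> snd ` P" using that by force+
    then show "x0 \<le> x" "x \<le> x1" "y0 \<le> y" "y \<le> y1"
      using fin by (simp_all add: x0_def x1_def y0_def y1_def)
  qed
  have "x0 \<in> fst ` P" "x1 \<in> fst ` P" "y0 \<in> snd ` P" "y1 \<in> snd ` P"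
    unfolding x0_def x1_def y0_def y1_def using fin ne by (auto intro!: Min_in Max_in)
  then obtain a0 a1 b0 b1 where ext: "(x0, a0) \<in> P" "(x1, a1) \<in> P" "(b0, y0) \<in> P" "(b1, y1) \<in> P"
    by force
  define C where "C x = {y. (x, y) \<in> P}" for x
  have finC: "finite (C x)" for x
    by (rule finite_subset[of _ "snd ` P"]) (use fin in \<open>force simp: C_def\<close>)+
  have meet: "\<exists>y. (x, y) \<in> P \<and> (x + 1, y) \<in> P" if "x0 \<le> x" "x < x1" for x
    using adjacent_columns_meet[OF P ext(1,2) that] by blast
  have neC: "C x \<noteq> {}" if "x0 \<le> x" "x \<le> x1" for x
    using meet[of x] ext(2) that by (cases "x = x1") (auto simp: C_def)
  define L U where "L x = Min (C x)" and "U x = Max (C x) + 1" for x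
  have LU: "(x, L x) \<in> P" "(x, U x - 1) \<in> P" if "x0 \<le> x" "x \<le> x1" for x
    using Min_in[OF finC neC[OF that]] Max_in[OF finC neC[OF that]] by (auto simp: L_def U_def C_def)
  have mem: "(x, y) \<in> P \<longleftrightarrow> x0 \<le> x \<and> x \<le> x1 \<and> L x \<le> y \<and> y < U x" for x y
  proof
    assume xy: "(x, y) \<in> P"
    then have "y \<in> C x" by (simp add: C_def)
    then have "L x \<le> y" "y \<le> Max (C x)" using finC by (auto simp: L_def)
    then show "x0 \<le> x \<and> x \<le> x1 \<and> L x \<le> y \<and> y < U x" using bounds[OF xy] by (simp add: U_def)
  next
    assume "x0 \<le> x \<and> x \<le> x1 \<and> L x \<le> y \<and> y < U x"
    then show "(x, y) \<in> P" using convex_col[OF P LU(1) LU(2)] by auto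
  qed
  define w where "w = nat (x1 - x0 + 1)"
  define cs where "cs = map (\<lambda>i. (L (x0 + int i) - y0, U (x0 + int i) - y0)) [0..<w]"
  have "x0 \<le> x1" using bounds[OF ext(1)] by simp
  have rng: "x0 \<le> x0 + int i" "x0 + int i \<le> x1" if "i < w" for i using that by (auto simp: w_def)
  have cell: "(int i, y) \<in> cells cs \<longleftrightarrow> (x0 + int i, y0 + y) \<in> P" for i y
    using \<open>x0 \<le> x1\<close> unfolding cells_int_iff mem by (auto simp: cs_def w_def)
  have len: "length cs = w" by (simp add: cs_def)
  have nth: "fst (cs ! i) = L (x0 + int i) - y0" "snd (cs ! i) = U (x0 + int i) - y0" if "i < w" for i
    using that by (simp_all add: cs_def)
  have "ascending_cols cs (y1 - y0 + 1)"
    unfolding ascending_cols_def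
  proof (intro conjI allI impI ballI)
    show "cs \<noteq> []" using \<open>x0 \<le> x1\<close> by (simp add: cs_def w_def)
  next
    fix c assume "c \<in> set cs"
    then obtain i where i: "i < w" "c = cs ! i" by (metis in_set_conv_nth len)
    have "(x0 + int i, L (x0 + int i)) \<in> P" "(x0 + int i, U (x0 + int i) - 1) \<in> P"
      using LU rng[OF i(1)] by auto
    then show "0 \<le> fst c" "fst c < snd c" "snd c \<le> y1 - y0 + 1"
      using bounds[of "x0 + int i"] mem[of "x0 + int i" "L (x0 + int i)"] nth[OF i(1)] i(2) by fastforce+
  next
    have b0: "x0 \<le> b0" "b0 \<le> x1" using bounds[OF ext(3)] by auto
    then obtain i where i: "b0 = x0 + int i" by (metis zle_iff_zadd)
    have iw: "i < w" using b0 i by (simp add: w_def)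
    have "L b0 = y0" using ext(3) mem[of b0 y0] bounds[OF LU(1)[OF b0]] by auto
    then show "\<exists>c\<in>set cs. fst c = 0" using nth[OF iw] i iw len by (metis diff_self nth_mem)
  next
    have b1: "x0 \<le> b1" "b1 \<le> x1" using bounds[OF ext(4)] by auto
    then obtain i where i: "b1 = x0 + int i" by (metis zle_iff_zadd)
    have iw: "i < w" using b1 i by (simp add: w_def)
    have "U b1 = y1 + 1" using ext(4) mem[of b1 y1] bounds[OF LU(2)[OF b1]] by auto
    then have "snd (cs ! i) = y1 - y0 + 1" using nth[OF iw] i by simp
    then show "\<exists>c\<in>set cs. snd c = y1 - y0 + 1" using iw len nth_mem by metis
  next
    fix i assume i: "Suc i < length cs"
    then have "x0 + int i < x1" by (simp add: len w_def zless_nat_eq_int_zless)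
    then obtain y where "(x0 + int i, y) \<in> P" "(x0 + int i + 1, y) \<in> P"
      using meet[of "x0 + int i"] by auto
    then have "(x0 + int i, y) \<in> P" "(x0 + int (Suc i), y) \<in> P" by (simp_all add: add_ac)
    then show "overlap (cs ! i) (cs ! Suc i)"
      using nth[of i] nth[of "Suc i"] i unfolding mem overlap_def by (simp add: len)
  next
    fix i j k :: nat and y
    assume "i < j" "j < k" "k < length cs" "fst (cs ! i) \<le> y \<and> y < snd (cs ! i)" "fst (cs ! k) \<le> y \<and> y < snd (cs ! k)"
    then have "(int i, y) \<in> cells cs" "(int k, y) \<in> cells cs" by simp_all
    then have "(x0 + int j, y0 + y) \<in> P"
      using convex_row[OF P, of "x0 + int i" "y0 + y" "x0 + int k" "x0 + int j"] \<open>i < j\<close> \<open>j < k\<close> unfolding cell by simp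
    then have "(int j, y) \<in> cells cs" unfolding cell .
    then show "fst (cs ! j) \<le> y" "y < snd (cs ! j)" by simp_all
  next
    fix i j :: nat assume ij: "i < j" "j < length cs"
    show "\<not> below (cs ! j) (cs ! i)"
    proof
      assume b: "below (cs ! j) (cs ! i)"
      have iw: "i < w" "j < w" using ij len by auto
      let ?i = "x0 + int i" and ?j = "x0 + int j"
      have b': "L ?j < L ?i" "U ?j < U ?i" using b nth[OF iw(1)] nth[OF iw(2)] by (auto simp: below_def)
      have Lj: "(?j, L ?j) \<in> P" and Ui: "(?i, U ?i - 1) \<in> P" and Li: "(?i, L ?i) \<in> P" using LU rng iw by blast+
      \<comment> \<open>The bottom cell of the eastern and the top cell of the western column are
        the test pair: each lies in a row that the other column misses.\<close>
      have "L ?j \<le> U ?i - 1" using b' Li mem[of ?i "L ?i"] by linarith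
      moreover have "?i \<le> ?j" using ij by simp
      ultimately have "(?i, L ?j) \<in> P \<or> (?j, U ?i - 1) \<in> P"
        using assms Lj Ui unfolding ascending_iff[OF P] by blast
      then show False using b' unfolding mem by auto
    qed
  qed
  moreover have "P = (+) (x0, y0) ` cells cs"
  proof (rule set_eqI)
    fix c show "c \<in> P \<longleftrightarrow> c \<in> (+) (x0, y0) ` cells cs"
    proof (cases c)
      case (Pair x y)
      show ?thesis
      proof (cases "x0 \<le> x")
        case True
        then obtain i where "x = x0 + int i" by (metis zle_iff_zadd)
        then show ?thesis using cell[of i "y - y0"] unfolding Pair image_plus_pair by simp
      next
        case False
        then have "(x, y) \<notin> P" "(x - x0, y - y0) \<notin> cells cs" using bounds(1) by (auto simp: cells_iff)
        then show ?thesis unfolding Pair image_plus_pair by simp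
      qed
    qed
  qed
  ultimately show ?thesis using that by blast
qed

lemma translate_Min_Max:
  assumes "finite P" "P \<noteq> {}"
  shows "Min (fst ` (+) v ` P) = fst v + Min (fst ` P)" "Max (fst ` (+) v ` P) = fst v + Max (fst ` P)"
    "Min (snd ` (+) v ` P) = snd v + Min (snd ` P)" "Max (snd ` (+) v ` P) = snd v + Max (snd ` (P :: cell set))"
proof -
  have "fst ` (+) v ` P = (+) (fst v) ` fst ` P" "snd ` (+) v ` P = (+) (snd v) ` snd ` P"
    by (simp_all add: image_image)
  moreover have "mono ((+) c)" for c :: int by (simp add: mono_def)
  ultimately show "Min (fst ` (+) v ` P) = fst v + Min (fst ` P)" "Max (fst ` (+) v ` P) = fst v + Max (fst ` P)"
    "Min (snd ` (+) v ` P) = snd v + Min (snd ` P)" "Max (snd ` (+) v ` P) = snd v + Max (snd ` P)"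
    using assms by (simp_all add: mono_Min_commute mono_Max_commute)
qed

lemma semi_perimeter_translate:
  "finite P \<Longrightarrow> P \<noteq> {} \<Longrightarrow> semi_perimeter ((+) v ` P) = semi_perimeter P"
  by (simp add: semi_perimeter_def width_def height_def translate_Min_Max)

text \<open>Both bounding rectangles have their lower left corner at the origin, which forces the
  translation to be 0; the columns can then be read off the cells.\<close>

lemma cells_inj:
  assumes cs: "ascending_cols cs h" and cs': "ascending_cols cs' h'" and eq: "cells cs' = (+) v ` cells cs"
  shows "cs = cs'"
proof -
  have "Min (fst ` cells cs') = fst v + Min (fst ` cells cs)" "Min (snd ` cells cs') = snd v + Min (snd ` cells cs)"
    unfolding eq using translate_Min_Max(1,3)[OF finite_cells[OF cs] cells_nonempty[OF cs], of v] by simp_all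
  then have "v = 0" using Min_Max_cells[OF cs] Min_Max_cells[OF cs'] by (simp add: prod_eq_iff)
  then have same: "cells cs' = cells cs" using eq by simp
  have "{0..<int (length cs)} = {0..<int (length cs')}" using fst_cells[OF cs] fst_cells[OF cs'] same by simp
  then have len: "length cs = length cs'"
    using Min_Max_cells(2)[OF cs] Min_Max_cells(2)[OF cs'] same by simp
  show ?thesis
  proof (rule nth_equalityI[OF len])
    fix i assume i: "i < length cs"
    have "fst (cs ! i) \<le> y \<and> y < snd (cs ! i) \<longleftrightarrow> fst (cs' ! i) \<le> y \<and> y < snd (cs' ! i)" for y
      using same i len cells_int_iff[of i y cs] cells_int_iff[of i y cs'] by simp
    from this[of "fst (cs ! i)"] this[of "fst (cs' ! i)"] this[of "snd (cs ! i) - 1"] this[of "snd (cs' ! i) - 1"]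
    show "cs ! i = cs' ! i"
      using ascending_cols_nth[OF cs i] ascending_cols_nth[OF cs', of i] i len by (auto simp: prod_eq_iff)
  qed
qed

lemma card_translation_classes:
  "card ({P. ascending P \<and> semi_perimeter P = n} // translation) =
     card {cs. \<exists>h. ascending_cols cs h \<and> int (length cs) + h = int n}"
proof -
  let ?Q = "{P. ascending P \<and> semi_perimeter P = n}" and ?A = "{cs. \<exists>h. ascending_cols cs h \<and> int (length cs) + h = int n}"
  have cls: "translation `` {P} = {(+) v ` P | v. True}" for P by (auto simp: translation_def)
  have trans: "translation `` {(+) v ` P} = translation `` {P}" for v :: cell and P
  proof -
    have "(+) w ` (+) v ` P = (+) (w + v) ` P" for w :: cell by (simp add: image_image add.assoc)
    moreover have "(+) w ` P = (+) (w - v) ` (+) v ` P" for w :: cell by (simp add: image_image)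
    ultimately show ?thesis unfolding cls by blast
  qed
  have "bij_betw (\<lambda>cs. translation `` {cells cs}) ?A (?Q // translation)"
    unfolding bij_betw_def
  proof
    show "inj_on (\<lambda>cs. translation `` {cells cs}) ?A"
    proof (rule inj_onI)
      fix cs cs' assume c: "cs \<in> ?A" "cs' \<in> ?A" and eq: "translation `` {cells cs} = translation `` {cells cs'}"
      have "cells cs' = (+) 0 ` cells cs'" by simp
      then have "cells cs' \<in> translation `` {cells cs'}" unfolding cls by blast
      then have "cells cs' \<in> translation `` {cells cs}" using eq by simp
      then obtain v where "cells cs' = (+) v ` cells cs" unfolding cls by blast
      then show "cs = cs'" using c cells_inj by blast
    qed
    show "(\<lambda>cs. translation `` {cells cs}) ` ?A = ?Q // translation"
    proof (intro equalityI subsetI)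
      fix X assume "X \<in> (\<lambda>cs. translation `` {cells cs}) ` ?A"
      then obtain cs h where c: "ascending_cols cs h" "int (length cs) + h = int n" "X = translation `` {cells cs}" by blast
      then have "cells cs \<in> ?Q" using ascending_cells semi_perimeter_cells by fastforce
      then show "X \<in> ?Q // translation" unfolding c(3) by (rule quotientI)
    next
      fix X assume "X \<in> ?Q // translation"
      then obtain P where P: "ascending P" "semi_perimeter P = n" "X = translation `` {P}" by (auto elim: quotientE)
      obtain v cs h where c: "ascending_cols cs h" "P = (+) v ` cells cs" using ascending_polyomino_cols[OF P(1)] .
      have "semi_perimeter (cells cs) = n"
        using P(2) semi_perimeter_translate[OF finite_cells[OF c(1)] cells_nonempty[OF c(1)]] by (simp add: c(2))
      then have "cs \<in> ?A" using semi_perimeter_cells[OF c(1)] c(1) by auto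
      moreover have "X = translation `` {cells cs}" unfolding P(3) c(2) by (rule trans)
      ultimately show "X \<in> (\<lambda>cs. translation `` {cells cs}) ` ?A" by blast
    qed
  qed
  then show ?thesis by (simp add: bij_betw_same_card)
qed

section \<open>Column sequences as triples\<close>

lemma valley_nth:
  fixes A B :: "int list"
  assumes "sorted A" "sorted B" "i < j" "j < k" "k < length (rev A @ B)"
  shows "(rev A @ B) ! j \<le> max ((rev A @ B) ! i) ((rev A @ B) ! k)"
proof (cases "j < length A")
  case True
  then have "(rev A @ B) ! j \<le> (rev A @ B) ! i"
    using assms by (simp add: nth_append rev_nth sorted_nth_mono)
  then show ?thesis by simp
next
  case False
  then have "(rev A @ B) ! j \<le> (rev A @ B) ! k"
    using assms by (simp add: nth_append sorted_nth_mono)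
  then show ?thesis by simp
qed

lemma peak_nth:
  fixes A B :: "int list"
  assumes "sorted A" "sorted B" "i < j" "j < k" "k < length (A @ rev B)"
  shows "min ((A @ rev B) ! i) ((A @ rev B) ! k) \<le> (A @ rev B) ! j"
proof (cases "j < length A")
  case True
  then have "(A @ rev B) ! i \<le> (A @ rev B) ! j"
    using assms by (simp add: nth_append sorted_nth_mono)
  then show ?thesis by simp
next
  case False
  then have "(A @ rev B) ! k \<le> (A @ rev B) ! j"
    using assms by (simp add: nth_append rev_nth sorted_nth_mono)
  then show ?thesis by simp
qed

lemma nested_overlap: "nested L U cs \<Longrightarrow> successively overlap cs"
proof (induction cs arbitrary: L U)
  case (Cons c cs)
  then show ?case by (cases cs) (auto simp: overlap_def)
qed simp

lemma overlap_sym: "overlap c d \<longleftrightarrow> overlap d c"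
  by (auto simp: overlap_def)

lemma para_overlap:
  assumes "para M"
  shows "successively overlap M"
  unfolding successively_conv_nth
proof (intro allI impI)
  fix i assume i: "Suc i < length M"
  have "slant (M ! i) (M ! Suc i)" using assms i by (simp add: para_def successively_conv_nth)
  moreover have "fst (M ! i) < snd (M ! i)" "fst (M ! Suc i) < snd (M ! Suc i)"
    using para_bounds(2)[OF assms nth_mem] i by simp_all
  ultimately show "overlap (M ! i) (M ! Suc i)" by (auto simp: slant_def overlap_def)
qed

lemma triples_edges:
  assumes "(G, M, H) \<in> triples n"
  shows "sorted (map fst G)" "sorted (map fst (M @ H))" "sorted (rev (map snd G) @ map snd M)" "sorted (rev (map snd H))"
proof -
  have M: "para M" and G: "nested 1 (snd (hd M)) G" and H: "nested (fst (last M)) (snd (last M) - 1) H"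
    using assms by (simp_all add: triples_def)
  have sM: "sorted (map fst M)" "sorted (map snd M)" using M by (simp_all add: para_def successively_slant)
  show "sorted (map fst G)" "sorted (rev (map snd H))" using G H by (simp_all add: nested_iff_sorted)
  have "fst c \<le> fst d" if "c \<in> set M" "d \<in> set H" for c d
    using para_bounds(4)[OF M that(1)] nested_bounds(1)[OF H that(2)] by simp
  then show "sorted (map fst (M @ H))" using sM(1) H by (auto simp: sorted_append nested_iff_sorted)
  have "snd c \<le> snd d" if "c \<in> set G" "d \<in> set M" for c d
    using para_bounds(5)[OF M that(2)] nested_bounds(3)[OF G that(1)] by simp
  then show "sorted (rev (map snd G) @ map snd M)" using sM(2) G by (auto simp: sorted_append nested_iff_sorted)
qed

text \<open>Lower edges fall along \<open>rev G\<close> and rise along \<open>M @ H\<close>, upper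
  edges rise along \<open>rev G @ M\<close> and fall along \<open>H\<close>. The valley and the peak
  give row convexity, and they confine a forbidden pair of columns to \<open>G\<close> and
  \<open>H\<close>.\<close>

lemma ascending_cols_triples:
  assumes t: "(G, M, H) \<in> triples n" and nc: "\<not> crossing G H"
  shows "ascending_cols (rev G @ M @ H) (snd (last M))"
proof -
  define cs where "cs = rev G @ M @ H"
  let ?h = "snd (last M)"
  have M: "para M" and G: "nested 1 (snd (hd M)) G" and H: "nested (fst (last M)) (?h - 1) H"
    using t by (simp_all add: triples_def)
  have ne: "M \<noteq> []" and hd0: "fst (hd M) = 0" using M by (simp_all add: para_def)
  have hdM: "hd M \<in> set M" and lastM: "last M \<in> set M" using ne by simp_all
  note edges = triples_edges[OF t]
  have lower: "map fst cs = rev (map fst G) @ map fst (M @ H)" by (simp add: cs_def rev_map)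
  have upper: "map snd cs = (rev (map snd G) @ map snd M) @ rev (rev (map snd H))" by (simp add: cs_def rev_map)
  have valley: "fst (cs ! j) \<le> max (fst (cs ! i)) (fst (cs ! k))" if "i < j" "j < k" "k < length cs" for i j k
    using valley_nth[OF edges(1,2) that(1,2)] that unfolding lower[symmetric] by simp
  have peak: "min (snd (cs ! i)) (snd (cs ! k)) \<le> snd (cs ! j)" if "i < j" "j < k" "k < length cs" for i j k
    using peak_nth[OF edges(3,4) that(1,2)] that unfolding upper[symmetric] by simp
  have hd_snd: "snd (hd M) \<le> ?h" using para_bounds(3)[OF M hdM] .
  have last_fst: "0 \<le> fst (last M)" using para_bounds(1)[OF M lastM] .
  have bounds: "0 \<le> fst c \<and> fst c < snd c \<and> snd c \<le> ?h" if c: "c \<in> set cs" for c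
  proof -
    consider "c \<in> set G" | "c \<in> set M" | "c \<in> set H" using c by (auto simp: cs_def)
    then show ?thesis
    proof cases
      case 1 then show ?thesis using nested_bounds[OF G, of c] hd_snd by simp
    next
      case 2 then show ?thesis using para_bounds(1-3)[OF M, of c] by simp
    next
      case 3 then show ?thesis using nested_bounds[OF H, of c] last_fst by simp
    qed
  qed
  have "overlap (hd G) (hd M)" if "G \<noteq> []"
    using nested_bounds[OF G, of "hd G"] para_bounds(2)[OF M hdM] hd0 that by (simp add: overlap_def)
  moreover have "overlap (last M) (hd H)" if "H \<noteq> []"
    using nested_bounds[OF H, of "hd H"] para_bounds(2)[OF M lastM] that by (simp add: overlap_def)
  moreover have "successively overlap (rev G)"
    using nested_overlap[OF G] by (simp add: overlap_sym successively_rev)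
  ultimately have ov: "successively overlap cs"
    using nested_overlap[OF H] para_overlap[OF M] ne
    by (auto simp: cs_def successively_append_iff last_rev overlap_sym)
  have no_below: "\<not> below (cs ! j) (cs ! i)" if ij: "i < j" "j < length cs" for i j
  proof
    assume b: "below (cs ! j) (cs ! i)"
    \<comment> \<open>From \<open>M\<close> on the lower edges do not fall, so the western column of
      a forbidden pair is in \<open>G\<close>; by the upper edges the eastern one is in
      \<open>H\<close>.\<close>
    have i: "i < length G"
    proof (rule ccontr)
      assume "\<not> i < length G"
      then have "map fst cs ! i \<le> map fst cs ! j"
        unfolding lower using sorted_nth_mono[OF edges(2), of "i - length G" "j - length G"] ij
        by (simp add: nth_append[of "rev (map fst G)"] cs_def del: map_append)
      then show False using b ij by (simp add: below_def)
    qed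
    have j: "length G + length M \<le> j"
    proof (rule ccontr)
      assume "\<not> length G + length M \<le> j"
      then have "map snd cs ! i \<le> map snd cs ! j"
        unfolding upper using sorted_nth_mono[OF edges(3), of i j] ij
        by (simp add: nth_append[of "rev (map snd G) @ map snd M"] del: append_assoc)
      then show False using b ij by (simp add: below_def)
    qed
    have "cs ! i \<in> set G" using i by (simp add: cs_def nth_append rev_nth)
    moreover have "cs ! j \<in> set H" using ij j by (auto simp: cs_def nth_append)
    ultimately show False using b nc by (auto simp: crossing_def)
  qed
  show ?thesis
    unfolding cs_def[symmetric] ascending_cols_def
  proof (intro conjI ballI)
    show "cs \<noteq> []" using ne by (simp add: cs_def)
    show "\<exists>c\<in>set cs. fst c = 0" using hdM hd0 by (auto simp: cs_def)
    show "\<exists>c\<in>set cs. snd c = ?h" using lastM by (auto simp: cs_def)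
    show "\<forall>i. Suc i < length cs \<longrightarrow> overlap (cs ! i) (cs ! Suc i)"
      using ov unfolding successively_conv_nth by blast
    show "\<forall>i j. i < j \<longrightarrow> j < length cs \<longrightarrow> \<not> below (cs ! j) (cs ! i)" using no_below by blast
    show "\<forall>i j k y. i < j \<longrightarrow> j < k \<longrightarrow> k < length cs \<longrightarrow> fst (cs ! i) \<le> y \<and> y < snd (cs ! i) \<longrightarrow>
        fst (cs ! k) \<le> y \<and> y < snd (cs ! k) \<longrightarrow> fst (cs ! j) \<le> y \<and> y < snd (cs ! j)"
    proof (intro allI impI)
      fix i j k y
      assume a: "i < j" "j < k" "k < length cs" "fst (cs ! i) \<le> y \<and> y < snd (cs ! i)" "fst (cs ! k) \<le> y \<and> y < snd (cs ! k)"
      show "fst (cs ! j) \<le> y \<and> y < snd (cs ! j)"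
        using valley[OF a(1-3)] peak[OF a(1-3)] a(4,5) by linarith
    qed
  qed (use bounds in blast)+
qed

text \<open>Suppose the column \<open>j\<close> starts above both others. As \<open>k\<close> is not
  below \<open>j\<close>, the cell just under column \<open>j\<close> has a counterpart in column
  \<open>k\<close>; by connectivity it also has one between \<open>i\<close> and \<open>j\<close>.
  Row convexity then puts that cell into column \<open>j\<close>.\<close>

lemma ascending_cols_valley:
  assumes cs: "ascending_cols cs h" and ijk: "i < j" "j < k" "k < length cs"
  shows "fst (cs ! j) \<le> max (fst (cs ! i)) (fst (cs ! k))"
proof (rule ccontr)
  assume neg: "\<not> ?thesis"
  then have l: "fst (cs ! i) < fst (cs ! j)" "fst (cs ! k) < fst (cs ! j)" by auto
  have "\<not> below (cs ! k) (cs ! j)" using cs ijk by (simp add: ascending_cols_def)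
  then have "snd (cs ! j) \<le> snd (cs ! k)" using l by (simp add: below_def)
  then have k: "(int k, fst (cs ! j) - 1) \<in> cells cs"
    using l ascending_cols_nth[OF cs, of j] ijk by simp
  have "(int i, fst (cs ! i)) \<in> cells cs" "(int j, fst (cs ! j)) \<in> cells cs"
    using ascending_cols_nth[OF cs, of i] ascending_cols_nth[OF cs, of j] ijk by simp_all
  then obtain x where x: "int i \<le> x" "x \<le> int j" "(x, fst (cs ! j) - 1) \<in> cells cs"
    using column_between[OF convex_cells[OF cs], of "int i" "fst (cs ! i)" "int j" "fst (cs ! j)" "fst (cs ! j) - 1"] l ijk by auto
  then have "(int j, fst (cs ! j) - 1) \<in> cells cs"
    using convex_row[OF convex_cells[OF cs], of x "fst (cs ! j) - 1" "int k" "int j"] k ijk by simp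
  then show False by simp
qed

text \<open>The mirror image of the valley: the row just above column \<open>j\<close> is met by
  column \<open>i\<close>, because \<open>j\<close> is not below \<open>i\<close>, and by some
  column from \<open>j\<close> to \<open>k\<close>.\<close>

lemma ascending_cols_peak:
  assumes cs: "ascending_cols cs h" and ijk: "i < j" "j < k" "k < length cs"
  shows "min (snd (cs ! i)) (snd (cs ! k)) \<le> snd (cs ! j)"
proof (rule ccontr)
  assume neg: "\<not> ?thesis"
  then have u: "snd (cs ! j) < snd (cs ! i)" "snd (cs ! j) < snd (cs ! k)" by auto
  have "\<not> below (cs ! j) (cs ! i)" using cs ijk by (simp add: ascending_cols_def)
  then have "fst (cs ! i) \<le> fst (cs ! j)" using u by (simp add: below_def)
  then have i: "(int i, snd (cs ! j)) \<in> cells cs"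
    using u ascending_cols_nth[OF cs, of j] ijk by simp
  have "(int j, snd (cs ! j) - 1) \<in> cells cs" "(int k, snd (cs ! k) - 1) \<in> cells cs"
    using ascending_cols_nth[OF cs, of j] ascending_cols_nth[OF cs, of k] ijk by simp_all
  then obtain x where x: "int j \<le> x" "x \<le> int k" "(x, snd (cs ! j)) \<in> cells cs"
    using column_between[OF convex_cells[OF cs], of "int j" "snd (cs ! j) - 1" "int k" "snd (cs ! k) - 1" "snd (cs ! j)"] u ijk by auto
  then have "(int j, snd (cs ! j)) \<in> cells cs"
    using convex_row[OF convex_cells[OF cs], of "int i" "snd (cs ! j)" x "int j"] i ijk by simp
  then show False by simp
qed

lemma ascending_cols_split:
  assumes cs: "ascending_cols cs h" and n: "int (length cs) + h = int n"
  obtains G M H where "(G, M, H) \<in> triples n" "\<not> crossing G H" "cs = rev G @ M @ H"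
proof -
  define p where "p = (LEAST i. i < length cs \<and> fst (cs ! i) = 0)"
  have "\<exists>i. i < length cs \<and> fst (cs ! i) = 0"
    using cs unfolding ascending_cols_def by (metis in_set_conv_nth)
  then have p: "p < length cs" "fst (cs ! p) = 0" unfolding p_def by (metis (mono_tags, lifting) LeastI)+
  have before: "0 < fst (cs ! i)" if "i < p" for i
    using not_less_Least[OF that[unfolded p_def]] ascending_cols_nth(1)[OF cs, of i] that p by force
  define q where "q = (GREATEST i. i < length cs \<and> snd (cs ! i) = h)"
  have ex: "\<exists>i. i < length cs \<and> snd (cs ! i) = h"
    using cs unfolding ascending_cols_def by (metis in_set_conv_nth)
  have bd: "\<forall>i. i < length cs \<and> snd (cs ! i) = h \<longrightarrow> i \<le> length cs" by simp
  have q: "q < length cs" "snd (cs ! q) = h" using GreatestI_ex_nat[OF ex bd[rule_format]] by (simp_all add: q_def)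
  have after: "snd (cs ! i) < h" if "q < i" "i < length cs" for i
  proof -
    have "snd (cs ! i) \<noteq> h"
      using Greatest_le_nat[of "\<lambda>i. i < length cs \<and> snd (cs ! i) = h" i "length cs"] that by (auto simp: q_def)
    then show ?thesis using ascending_cols_nth(3)[OF cs that(2)] by simp
  qed
  have nb: "\<not> below (cs ! j) (cs ! i)" if "i < j" "j < length cs" for i j
    using cs that by (simp add: ascending_cols_def)
  \<comment> \<open>If every column on the top line came before the first one on the bottom line,
    \<open>cs ! p\<close> would be below the more western \<open>cs ! q\<close>.\<close>
  have pq: "p \<le> q"
  proof (rule ccontr)
    assume "\<not> p \<le> q"
    then have "below (cs ! p) (cs ! q)" using before[of q] after[of p] p q by (simp add: below_def)
    then show False using nb[of q p] \<open>\<not> p \<le> q\<close> p by simp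
  qed
  have l1: "fst (cs ! j) \<le> fst (cs ! i)" if "i \<le> j" "j \<le> p" for i j
    using ascending_cols_valley[OF cs, of i j p] ascending_cols_nth(1)[OF cs, of i] p that
    by (cases "i = j"; cases "j = p") auto
  have l2: "fst (cs ! i) \<le> fst (cs ! j)" if "p \<le> i" "i \<le> j" "j < length cs" for i j
    using ascending_cols_valley[OF cs, of p i j] ascending_cols_nth(1)[OF cs, of j] p that
    by (cases "i = j"; cases "i = p") auto
  have u1: "snd (cs ! i) \<le> snd (cs ! j)" if "i \<le> j" "j \<le> q" for i j
    using ascending_cols_peak[OF cs, of i j q] ascending_cols_nth(3)[OF cs, of i] q that
    by (cases "i = j"; cases "j = q") auto
  have u2: "snd (cs ! j) \<le> snd (cs ! i)" if "q \<le> i" "i \<le> j" "j < length cs" for i j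
    using ascending_cols_peak[OF cs, of q i j] ascending_cols_nth(3)[OF cs, of j] q that
    by (cases "i = j"; cases "i = q") auto
  define G M H where "G = rev (take p cs)" and "M = take (Suc q - p) (drop p cs)" and "H = drop (Suc q) cs"
  have len: "length G = p" "length M = Suc q - p" "length H = length cs - Suc q"
    using p q pq by (simp_all add: G_def M_def H_def)
  have split: "cs = rev G @ M @ H"
  proof -
    have "drop p cs = M @ drop (Suc q - p) (drop p cs)" unfolding M_def by (rule append_take_drop_id[symmetric])
    also have "drop (Suc q - p) (drop p cs) = H" unfolding H_def using pq by simp
    finally show ?thesis using append_take_drop_id[of p cs] by (simp add: G_def)
  qed
  have nthM: "M ! i = cs ! (p + i)" if "i < Suc q - p" for i using that p by (simp add: M_def)
  have nthH: "H ! i = cs ! (Suc q + i)" for i using q by (simp add: H_def)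
  have ne: "M \<noteq> []" using len pq by auto
  have hdM: "hd M = cs ! p" using nthM[of 0] ne pq by (simp add: hd_conv_nth)
  have lastM: "last M = cs ! q" using nthM[of "q - p"] ne pq len by (simp add: last_conv_nth)
  have memG: "\<exists>i<p. c = cs ! i" if "c \<in> set G" for c
    using that p by (auto simp: G_def in_set_conv_nth)
  have memM: "\<exists>i. p \<le> i \<and> i \<le> q \<and> c = cs ! i" if "c \<in> set M" for c
  proof -
    obtain i where i: "i < Suc q - p" "c = M ! i" using \<open>c \<in> set M\<close> len by (metis in_set_conv_nth)
    show ?thesis using i nthM[OF i(1)] by (intro exI[of _ "p + i"]) auto
  qed
  have memH: "\<exists>i. q < i \<and> i < length cs \<and> c = cs ! i" if "c \<in> set H" for c
  proof -
    obtain i where i: "i < length cs - Suc q" "c = H ! i" using \<open>c \<in> set H\<close> len by (metis in_set_conv_nth)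
    show ?thesis using i nthH[of i] by (intro exI[of _ "Suc q + i"]) auto
  qed
  have "nested 1 (snd (hd M)) G"
    unfolding nested_iff_sorted
  proof (intro conjI ballI)
    show "sorted (map fst G)"
      unfolding G_def rev_map[symmetric] sorted_rev_iff_nth_mono using l1 p by simp
    show "sorted (rev (map snd G))"
      unfolding G_def rev_map rev_rev_ident sorted_iff_nth_mono using u1 p pq by simp
    fix c assume "c \<in> set G"
    then obtain i where i: "i < p" "c = cs ! i" using memG by blast
    then show "1 \<le> fst c" "fst c < snd c" "snd c \<le> snd (hd M)"
      using before[of i] ascending_cols_nth(2)[OF cs, of i] u1[of i p] pq p hdM by simp_all
  qed
  moreover have "nested (fst (last M)) (snd (last M) - 1) H"
    unfolding nested_iff_sorted
  proof (intro conjI ballI)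
    show "sorted (map fst H)"
      unfolding sorted_iff_nth_mono using l2 pq len nthH by simp
    show "sorted (rev (map snd H))"
      unfolding sorted_rev_iff_nth_mono using u2 len nthH by simp
    fix c assume "c \<in> set H"
    then obtain i where i: "q < i" "i < length cs" "c = cs ! i" using memH by blast
    then show "fst (last M) \<le> fst c" "fst c < snd c" "snd c \<le> snd (last M) - 1"
      using after[of i] ascending_cols_nth(2)[OF cs, of i] l2[of q i] pq q lastM by simp_all
  qed
  moreover have "para M"
    unfolding para_def successively_slant
  proof (intro conjI ballI)
    show "M \<noteq> []" "fst (hd M) = 0" using ne hdM p by simp_all
    show "sorted (map fst M)"
      unfolding sorted_iff_nth_mono using l2 len nthM q by simp
    show "sorted (map snd M)"
      unfolding sorted_iff_nth_mono using u1 len nthM by simp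
    show "successively (\<lambda>c d. fst d < snd c) M"
      unfolding successively_conv_nth
    proof (intro allI impI)
      fix i assume i: "Suc i < length M"
      then have "Suc (p + i) < length cs" using len q by simp
      then have "overlap (cs ! (p + i)) (cs ! Suc (p + i))" using cs by (simp add: ascending_cols_def)
      then show "fst (M ! Suc i) < snd (M ! i)" using i nthM[of i] nthM[of "Suc i"] len by (simp add: overlap_def)
    qed
    fix c assume "c \<in> set M"
    then obtain i where "i \<le> q" "c = cs ! i" using memM by blast
    then show "fst c < snd c" using ascending_cols_nth(2)[OF cs, of i] q by simp
  qed
  moreover have "int (length G + length M + length H) + snd (last M) = int n"
    using n q pq len lastM by simp
  ultimately have "(G, M, H) \<in> triples n" by (simp add: triples_def)
  moreover have "\<not> crossing G H"
  proof
    assume "crossing G H"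
    then obtain g c where gc: "g \<in> set G" "c \<in> set H" "below c g" by (auto simp: crossing_def)
    obtain i j where "i < p" "g = cs ! i" "q < j" "j < length cs" "c = cs ! j" using memG[OF gc(1)] memH[OF gc(2)] by blast
    then show False using nb[of i j] gc(3) pq by simp
  qed
  ultimately show ?thesis using that split by blast
qed

text \<open>Both cuts can be recovered from the concatenated list and \<open>n\<close>, since the
  height is \<open>n\<close> minus the number of columns. This gives injectivity in
  \<open>card_ascending_cols\<close>.\<close>

lemma triples_takeWhile:
  assumes "(G, M, H) \<in> triples n"
  defines "cs \<equiv> rev G @ M @ H"
  shows "takeWhile (\<lambda>c. fst c \<noteq> 0) cs = rev G"
    "takeWhile (\<lambda>c. snd c \<noteq> int n - int (length cs)) (rev cs) = rev H"
proof -
  have M: "para M" and G: "nested 1 (snd (hd M)) G" and H: "nested (fst (last M)) (snd (last M) - 1) H"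
    and h: "int n - int (length cs) = snd (last M)"
    using assms(1) by (simp_all add: triples_def cs_def)
  have ne: "M \<noteq> []" and hd0: "fst (hd M) = 0" using M by (simp_all add: para_def)
  have "takeWhile (\<lambda>c. fst c \<noteq> 0) (M @ H) = []" using ne hd0 by (cases M) auto
  moreover have "fst c \<noteq> 0" if "c \<in> set (rev G)" for c using nested_bounds(1)[OF G, of c] that by auto
  ultimately show "takeWhile (\<lambda>c. fst c \<noteq> 0) cs = rev G" unfolding cs_def using takeWhile_append2[of "rev G" "\<lambda>c. fst c \<noteq> 0" "M @ H"] by simp
  have "takeWhile (\<lambda>c. snd c \<noteq> snd (last M)) (rev M @ G) = []" using ne by (cases M rule: rev_cases) auto
  moreover have "snd c \<noteq> snd (last M)" if "c \<in> set (rev H)" for c using nested_bounds(3)[OF H, of c] that by auto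
  ultimately show "takeWhile (\<lambda>c. snd c \<noteq> int n - int (length cs)) (rev cs) = rev H"
    unfolding h unfolding cs_def using takeWhile_append2[of "rev H" "\<lambda>c. snd c \<noteq> snd (last M)" "rev M @ G"] by simp
qed

lemma card_ascending_cols:
  "card {cs. \<exists>h. ascending_cols cs h \<and> int (length cs) + h = int n} = card (triples n - crossing_triples n)"
proof -
  let ?f = "\<lambda>(G, M, H). rev G @ M @ H"
  have "inj_on ?f (triples n - crossing_triples n)"
  proof (rule inj_onI)
    fix x y assume xy: "x \<in> triples n - crossing_triples n" "y \<in> triples n - crossing_triples n" "?f x = ?f y"
    obtain G M H where x: "x = (G, M, H)" using prod_cases3 by blast
    obtain G' M' H' where y: "y = (G', M', H')" using prod_cases3 by blast
    have eq: "rev G @ M @ H = rev G' @ M' @ H'" using xy(3) x y by simp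
    have mem: "(G, M, H) \<in> triples n" "(G', M', H') \<in> triples n" using xy x y by auto
    have "rev G = rev G'" "rev H = rev H'"
      using triples_takeWhile[OF mem(1)] triples_takeWhile[OF mem(2)] unfolding eq by simp_all
    then show "x = y" using eq x y by simp
  qed
  moreover have "?f ` (triples n - crossing_triples n) = {cs. \<exists>h. ascending_cols cs h \<and> int (length cs) + h = int n}"
  proof (intro equalityI subsetI)
    fix cs assume "cs \<in> ?f ` (triples n - crossing_triples n)"
    then obtain G M H where t: "(G, M, H) \<in> triples n" "(G, M, H) \<notin> crossing_triples n" and cs: "cs = rev G @ M @ H" by auto
    then have "ascending_cols cs (snd (last M))" using ascending_cols_triples by (simp add: crossing_triples_def)
    moreover have "int (length cs) + snd (last M) = int n" using t(1) cs by (simp add: triples_def)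
    ultimately show "cs \<in> {cs. \<exists>h. ascending_cols cs h \<and> int (length cs) + h = int n}" by blast
  next
    fix cs assume "cs \<in> {cs. \<exists>h. ascending_cols cs h \<and> int (length cs) + h = int n}"
    then obtain h where h: "ascending_cols cs h" "int (length cs) + h = int n" by blast
    obtain G M H where GMH: "(G, M, H) \<in> triples n" "\<not> crossing G H" "cs = rev G @ M @ H"
      using ascending_cols_split[OF h] .
    then have "(G, M, H) \<in> triples n - crossing_triples n" by (simp add: crossing_triples_def)
    then show "cs \<in> ?f ` (triples n - crossing_triples n)" using GMH(3) by force
  qed
  ultimately have "bij_betw ?f (triples n - crossing_triples n) {cs. \<exists>h. ascending_cols cs h \<and> int (length cs) + h = int n}"
    unfolding bij_betw_def by blast
  then show ?thesis using bij_betw_same_card by fastforce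
qed

theorem theorem5:
  "ascending_gf =
     (let t = fps_X :: real fps in
        t^2 * (2 - 12 * t + 19 * t^2 - 4 * t^3) / (2 * (1 - 4 * t)^2)
        - t^4 * (5 - 8 * t) / (2 * (1 - 2 * t) * one_minus_4t_three_halves))"
proof -
  have "ascending_gf = triples_fps 1 - crossing_fps"
  proof (rule fps_ext)
    fix n
    have "crossing_triples n \<subseteq> triples n" by (auto simp: crossing_triples_def)
    then have "real (card (triples n - crossing_triples n)) = real (card (triples n)) - real (card (crossing_triples n))"
      using finite_triples[of n] by (simp add: card_Diff_subset finite_subset card_mono of_nat_diff)
    then show "fps_nth ascending_gf n = fps_nth (triples_fps 1 - crossing_fps) n"
      by (simp add: ascending_gf_def triples_fps_def crossing_fps_def triples_tail_1[unfolded One_nat_def] card_translation_classes card_ascending_cols)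
  qed
  then show ?thesis unfolding gf_identity .
qed

end
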